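(* Let $L>0$ and $\lambda>0$. For every time $T>0$ and every initial datum $y_0\in L^2(0,L)$ there exist two controls $u^1,u^2\in H^1(0,T)$ such that the solution $y$ of $$\begin{cases} y_t+\lambda y_{xx}+y_{xxxx}=0, & (t,x)\in(0,T)\times(0,L),\\ y(t,0)=u^1(t),\quad y_{xx}(t,0)=u^2(t), & t\in(0,T),\\ y_x(t,L)=y_{xxx}(t,L)=0, & t\in(0,T),\\ y(0,x)=y_0(x), & x\in(0,L),\end{cases}$$ satisfies $y(T,x)=0$ for all $x\in(0,L)$.
   Context: All functions are real-valued. Notion of solution: let $A\phi=\lambda\phi_{xx}+\phi_{xxxx}$ on $L^2(0,L)$ with domain $\{\phi\in H^4(0,L):\phi(0)=\phi_{xx}(0)=\phi_x(L)=\phi_{xxx}(L)=0\}$; $-A$ generates a strongly continuous semigroup. Fix $p_1,p_2\in C^\infty([0,L])$ with $p_1(0)=1$, $p_1''(0)=0$, $p_2(0)=0$, $p_2''(0)=1$ and $p_i'(L)=p_i'''(L)=0$ for $i=1,2$. For $y_0\in L^2(0,L)$ and $u^1,u^2\in H^1(0,T)$ the solution is $y=z+p_1u^1+p_2u^2\in C([0,T];L^2(0,L))$, where $z$ is the mild solution of $z_t+Az=-\sum_{i=1}^2\big(p_iu^i_t+(\lambda p_i''+p_i'''')u^i\big)$, $z(0)=y_0-p_1u^1(0)-p_2u^2(0)$ (independent of the choice of $p_1,p_2$). *)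

theory Defs
  imports "HOL-Analysis.Analysis"
begin

section \<open>The Hilbert space \<open>L\<^sup>2(\<real>)\<close>\<close>

definition square_integrable :: "(real \<Rightarrow> real) \<Rightarrow> bool" where
  "square_integrable f \<longleftrightarrow> f \<in> borel_measurable lborel \<and> integrable lborel (\<lambda>x. (f x)\<^sup>2)"

lemma square_integrable_mult:
  assumes "square_integrable f" "square_integrable g"
  shows "integrable lborel (\<lambda>x. f x * g x)"
proof (rule Bochner_Integration.integrable_bound)
  show "integrable lborel (\<lambda>x. (f x)\<^sup>2 + (g x)\<^sup>2)"
    using assms by (auto simp: square_integrable_def)
  show "(\<lambda>x. f x * g x) \<in> borel_measurable lborel"
    using assms by (auto simp: square_integrable_def)
  have "\<bar>a * b\<bar> \<le> a\<^sup>2 + b\<^sup>2" for a b :: real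
  proof -
    have "2 * (\<bar>a\<bar> * \<bar>b\<bar>) \<le> a\<^sup>2 + b\<^sup>2"
      using sum_squares_bound[of "\<bar>a\<bar>" "\<bar>b\<bar>"] by simp
    moreover have "0 \<le> \<bar>a\<bar> * \<bar>b\<bar>" by simp
    ultimately show ?thesis unfolding abs_mult by linarith
  qed
  then show "AE x in lborel. norm (f x * g x) \<le> norm ((f x)\<^sup>2 + (g x)\<^sup>2)"
    by simp
qed

lemma square_integrable_add:
  assumes "square_integrable f" "square_integrable g"
  shows "square_integrable (\<lambda>x. f x + g x)"
proof -
  have "integrable lborel (\<lambda>x. (f x)\<^sup>2 + (g x)\<^sup>2 + 2 * (f x * g x))"
    using square_integrable_mult[OF assms] assms by (auto simp: square_integrable_def)
  then show ?thesis
    using assms by (auto simp: square_integrable_def power2_sum mult.assoc)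
qed

lemma square_integrable_scale:
  "square_integrable f \<Longrightarrow> square_integrable (\<lambda>x. c * f x)"
  by (auto simp: square_integrable_def power_mult_distrib)

lemma square_integrable_zero: "square_integrable (\<lambda>x. 0)"
  by (simp add: square_integrable_def)

definition L2_rel :: "(real \<Rightarrow> real) \<Rightarrow> (real \<Rightarrow> real) \<Rightarrow> bool" where
  "L2_rel f g \<longleftrightarrow> square_integrable f \<and> square_integrable g \<and> (AE x in lborel. f x = g x)"

text \<open>
  Borel functions suffice, since every Lebesgue measurable function agrees almost everywhere with a
  Borel one. \<open>rep_L2\<close> picks some representative; it is only used in contexts invariant under change
  on a null set.
\<close>
quotient_type L2 = "real \<Rightarrow> real" / partial: L2_rel
proof (rule part_equivpI)
  show "\<exists>f. L2_rel f f"
    using square_integrable_zero by (auto simp: L2_rel_def)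
  show "symp L2_rel" by (auto simp: symp_def L2_rel_def eq_commute)
  show "transp L2_rel" by (auto simp: transp_def L2_rel_def)
qed

instantiation L2 :: real_vector
begin
lift_definition zero_L2 :: L2 is "\<lambda>x. 0"
  by (simp add: L2_rel_def square_integrable_zero)
lift_definition plus_L2 :: "L2 \<Rightarrow> L2 \<Rightarrow> L2" is "\<lambda>f g x. f x + g x"
  by (auto simp: L2_rel_def square_integrable_add)
lift_definition scaleR_L2 :: "real \<Rightarrow> L2 \<Rightarrow> L2" is "\<lambda>c f x. c * f x"
  by (auto simp: L2_rel_def square_integrable_scale)
definition uminus_L2 :: "L2 \<Rightarrow> L2" where "uminus_L2 f = (-1) *\<^sub>R f"
definition minus_L2 :: "L2 \<Rightarrow> L2 \<Rightarrow> L2" where "minus_L2 f g = f + (-1) *\<^sub>R g"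
instance
proof
  fix a b c :: L2 and r s :: real
  show "a + b + c = a + (b + c)"
    by transfer (auto simp: L2_rel_def square_integrable_add add.assoc)
  show "a + b = b + a"
    by transfer (auto simp: L2_rel_def square_integrable_add add.commute)
  show "0 + a = a"
    by transfer (auto simp: L2_rel_def)
  show "- a + a = 0"
    unfolding uminus_L2_def
    by transfer (auto simp: L2_rel_def square_integrable_zero intro: square_integrable_add square_integrable_scale
      square_integrable_scale[of _ "-1", simplified])
  show "a - b = a + - b"
    by (simp add: minus_L2_def uminus_L2_def)
  show "r *\<^sub>R (a + b) = r *\<^sub>R a + r *\<^sub>R b"
    by transfer (auto simp: L2_rel_def square_integrable_add square_integrable_scale distrib_left)
  show "(r + s) *\<^sub>R a = r *\<^sub>R a + s *\<^sub>R a"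
    by transfer (auto simp: L2_rel_def square_integrable_add square_integrable_scale distrib_right)
  show "r *\<^sub>R s *\<^sub>R a = (r * s) *\<^sub>R a"
    by transfer (auto simp: L2_rel_def square_integrable_scale mult.assoc)
  show "1 *\<^sub>R a = a"
    by transfer (auto simp: L2_rel_def)
qed
end

instantiation L2 :: real_inner
begin
lift_definition inner_L2 :: "L2 \<Rightarrow> L2 \<Rightarrow> real" is "\<lambda>f g. LINT x|lborel. f x * g x"
  by (rule integral_cong_AE) (auto simp: L2_rel_def square_integrable_def)
definition norm_L2 :: "L2 \<Rightarrow> real" where "norm_L2 f = sqrt (inner f f)"
definition dist_L2 :: "L2 \<Rightarrow> L2 \<Rightarrow> real" where "dist_L2 f g = norm (f - g)"
definition sgn_L2 :: "L2 \<Rightarrow> L2" where "sgn_L2 f = f /\<^sub>R norm f"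
definition uniformity_L2 :: "(L2 \<times> L2) filter" where
  "uniformity_L2 = (INF e\<in>{0<..}. principal {(x, y). dist x y < e})"
definition open_L2 :: "L2 set \<Rightarrow> bool" where
  "open_L2 U = (\<forall>x\<in>U. eventually (\<lambda>(x', y). x' = x \<longrightarrow> y \<in> U) uniformity)"
instance
proof
  fix a b c :: L2 and r :: real
  show "inner a b = inner b a"
    by transfer (simp add: mult.commute)
  show "inner (a + b) c = inner a c + inner b c"
    by transfer (simp add: distrib_right L2_rel_def square_integrable_mult)
  show "inner (r *\<^sub>R a) b = r * inner a b"
    by transfer (simp add: mult.assoc)
  show "inner a a \<ge> 0"
    by transfer (auto intro: integral_nonneg_AE)
  show "inner a a = 0 \<longleftrightarrow> a = 0"
  proof transfer
    fix f assume f: "L2_rel f f"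
    then have "integrable lborel (\<lambda>x. f x * f x)"
      by (auto simp: L2_rel_def square_integrable_mult)
    then show "(LINT x|lborel. f x * f x) = 0 \<longleftrightarrow> L2_rel f (\<lambda>x. 0)"
      using f by (subst integral_nonneg_eq_0_iff_AE) (auto simp: L2_rel_def square_integrable_zero)
  qed
  show "norm a = sqrt (inner a a)" by (rule norm_L2_def)
  show "sgn a = a /\<^sub>R norm a" by (rule sgn_L2_def)
  show "dist a b = norm (a - b)" by (rule dist_L2_def)
  show "(uniformity :: (L2 \<times> L2) filter) = (INF e\<in>{0<..}. principal {(x, y). dist x y < e})"
    by (rule uniformity_L2_def)
  show "open U \<longleftrightarrow> (\<forall>x\<in>U. eventually (\<lambda>(x', y). x' = x \<longrightarrow> y \<in> U) uniformity)" for U :: "L2 set"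
    by (rule open_L2_def)
qed
end


lemma L2_rel_refl: "square_integrable f \<Longrightarrow> L2_rel f f"
  by (simp add: L2_rel_def)

lemma square_integrable_rep: "square_integrable (rep_L2 f)"
  using Quotient3_rep_reflp[OF Quotient3_L2, of f] by (simp add: L2_rel_def)

lemma abs_rep_L2: "abs_L2 (rep_L2 f) = f"
  by (rule Quotient3_abs_rep[OF Quotient3_L2])

lemma abs_L2_cong:
  assumes "square_integrable f" "square_integrable g" "AE x in lborel. f x = g x"
  shows "abs_L2 f = abs_L2 g"
  using Quotient3_rel_abs[OF Quotient3_L2, of f g] assms by (simp add: L2_rel_def)

lemma rep_abs_L2: "square_integrable f \<Longrightarrow> AE x in lborel. rep_L2 (abs_L2 f) x = f x"
  using Quotient3_rep_abs[OF Quotient3_L2, of f] by (auto simp: L2_rel_def)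

lemma abs_L2_add:
  "square_integrable f \<Longrightarrow> square_integrable g \<Longrightarrow> abs_L2 f + abs_L2 g = abs_L2 (\<lambda>x. f x + g x)"
  by (simp add: plus_L2.abs_eq L2_rel_refl)

lemma abs_L2_scaleR: "square_integrable f \<Longrightarrow> c *\<^sub>R abs_L2 f = abs_L2 (\<lambda>x. c * f x)"
  by (simp add: scaleR_L2.abs_eq L2_rel_refl)

lemma abs_L2_zero: "abs_L2 (\<lambda>x. 0) = 0"
  by (simp add: zero_L2_def)

lemma square_integrable_diff:
  assumes "square_integrable f" "square_integrable g"
  shows "square_integrable (\<lambda>x. f x - g x)"
  using square_integrable_add[OF assms(1) square_integrable_scale[OF assms(2), of "-1"]] by simp

lemma abs_L2_diff:
  "square_integrable f \<Longrightarrow> square_integrable g \<Longrightarrow> abs_L2 f - abs_L2 g = abs_L2 (\<lambda>x. f x - g x)"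
  using square_integrable_scale[of g "-1"]
  unfolding minus_L2_def by (simp only: abs_L2_scaleR abs_L2_add) simp

lemma norm_abs_L2:
  "square_integrable f \<Longrightarrow> (norm (abs_L2 f))\<^sup>2 = (LINT x|lborel. (f x)\<^sup>2)"
  unfolding power2_norm_eq_inner
  by (simp add: inner_L2.abs_eq L2_rel_refl power2_eq_square)

lemma norm_L2_nn_integral:
  assumes "square_integrable f"
  shows "(\<integral>\<^sup>+x. ennreal ((f x)\<^sup>2) \<partial>lborel) = ennreal ((norm (abs_L2 f))\<^sup>2)"
  using assms unfolding norm_abs_L2[OF assms]
  by (intro nn_integral_eq_integral) (auto simp: square_integrable_def)

lemma square_integrable_bounded:
  assumes "f \<in> borel_measurable lborel" "square_integrable g" "AE x in lborel. \<bar>f x\<bar> \<le> \<bar>g x\<bar>"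
  shows "square_integrable f"
  unfolding square_integrable_def
proof
  show "integrable lborel (\<lambda>x. (f x)\<^sup>2)"
  proof (rule Bochner_Integration.integrable_bound)
    show "integrable lborel (\<lambda>x. (g x)\<^sup>2)"
      using assms(2) by (simp add: square_integrable_def)
    show "(\<lambda>x. (f x)\<^sup>2) \<in> borel_measurable lborel"
      using assms(1) by simp
    show "AE x in lborel. norm ((f x)\<^sup>2) \<le> norm ((g x)\<^sup>2)"
      using assms(3) by eventually_elim (simp add: abs_le_square_iff)
  qed
qed fact

lemma L2_dominated_convergence:
  assumes "\<And>i. s i \<in> borel_measurable lborel" "f \<in> borel_measurable lborel"
    and w: "square_integrable w"
    and lim: "AE x in lborel. (\<lambda>i. s i x) \<longlonglongrightarrow> f x"
    and bound: "\<And>i. AE x in lborel. \<bar>s i x\<bar> \<le> w x"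
  shows "square_integrable f" "\<And>i. square_integrable (s i)" "(\<lambda>i. abs_L2 (s i)) \<longlonglongrightarrow> abs_L2 f"
proof -
  have boundA: "AE x in lborel. \<forall>i. \<bar>s i x\<bar> \<le> w x"
    using bound by (simp add: AE_all_countable)
  have fw: "AE x in lborel. \<bar>f x\<bar> \<le> w x"
    using boundA lim
  proof eventually_elim
    case (elim x)
    then show ?case
      by (intro LIMSEQ_le_const2[OF tendsto_rabs[OF elim(2)]]) auto
  qed
  show f: "square_integrable f"
  proof (rule square_integrable_bounded[OF assms(2) w])
    show "AE x in lborel. \<bar>f x\<bar> \<le> \<bar>w x\<bar>"
      using fw by eventually_elim linarith
  qed
  show s: "square_integrable (s i)" for i
  proof (rule square_integrable_bounded[OF assms(1) w])
    show "AE x in lborel. \<bar>s i x\<bar> \<le> \<bar>w x\<bar>"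
      using bound[of i] by eventually_elim linarith
  qed
  have "(\<lambda>i. LINT x|lborel. (s i x - f x)\<^sup>2) \<longlonglongrightarrow> (LINT x::real|lborel. 0)"
  proof (rule integral_dominated_convergence[where w = "\<lambda>x. 4 * (w x)\<^sup>2"])
    note assms(1,2)[measurable]
    show "(\<lambda>x. 0::real) \<in> borel_measurable lborel" "(\<lambda>x. (s i x - f x)\<^sup>2) \<in> borel_measurable lborel" for i
      by measurable
    show "integrable lborel (\<lambda>x. 4 * (w x)\<^sup>2)"
      using w by (auto simp: square_integrable_def)
    show "AE x in lborel. (\<lambda>i. (s i x - f x)\<^sup>2) \<longlonglongrightarrow> 0"
      using lim
    proof eventually_elim
      case (elim x)
      have "(\<lambda>i. (s i x - f x)\<^sup>2) \<longlonglongrightarrow> (f x - f x)\<^sup>2"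
        by (intro tendsto_intros elim)
      then show ?case by simp
    qed
    show "AE x in lborel. norm ((s i x - f x)\<^sup>2) \<le> 4 * (w x)\<^sup>2" for i
      using bound[of i] fw
    proof eventually_elim
      case (elim x)
      then have "\<bar>s i x - f x\<bar> \<le> \<bar>2 * w x\<bar>" by linarith
      then have "(s i x - f x)\<^sup>2 \<le> (2 * w x)\<^sup>2" by (simp only: abs_le_square_iff)
      then show ?case by (simp add: power_mult_distrib)
    qed
  qed
  then have "(\<lambda>i. (norm (abs_L2 (s i) - abs_L2 f))\<^sup>2) \<longlonglongrightarrow> 0"
    by (simp add: abs_L2_diff[OF s f] norm_abs_L2[OF square_integrable_diff[OF s f]])
  then have "(\<lambda>i. sqrt ((norm (abs_L2 (s i) - abs_L2 f))\<^sup>2)) \<longlonglongrightarrow> sqrt 0"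
    by (rule tendsto_real_sqrt)
  then have "(\<lambda>i. norm (abs_L2 (s i) - abs_L2 f)) \<longlonglongrightarrow> 0"
    by simp
  then show "(\<lambda>i. abs_L2 (s i)) \<longlonglongrightarrow> abs_L2 f"
    by - (rule Lim_null[THEN iffD2], erule tendsto_norm_zero_cancel)
qed

instance L2 :: complete_space
proof
  fix X :: "nat \<Rightarrow> L2"
  assume X: "Cauchy X"
  define e where "e n = (1/4::real) ^ n" for n :: nat
  have "\<exists>N. \<forall>m\<ge>N. \<forall>k\<ge>N. dist (X m) (X k) < e n" for n
    by (rule metric_CauchyD[OF X]) (simp add: e_def)
  then have "\<exists>N. \<forall>n. \<forall>m\<ge>N n. \<forall>k\<ge>N n. dist (X m) (X k) < e n"
    by (intro choice allI)
  then obtain N where N: "\<And>n m k. m \<ge> N n \<Longrightarrow> k \<ge> N n \<Longrightarrow> dist (X m) (X k) < e n"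
    by blast
  define r where "r n = n + (\<Sum>k\<le>n. N k)" for n
  have r: "strict_mono r"
    by (rule strict_monoI_Suc) (simp add: r_def)
  have rN: "r n \<ge> N n" for n
    by (simp add: r_def trans_le_add2 member_le_sum)
  have close: "dist (X (r m)) (X (r n)) < e n" if "m \<ge> n" for m n
    by (rule N) (use that rN[of n] strict_mono_less_eq[OF r, of n m] in auto)
  define g where "g n = rep_L2 (X (r n))" for n
  have g: "square_integrable (g n)" for n
    by (simp add: g_def square_integrable_rep)
  have Xg: "X (r n) = abs_L2 (g n)" for n
    by (simp add: g_def abs_rep_L2)
  have [measurable]: "g n \<in> borel_measurable lborel" for n
    using g[of n] by (simp add: square_integrable_def)
  have nn: "(\<integral>\<^sup>+x. ennreal ((g m x - g n x)\<^sup>2) \<partial>lborel) \<le> ennreal ((e n)\<^sup>2)" if "m \<ge> n" for m n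
    using close[OF that]
    by (subst norm_L2_nn_integral)
       (auto intro!: ennreal_leI power_mono simp: square_integrable_diff g dist_norm Xg abs_L2_diff)
  have "(\<integral>\<^sup>+x. (\<Sum>n. ennreal (4 ^ n * (g (Suc n) x - g n x)\<^sup>2)) \<partial>lborel) =
      (\<Sum>n. \<integral>\<^sup>+x. ennreal (4 ^ n * (g (Suc n) x - g n x)\<^sup>2) \<partial>lborel)"
    by (intro nn_integral_suminf) measurable
  also have "\<dots> \<le> (\<Sum>n. ennreal ((1/4) ^ n))"
  proof (intro suminf_le summableI)
    fix n
    have "(\<integral>\<^sup>+x. ennreal (4 ^ n * (g (Suc n) x - g n x)\<^sup>2) \<partial>lborel)
        = ennreal (4 ^ n) * (\<integral>\<^sup>+x. ennreal ((g (Suc n) x - g n x)\<^sup>2) \<partial>lborel)"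
      by (simp add: ennreal_mult nn_integral_cmult)
    also have "\<dots> \<le> ennreal (4 ^ n) * ennreal ((e n)\<^sup>2)"
      by (intro mult_left_mono nn) auto
    also have "\<dots> = ennreal ((1/4) ^ n)"
      by (simp add: e_def ennreal_mult[symmetric] power2_eq_square power_mult_distrib[symmetric])
    finally show "(\<integral>\<^sup>+x. ennreal (4 ^ n * (g (Suc n) x - g n x)\<^sup>2) \<partial>lborel) \<le> ennreal ((1/4) ^ n)" .
  qed
  also have "\<dots> < \<infinity>"
    by (subst suminf_ennreal2) (auto intro: summable_geometric)
  finally have fin: "(\<integral>\<^sup>+x. (\<Sum>n. ennreal (4 ^ n * (g (Suc n) x - g n x)\<^sup>2)) \<partial>lborel) \<noteq> \<infinity>"
    by simp
  have "AE x in lborel. (\<Sum>n. ennreal (4 ^ n * (g (Suc n) x - g n x)\<^sup>2)) \<noteq> \<infinity>"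
    using fin by (intro nn_integral_noteq_infinite) auto
  then have conv: "AE x in lborel. convergent (\<lambda>n. g n x)"
  proof eventually_elim
    case (elim x)
    define a where "a n = 4 ^ n * (g (Suc n) x - g n x)\<^sup>2" for n
    define S where "S = (\<Sum>n. ennreal (a n))"
    have "S \<noteq> top"
      using elim by (simp only: S_def a_def infinity_ennreal_def not_False_eq_True)
    then obtain C where C: "S = ennreal C" "C \<ge> 0"
      by (cases S rule: ennreal_cases) auto
    have "norm (g (Suc n) x - g n x) \<le> sqrt C * (1/2) ^ n" for n
    proof -
      have "ennreal (a n) \<le> S"
        using sum_le_suminf[of "\<lambda>n. ennreal (a n)" "{n}"] by (simp add: S_def)
      then have "a n \<le> C"
        unfolding C(1) using C(2) by simp
      moreover have "a n = (2 ^ n * \<bar>g (Suc n) x - g n x\<bar>)\<^sup>2"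
      proof -
        have "(4::real) ^ n = (2 ^ n)\<^sup>2"
          by (simp flip: power_mult power_mult_distrib add: power2_eq_square)
        then show ?thesis
          by (simp only: a_def power_mult_distrib power2_abs)
      qed
      ultimately have "(2 ^ n * \<bar>g (Suc n) x - g n x\<bar>)\<^sup>2 \<le> C" by simp
      then have "2 ^ n * \<bar>g (Suc n) x - g n x\<bar> \<le> sqrt C"
        by (rule real_le_rsqrt)
      then show ?thesis
        by (simp add: power_one_over field_simps)
    qed
    moreover have "summable (\<lambda>n. sqrt C * (1/2) ^ n)"
      by (intro summable_mult summable_geometric) auto
    ultimately have "summable (\<lambda>n. g (Suc n) x - g n x)"
      by (blast intro: summable_comparison_test'[where N = 0])
    then have "convergent (\<lambda>n. \<Sum>k<n. g (Suc k) x - g k x)"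
      by (simp add: summable_iff_convergent)
    then have "convergent (\<lambda>n. g n x - g 0 x)"
      by (simp only: sum_lessThan_telescope[of "\<lambda>n. g n x"])
    then show ?case
      using convergent_add[OF _ convergent_const, of "\<lambda>n. g n x - g 0 x" "g 0 x"] by simp
  qed
  define G where "G x = lim (\<lambda>n. g n x)" for x
  have [measurable]: "G \<in> borel_measurable lborel"
    unfolding G_def by measurable
  have lim: "AE x in lborel. (\<lambda>n. g n x) \<longlonglongrightarrow> G x"
    using conv by eventually_elim (simp add: G_def convergent_LIMSEQ_iff)
  have Gn: "(\<integral>\<^sup>+x. ennreal ((G x - g n x)\<^sup>2) \<partial>lborel) \<le> ennreal ((e n)\<^sup>2)" for n
  proof -
    have "(\<integral>\<^sup>+x. ennreal ((G x - g n x)\<^sup>2) \<partial>lborel)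
        = (\<integral>\<^sup>+x. liminf (\<lambda>m. ennreal ((g m x - g n x)\<^sup>2)) \<partial>lborel)"
    proof (rule nn_integral_cong_AE)
      show "AE x in lborel. ennreal ((G x - g n x)\<^sup>2) = liminf (\<lambda>m. ennreal ((g m x - g n x)\<^sup>2))"
        using lim
      proof eventually_elim
        case (elim x)
        have "(\<lambda>m. ennreal ((g m x - g n x)\<^sup>2)) \<longlonglongrightarrow> ennreal ((G x - g n x)\<^sup>2)"
          by (intro tendsto_intros elim)
        then show ?case
          using lim_imp_Liminf[OF sequentially_bot] by metis
      qed
    qed
    also have "\<dots> \<le> liminf (\<lambda>m. \<integral>\<^sup>+x. ennreal ((g m x - g n x)\<^sup>2) \<partial>lborel)"
      by (rule nn_integral_liminf) measurable
    also have "\<dots> \<le> limsup (\<lambda>m. \<integral>\<^sup>+x. ennreal ((g m x - g n x)\<^sup>2) \<partial>lborel)"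
      by (rule Liminf_le_Limsup) simp
    also have "\<dots> \<le> ennreal ((e n)\<^sup>2)"
      by (rule Limsup_bounded) (auto intro!: eventually_sequentiallyI[of n] nn)
    finally show ?thesis .
  qed
  have Gg: "square_integrable (\<lambda>x. G x - g n x)" for n
    unfolding square_integrable_def
  proof
    show "integrable lborel (\<lambda>x. (G x - g n x)\<^sup>2)"
      using le_less_trans[OF Gn[of n]] by (intro integrableI_bounded) auto
  qed measurable
  have G: "square_integrable G"
    using square_integrable_add[OF Gg[of 0] g[of 0]] by simp
  have "norm (X (r n) - abs_L2 G) \<le> e n" for n
  proof -
    have "ennreal ((norm (abs_L2 G - X (r n)))\<^sup>2) \<le> ennreal ((e n)\<^sup>2)"
      unfolding Xg abs_L2_diff[OF G g] norm_L2_nn_integral[OF Gg, symmetric] by (rule Gn)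
    then have "(norm (abs_L2 G - X (r n)))\<^sup>2 \<le> (e n)\<^sup>2"
      by (simp add: e_def)
    then show ?thesis
      by (subst norm_minus_commute, rule power2_le_imp_le) (auto simp: e_def)
  qed
  moreover have "e \<longlonglongrightarrow> 0"
    unfolding e_def by (intro LIMSEQ_realpow_zero) auto
  ultimately have "(\<lambda>n. X (r n) - abs_L2 G) \<longlonglongrightarrow> 0"
    by (auto intro: Lim_null_comparison[where g = e])
  then have "(X \<circ> r) \<longlonglongrightarrow> abs_L2 G"
    by (simp add: LIM_zero_iff comp_def)
  then show "convergent X"
    using Cauchy_converges_subseq[OF X r] by (auto simp: convergent_def)
qed

instance L2 :: banach ..

lemma closure_limI:
  fixes S :: "'a::metric_space set"
  assumes "s \<longlonglongrightarrow> l" "\<And>n. s n \<in> S"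
  shows "l \<in> closure S"
  unfolding closure_sequential using assms by (intro exI[of _ s]) simp

lemma square_integrable_indicator:
  assumes "A \<in> sets lborel"
  shows "square_integrable (indicator (A \<inter> {- real n<..<real n}))"
proof -
  have "(indicator (A \<inter> {- real n<..<real n}) x :: real)\<^sup>2 = indicator (A \<inter> {- real n<..<real n}) x" for x
    by (simp add: indicator_def)
  moreover have "A \<inter> {- real n<..<real n} \<in> sets lborel"
    using assms by auto
  moreover have "emeasure lborel (A \<inter> {- real n<..<real n}) < \<infinity>"
  proof (rule le_less_trans)
    show "emeasure lborel (A \<inter> {- real n<..<real n}) \<le> emeasure lborel {- real n<..<real n}"
      by (rule emeasure_mono) auto
    show "emeasure lborel {- real n<..<real n} < \<infinity>"
      by simp
  qed
  ultimately show ?thesis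
    by (auto simp: square_integrable_def)
qed

lemma square_integrable_interval: "square_integrable (indicator {a<..<b})"
proof -
  have "(indicator {a<..<b} x :: real)\<^sup>2 = indicator {a<..<b} x" for x
    by (simp add: indicator_def)
  then show ?thesis
    by (simp add: square_integrable_def emeasure_lborel_box_eq flip: box_real)
qed

definition rat_step :: "(rat \<times> rat \<times> rat) list \<Rightarrow> L2" where
  "rat_step l = (\<Sum>(q, a, b)\<leftarrow>l. of_rat q *\<^sub>R abs_L2 (indicator {of_rat a<..<of_rat b}))"

lemma closure_rat_step_add:
  assumes "f \<in> closure (range rat_step)" "g \<in> closure (range rat_step)"
  shows "f + g \<in> closure (range rat_step)"
proof -
  obtain s t where s: "\<And>n. s n \<in> range rat_step" "s \<longlonglongrightarrow> f"
    and t: "\<And>n. t n \<in> range rat_step" "t \<longlonglongrightarrow> g"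
    using assms unfolding closure_sequential by blast
  have "rat_step l + rat_step m = rat_step (l @ m)" for l m
    by (simp add: rat_step_def)
  then have "s n + t n \<in> range rat_step" for n
    using s(1)[of n] t(1)[of n] by auto
  then show ?thesis
    using tendsto_add[OF s(2) t(2)] by (rule closure_limI[rotated])
qed

lemma closure_rat_step_scaleR:
  assumes "f \<in> closure (range rat_step)"
  shows "c *\<^sub>R f \<in> closure (range rat_step)"
proof -
  obtain s where s: "\<And>n. s n \<in> range rat_step" "s \<longlonglongrightarrow> f"
    using assms unfolding closure_sequential by blast
  have "\<exists>q. \<bar>of_rat q - c\<bar> < 1 / real (Suc n)" for n
  proof -
    have "c - 1 / real (Suc n) < c + 1 / real (Suc n)"
      by (simp add: add_pos_pos less_diff_eq algebra_simps)
    from of_rat_dense[OF this] obtain q where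
      "c - 1 / real (Suc n) < of_rat q" "of_rat q < c + 1 / real (Suc n)"
      by blast
    then have "\<bar>of_rat q - c\<bar> < 1 / real (Suc n)"
      unfolding abs_less_iff by linarith
    then show ?thesis ..
  qed
  then obtain q where q: "\<And>n. \<bar>of_rat (q n) - c\<bar> < 1 / real (Suc n)"
    by metis
  have "(\<lambda>n. of_rat (q n) - c) \<longlonglongrightarrow> 0"
    by (rule Lim_null_comparison[OF _ LIMSEQ_inverse_real_of_nat])
       (use q in \<open>auto intro!: always_eventually less_imp_le simp: inverse_eq_divide\<close>)
  then have "(\<lambda>n. of_rat (q n)) \<longlonglongrightarrow> c"
    by (rule LIM_zero_cancel)
  then have "(\<lambda>n. of_rat (q n) *\<^sub>R s n) \<longlonglongrightarrow> c *\<^sub>R f"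
    by (intro tendsto_scaleR s)
  moreover have "of_rat q *\<^sub>R rat_step l = rat_step (map (\<lambda>(p, ab). (q * p, ab)) l)" for q l
    by (induction l) (auto simp: rat_step_def scaleR_add_right of_rat_mult)
  then have "of_rat (q n) *\<^sub>R s n \<in> range rat_step" for n
    using s(1)[of n] by auto
  ultimately show ?thesis
    by (rule closure_limI)
qed

lemma closure_rat_step_interval:
  "abs_L2 (indicator {a<..<b}) \<in> closure (range rat_step)"
proof -
  have "\<exists>p. a < of_rat p \<and> of_rat p < a + 1 / real (Suc n)" for n
    by (rule of_rat_dense) simp
  then obtain p where p: "\<And>n. a < of_rat (p n)" "\<And>n. of_rat (p n) < a + 1 / real (Suc n)"
    by metis
  have "\<exists>p. b - 1 / real (Suc n) < of_rat p \<and> of_rat p < b" for n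
    by (rule of_rat_dense) simp
  then obtain q where q: "\<And>n. b - 1 / real (Suc n) < of_rat (q n)" "\<And>n. of_rat (q n) < b"
    by metis
  have "(\<lambda>n. abs_L2 (indicator {of_rat (p n)<..<of_rat (q n)})) \<longlonglongrightarrow> abs_L2 (indicator {a<..<b})"
  proof (rule L2_dominated_convergence(3)[OF _ _ square_integrable_interval[of a b]])
    show "AE x in lborel. (\<lambda>i. indicator {of_rat (p i)<..<of_rat (q i)} x) \<longlonglongrightarrow> (indicator {a<..<b} x :: real)"
    proof (rule AE_I2)
      fix x :: real
      show "(\<lambda>i. indicator {of_rat (p i)<..<of_rat (q i)} x) \<longlonglongrightarrow> (indicator {a<..<b} x :: real)"
      proof (cases "x \<in> {a<..<b}")
        case True
        then have "\<forall>\<^sub>F n in sequentially. 1 / real (Suc n) < x - a"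
          "\<forall>\<^sub>F n in sequentially. 1 / real (Suc n) < b - x"
          using order_tendstoD(2)[OF LIMSEQ_inverse_real_of_nat] by (auto simp: inverse_eq_divide)
        then have "\<forall>\<^sub>F i in sequentially. indicator {of_rat (p i)<..<of_rat (q i)} x = (indicator {a<..<b} x :: real)"
        proof eventually_elim
          case (elim i)
          then have "x \<in> {of_rat (p i)<..<of_rat (q i)}"
            using p(2)[of i] q(1)[of i] by simp
          then show ?case using True by simp
        qed
        then show ?thesis by (rule tendsto_eventually)
      next
        case False
        then have "x \<notin> {of_rat (p i)<..<of_rat (q i)}" for i
          using p(1)[of i] q(2)[of i] by auto
        then show ?thesis using False by simp
      qed
    qed
    show "AE x in lborel. \<bar>indicator {of_rat (p i)<..<of_rat (q i)} x\<bar> \<le> (indicator {a<..<b} x :: real)" for i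
      using p(1)[of i] q(2)[of i] by (auto simp: indicator_def)
  qed auto
  moreover have "abs_L2 (indicator {of_rat a<..<of_rat b}) = rat_step [(1, a, b)]" for a b
    by (simp add: rat_step_def)
  then have "abs_L2 (indicator {of_rat (p n)<..<of_rat (q n)}) \<in> range rat_step" for n
    by auto
  ultimately show ?thesis
    by (rule closure_limI)
qed

lemma closure_rat_step_sum:
  fixes f :: "'i \<Rightarrow> real \<Rightarrow> real"
  assumes "finite I" "\<And>i. i \<in> I \<Longrightarrow> square_integrable (f i)"
    "\<And>i. i \<in> I \<Longrightarrow> abs_L2 (f i) \<in> closure (range rat_step)"
  shows "square_integrable (\<lambda>x. \<Sum>i\<in>I. f i x) \<and>
    abs_L2 (\<lambda>x. \<Sum>i\<in>I. f i x) \<in> closure (range rat_step)"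
  using assms
proof (induction I rule: finite_induct)
  case empty
  have "rat_step [] = 0" by (simp add: rat_step_def)
  then have "0 \<in> range rat_step" by (metis rangeI)
  then show ?case
    using closure_subset[of "range rat_step"] by (auto simp: abs_L2_zero square_integrable_zero)
next
  case (insert i I)
  then show ?case
    by (simp add: square_integrable_add closure_rat_step_add flip: abs_L2_add)
qed

lemma closure_rat_step_indicator:
  assumes "A \<in> sets lborel"
  shows "abs_L2 (indicator (A \<inter> {- real n<..<real n})) \<in> closure (range rat_step)"
proof -
  have "A \<in> sigma_sets UNIV (range (\<lambda>a::real. {..<a}))"
    using assms by (simp add: borel_Iio)
  have "Int_stable (range (\<lambda>a::real. {..<a}))"
  proof (rule Int_stableI)
    fix X Y assume "X \<in> range (\<lambda>a::real. {..<a})" "Y \<in> range (\<lambda>a::real. {..<a})"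
    then obtain a b where "X = {..<a}" "Y = {..<b}" by blast
    then have "X \<inter> Y = {..<min a b}" by auto
    then show "X \<inter> Y \<in> range (\<lambda>a::real. {..<a})" by simp
  qed
  moreover have "range (\<lambda>a::real. {..<a}) \<subseteq> Pow UNIV" by simp
  moreover note \<open>A \<in> sigma_sets UNIV _\<close>
  ultimately show ?thesis
  proof (induction rule: sigma_sets_induct_disjoint)
    case (basic A)
    then obtain a where "A = {..<a}" by auto
    then have "A \<inter> {- real n<..<real n} = {- real n<..<min a (real n)}" by auto
    then show ?case by (simp add: closure_rat_step_interval)
  next
    case empty
    have "{} \<inter> {- real n<..<real n} = {0<..<0}" by simp
    then show ?case by (metis closure_rat_step_interval)
  next
    case (compl A)
    then have A: "A \<in> sets lborel" by (simp add: borel_Iio)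
    let ?I = "{- real n<..<real n}"
    have "abs_L2 (indicator ?I) + (-1) *\<^sub>R abs_L2 (indicator (A \<inter> ?I)) \<in> closure (range rat_step)"
      by (intro closure_rat_step_add closure_rat_step_scaleR closure_rat_step_interval compl)
    also have "abs_L2 (indicator ?I) + (-1) *\<^sub>R abs_L2 (indicator (A \<inter> ?I)) =
        abs_L2 (\<lambda>x. indicator ?I x + (-1) * indicator (A \<inter> ?I) x)"
      by (simp only: abs_L2_scaleR abs_L2_add square_integrable_interval square_integrable_indicator[OF A]
        square_integrable_scale)
    also have "(\<lambda>x. indicator ?I x + (-1) * indicator (A \<inter> ?I) x) = (indicator ((UNIV - A) \<inter> ?I) :: real \<Rightarrow> real)"
      by (auto simp: indicator_def)
    finally show ?case .
  next
    case (union A)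
    then have A: "A i \<in> sets lborel" for i by (auto simp: borel_Iio)
    let ?I = "{- real n<..<real n}"
    have sum: "(\<lambda>x. \<Sum>i<k. indicator (A i \<inter> ?I) x) = (indicator (\<Union>i<k. A i \<inter> ?I) :: real \<Rightarrow> real)" for k
    proof -
      have "disjoint_family_on (\<lambda>i. A i \<inter> ?I) {..<k}"
        using union(1) by (auto simp: disjoint_family_on_def)
      then show ?thesis
        by (intro ext) (simp only: indicator_UN_disjoint finite_lessThan)
    qed
    have "(\<lambda>k. abs_L2 (indicator (\<Union>i<k. A i \<inter> ?I))) \<longlonglongrightarrow> abs_L2 (indicator (\<Union>i. A i \<inter> ?I))"
    proof (rule L2_dominated_convergence(3)[OF _ _ square_integrable_interval[of "- real n" "real n"]])
      show "AE x in lborel. (\<lambda>k. indicator (\<Union>i<k. A i \<inter> ?I) x) \<longlonglongrightarrow> (indicator (\<Union>i. A i \<inter> ?I) x :: real)"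
        by (intro AE_I2 LIMSEQ_indicator_UN)
      show "AE x in lborel. \<bar>indicator (\<Union>i<k. A i \<inter> ?I) x\<bar> \<le> (indicator ?I x :: real)" for k
        by (intro AE_I2) (auto simp: indicator_def)
      show "indicator (\<Union>i. A i \<inter> ?I) \<in> borel_measurable lborel"
        "indicator (\<Union>i<k. A i \<inter> ?I) \<in> borel_measurable lborel" for k
        using A by (auto intro!: borel_measurable_indicator)
    qed
    moreover have "abs_L2 (indicator (\<Union>i<k. A i \<inter> ?I)) \<in> closure (range rat_step)" for k
      using closure_rat_step_sum[of "{..<k}" "\<lambda>i. indicator (A i \<inter> ?I)"] union(3) A
      by (simp add: sum square_integrable_indicator)
    ultimately have "abs_L2 (indicator (\<Union>i. A i \<inter> ?I)) \<in> closure (closure (range rat_step))"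
      by (rule closure_limI)
    moreover have "(\<Union>i. A i \<inter> ?I) = (\<Union>i. A i) \<inter> ?I" by auto
    ultimately show ?case by simp
  qed
qed

lemma closure_rat_step: "closure (range rat_step) = UNIV"
proof -
  have "abs_L2 f \<in> closure (range rat_step)" if f: "square_integrable f" for f
  proof -
    have [measurable]: "f \<in> borel_measurable lborel"
      using f by (simp add: square_integrable_def)
    obtain F where F: "\<And>i. simple_function lborel (F i)" "\<And>x. (\<lambda>i. F i x) \<longlonglongrightarrow> f x"
      and bound: "\<And>i x. \<bar>F i x\<bar> \<le> 2 * \<bar>f x\<bar>"
      using borel_measurable_implies_sequence_metric[of f lborel 0] by auto
    have [measurable]: "F i \<in> borel_measurable lborel" for i
      using F(1) by (rule borel_measurable_simple_function)
    define s where "s n x = F n x * indicator {- real n<..<real n} x" for n x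
    have "(\<lambda>n. abs_L2 (s n)) \<longlonglongrightarrow> abs_L2 f"
    proof (rule L2_dominated_convergence(3))
      show "square_integrable (\<lambda>x. 2 * \<bar>f x\<bar>)"
        using f by (intro square_integrable_scale) (auto simp: square_integrable_def)
      show "AE x in lborel. (\<lambda>n. s n x) \<longlonglongrightarrow> f x"
      proof (rule AE_I2)
        fix x
        obtain N where N: "\<bar>x\<bar> < real N"
          using reals_Archimedean2 by blast
        have "\<forall>\<^sub>F n in sequentially. F n x = s n x"
          using eventually_ge_at_top[of N]
        proof eventually_elim
          case (elim n)
          then have "x \<in> {- real n<..<real n}" using N by auto
          then show ?case by (simp add: s_def)
        qed
        then show "(\<lambda>n. s n x) \<longlonglongrightarrow> f x"
          using F(2)[of x] by (rule Lim_transform_eventually[rotated])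
      qed
      show "AE x in lborel. \<bar>s n x\<bar> \<le> 2 * \<bar>f x\<bar>" for n
        using bound[of n] by (intro AE_I2) (auto simp: s_def indicator_def)
      show "s n \<in> borel_measurable lborel" for n
        unfolding s_def by measurable
    qed measurable
    moreover have "abs_L2 (s n) \<in> closure (range rat_step)" for n
    proof -
      let ?A = "\<lambda>y. F n -` {y} \<inter> {- real n<..<real n}"
      have A: "F n -` {y} \<in> sets lborel" for y
        using simple_functionD(2)[OF F(1), of n "{y}"] by simp
      have "s n = (\<lambda>x. \<Sum>y\<in>range (F n). y * indicator (?A y) x)"
      proof
        fix x
        have "(\<Sum>y\<in>range (F n). y * indicator (?A y) x) = (\<Sum>y\<in>{F n x}. y * indicator (?A y) x)"
          using simple_functionD(1)[OF F(1), of n] by (intro sum.mono_neutral_right) auto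
        then show "s n x = (\<Sum>y\<in>range (F n). y * indicator (?A y) x)"
          by (simp add: s_def indicator_def)
      qed
      moreover have "abs_L2 (\<lambda>x. \<Sum>y\<in>range (F n). y * indicator (?A y) x) \<in> closure (range rat_step)"
      proof (rule closure_rat_step_sum[THEN conjunct2])
        show "finite (range (F n))"
          using simple_functionD(1)[OF F(1), of n] by simp
        show "square_integrable (\<lambda>x. y * indicator (?A y) x)" for y
          by (rule square_integrable_scale[OF square_integrable_indicator[OF A]])
        show "abs_L2 (\<lambda>x. y * indicator (?A y) x) \<in> closure (range rat_step)" for y
          using closure_rat_step_scaleR[OF closure_rat_step_indicator[OF A], of y]
          by (simp only: abs_L2_scaleR[OF square_integrable_indicator[OF A]])
      qed
      ultimately show ?thesis by simp
    qed
    ultimately have "abs_L2 f \<in> closure (closure (range rat_step))"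
      by (rule closure_limI)
    then show ?thesis by simp
  qed
  then show ?thesis
    using abs_rep_L2 square_integrable_rep by (metis UNIV_eq_I)
qed

instance L2 :: second_countable_topology
proof
  define B where "B = (\<lambda>(l, n). ball (rat_step l) (1 / real (Suc n))) ` UNIV"
  have "topological_basis B"
  proof (rule topological_basisI)
    show "open U" if "U \<in> B" for U
      using that by (auto simp: B_def)
    fix U :: "L2 set" and f
    assume "open U" "f \<in> U"
    then obtain e where e: "e > 0" "ball f e \<subseteq> U"
      unfolding open_contains_ball by blast
    obtain n where n: "1 / real (Suc n) < e / 2"
      using nat_approx_posE[of "e / 2"] e(1) by auto
    have "f \<in> closure (range rat_step)"
      by (simp add: closure_rat_step)
    then obtain l where l: "dist (rat_step l) f < 1 / real (Suc n)"
      unfolding closure_approachable by (metis imageE of_nat_0_less_iff zero_less_Suc zero_less_divide_1_iff)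
    have "ball (rat_step l) (1 / real (Suc n)) \<subseteq> ball f e"
    proof
      fix g assume "g \<in> ball (rat_step l) (1 / real (Suc n))"
      then have "dist (rat_step l) g < 1 / real (Suc n)" by simp
      then have "dist f g < e"
        using l n dist_triangle[of f g "rat_step l"] by (simp add: dist_commute)
      then show "g \<in> ball f e" by simp
    qed
    moreover have "ball (rat_step l) (1 / real (Suc n)) \<in> B"
      by (auto simp: B_def)
    ultimately show "\<exists>U'\<in>B. f \<in> U' \<and> U' \<subseteq> U"
      using l e(2) by (intro bexI[of _ "ball (rat_step l) (1 / real (Suc n))"]) auto
  qed
  moreover have "countable B"
    by (simp add: B_def)
  ultimately show "\<exists>B::L2 set set. countable B \<and> open = generate_topology B"
    using topological_basis_imp_subbasis by blast
qed


section \<open>Square-integrable functions and Sobolev spaces on an interval\<close>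

text \<open>
  \<open>L\<^sup>2(0,b)\<close> is the closed subspace of \<open>L\<^sup>2(\<real>)\<close> of classes vanishing outside \<open>(0,b)\<close>.
\<close>
definition L2_on :: "real \<Rightarrow> L2 set" where
  "L2_on b = {f. AE x in lborel. x \<notin> {0<..<b} \<longrightarrow> rep_L2 f x = 0}"

text \<open>The class in \<open>L\<^sup>2(0,b)\<close> of a function given on \<open>[0,b]\<close>; meaningful when it is square integrable there.\<close>
definition L2_of :: "real \<Rightarrow> (real \<Rightarrow> real) \<Rightarrow> L2" where
  "L2_of b f = abs_L2 (\<lambda>x. indicator {0<..<b} x * f x)"

text \<open>
  Test functions are \<open>C\<^sup>1\<close> with compact support in \<open>(0,b)\<close>, as in Brezis' treatment of Sobolev
  spaces in dimension one; \<open>C\<^sup>\<infinity>\<close> test functions give the same weak derivative.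
\<close>
definition test_function :: "real \<Rightarrow> (real \<Rightarrow> real) \<Rightarrow> bool" where
  "test_function b \<psi> \<longleftrightarrow>
     (\<forall>x. \<psi> differentiable (at x)) \<and> continuous_on UNIV (deriv \<psi>) \<and>
     (\<exists>K. compact K \<and> K \<subseteq> {0<..<b} \<and> (\<forall>x. x \<notin> K \<longrightarrow> \<psi> x = 0))"

definition has_weak_deriv :: "real \<Rightarrow> L2 \<Rightarrow> L2 \<Rightarrow> bool" where
  "has_weak_deriv b f g \<longleftrightarrow> f \<in> L2_on b \<and> g \<in> L2_on b \<and>
     (\<forall>\<psi>. test_function b \<psi> \<longrightarrow>
        (LINT x:{0<..<b}|lborel. rep_L2 f x * deriv \<psi> x) =
        - (LINT x:{0<..<b}|lborel. rep_L2 g x * \<psi> x))"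

definition weak_deriv :: "real \<Rightarrow> L2 \<Rightarrow> L2" where
  "weak_deriv b f = (THE g. has_weak_deriv b f g)"

text \<open>\<open>sobolev m b\<close> is \<open>H\<^sup>m(0,b)\<close>.\<close>
primrec sobolev :: "nat \<Rightarrow> real \<Rightarrow> L2 set" where
  "sobolev 0 b = L2_on b"
| "sobolev (Suc m) b = {f \<in> L2_on b. \<exists>g\<in>sobolev m b. has_weak_deriv b f g}"

text \<open>
  Value at \<open>x \<in> [0,b]\<close> of the continuous representative on \<open>[0,b]\<close>, which exists and is unique for
  classes in \<open>H\<^sup>1(0,b)\<close>. All boundary values and traces below are meant in this sense.
\<close>
definition point_value :: "real \<Rightarrow> L2 \<Rightarrow> real \<Rightarrow> real" where
  "point_value b f x = (THE v. \<exists>g. continuous_on {0..b} g \<and> L2_of b g = f \<and> g x = v)"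


section \<open>Strongly continuous semigroups and mild solutions\<close>

text \<open>
  The semigroup acts on a closed subspace \<open>X\<close>; the values of \<open>S t\<close> outside \<open>X\<close>, and of \<open>S t\<close> for
  \<open>t < 0\<close>, are irrelevant.
\<close>
definition C0_semigroup :: "'a::real_normed_vector set \<Rightarrow> (real \<Rightarrow> 'a \<Rightarrow> 'a) \<Rightarrow> bool" where
  "C0_semigroup X S \<longleftrightarrow>
     (\<forall>t\<ge>0. (\<forall>x\<in>X. S t x \<in> X) \<and>
        (\<forall>x\<in>X. \<forall>y\<in>X. S t (x + y) = S t x + S t y) \<and>
        (\<forall>c. \<forall>x\<in>X. S t (c *\<^sub>R x) = c *\<^sub>R S t x) \<and>
        (\<exists>K. \<forall>x\<in>X. norm (S t x) \<le> K * norm x)) \<and>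
     (\<forall>x\<in>X. S 0 x = x) \<and>
     (\<forall>s\<ge>0. \<forall>t\<ge>0. \<forall>x\<in>X. S (s + t) x = S s (S t x)) \<and>
     (\<forall>x\<in>X. ((\<lambda>t. S t x) \<longlongrightarrow> x) (at_right 0))"

text \<open>
  \<open>B\<close> with domain \<open>D\<close> is the generator of \<open>S\<close>: the difference quotients at \<open>x\<close> converge exactly when
  \<open>x \<in> D\<close>, and then their limit is \<open>B x\<close>.
\<close>
definition has_generator ::
    "'a::real_normed_vector set \<Rightarrow> (real \<Rightarrow> 'a \<Rightarrow> 'a) \<Rightarrow> 'a set \<Rightarrow> ('a \<Rightarrow> 'a) \<Rightarrow> bool" where
  "has_generator X S D B \<longleftrightarrow> D \<subseteq> X \<and>
     (\<forall>x\<in>X. \<forall>w. ((\<lambda>h. (S h x - x) /\<^sub>R h) \<longlongrightarrow> w) (at_right 0) \<longleftrightarrow> x \<in> D \<and> w = B x)"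

text \<open>
  Mild solution on \<open>[0,T]\<close> of \<open>z' + A z = F\<close>, \<open>z(0) = z0\<close>, by Duhamel's formula with a Bochner
  integral. A strongly continuous semigroup is determined on \<open>X\<close> by its generator, so the
  existential quantifier only names the semigroup generated by \<open>-A\<close>.
\<close>
definition mild_solution ::
    "'a::{banach, second_countable_topology} set \<Rightarrow> 'a set \<Rightarrow> ('a \<Rightarrow> 'a) \<Rightarrow> real \<Rightarrow>
     (real \<Rightarrow> 'a) \<Rightarrow> 'a \<Rightarrow> (real \<Rightarrow> 'a) \<Rightarrow> bool" where
  "mild_solution X D A T F z0 z \<longleftrightarrow>
     (\<exists>S. C0_semigroup X S \<and> has_generator X S D (\<lambda>x. - A x) \<and>
       (\<forall>t\<in>{0..T}. set_integrable lborel {0..t} (\<lambda>s. S (t - s) (F s)) \<and>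
          z t = S t z0 + (LINT s:{0..t}|lborel. S (t - s) (F s))))"


section \<open>The Kuramoto--Sivashinsky control system\<close>

definition KS_domain :: "real \<Rightarrow> L2 set" where
  "KS_domain L = {\<phi> \<in> sobolev 4 L.
     point_value L \<phi> 0 = 0 \<and> point_value L ((weak_deriv L ^^ 2) \<phi>) 0 = 0 \<and>
     point_value L (weak_deriv L \<phi>) L = 0 \<and> point_value L ((weak_deriv L ^^ 3) \<phi>) L = 0}"

definition KS_op :: "real \<Rightarrow> real \<Rightarrow> L2 \<Rightarrow> L2" where
  "KS_op L lam \<phi> = lam *\<^sub>R (weak_deriv L ^^ 2) \<phi> + (weak_deriv L ^^ 4) \<phi>"

text \<open>Classical derivative on \<open>[0,L]\<close>, one-sided at the end points.\<close>
definition deriv_on :: "real \<Rightarrow> (real \<Rightarrow> real) \<Rightarrow> real \<Rightarrow> real" where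
  "deriv_on L f = (\<lambda>x. vector_derivative f (at x within {0..L}))"

definition smooth_on :: "real \<Rightarrow> (real \<Rightarrow> real) \<Rightarrow> bool" where
  "smooth_on L f \<longleftrightarrow> (\<forall>k. \<forall>x\<in>{0..L}. (deriv_on L ^^ k) f differentiable (at x within {0..L}))"

definition lifting :: "real \<Rightarrow> (real \<Rightarrow> real) \<Rightarrow> (real \<Rightarrow> real) \<Rightarrow> bool" where
  "lifting L p1 p2 \<longleftrightarrow> smooth_on L p1 \<and> smooth_on L p2 \<and>
     p1 0 = 1 \<and> (deriv_on L ^^ 2) p1 0 = 0 \<and> p2 0 = 0 \<and> (deriv_on L ^^ 2) p2 0 = 1 \<and>
     deriv_on L p1 L = 0 \<and> (deriv_on L ^^ 3) p1 L = 0 \<and>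
     deriv_on L p2 L = 0 \<and> (deriv_on L ^^ 3) p2 L = 0"

text \<open>
  Contribution \<open>-(p u\<^sub>t + (\<lambda> p'' + p'''') u)\<close> of one lifted boundary value to the source term.
\<close>
definition KS_source :: "real \<Rightarrow> real \<Rightarrow> real \<Rightarrow> (real \<Rightarrow> real) \<Rightarrow> L2 \<Rightarrow> real \<Rightarrow> L2" where
  "KS_source L lam T p u s =
     - (rep_L2 (weak_deriv T u) s *\<^sub>R L2_of L p +
        point_value T u s *\<^sub>R L2_of L (\<lambda>x. lam * (deriv_on L ^^ 2) p x + (deriv_on L ^^ 4) p x))"

text \<open>
  \<open>y \<in> C([0,T]; L\<^sup>2(0,L))\<close> is the solution with initial datum \<open>y0\<close> and controls
  \<open>y(t,0) = u1(t)\<close>, \<open>y\<^sub>x\<^sub>x(t,0) = u2(t)\<close>. The construction does not depend on the lifting, and the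
  formula is required for all of them; liftings exist by \<open>lifting_exists\<close> below.
\<close>
definition KS_solution :: "real \<Rightarrow> real \<Rightarrow> real \<Rightarrow> L2 \<Rightarrow> L2 \<Rightarrow> L2 \<Rightarrow> (real \<Rightarrow> L2) \<Rightarrow> bool" where
  "KS_solution L lam T y0 u1 u2 y \<longleftrightarrow>
     continuous_on {0..T} y \<and> (\<forall>t\<in>{0..T}. y t \<in> L2_on L) \<and>
     (\<forall>p1 p2. lifting L p1 p2 \<longrightarrow>
       (\<exists>z. mild_solution (L2_on L) (KS_domain L) (KS_op L lam) T
              (\<lambda>s. KS_source L lam T p1 u1 s + KS_source L lam T p2 u2 s)
              (y0 - point_value T u1 0 *\<^sub>R L2_of L p1 - point_value T u2 0 *\<^sub>R L2_of L p2) z \<and>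
            (\<forall>t\<in>{0..T}. y t = z t + point_value T u1 t *\<^sub>R L2_of L p1 + point_value T u2 t *\<^sub>R L2_of L p2)))"

lemma deriv_on_iterate:
  assumes "L > 0" and D0: "D 0 = f"
    and D: "\<And>k x. x \<in> {0..L} \<Longrightarrow> (D k has_real_derivative D (Suc k) x) (at x within {0..L})"
  shows "\<forall>x\<in>{0..L}. (deriv_on L ^^ k) f x = D k x" "smooth_on L f"
proof -
  have *: "\<forall>x\<in>{0..L}. (deriv_on L ^^ k) f x = D k x" for k
  proof (induction k)
    case 0
    then show ?case by (simp add: D0)
  next
    case (Suc k)
    show ?case
    proof
      fix x assume x: "x \<in> {0..L}"
      have "((deriv_on L ^^ k) f has_vector_derivative D (Suc k) x) (at x within {0..L})"
        using D[OF x, of k] Suc x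
        by (auto simp: has_real_derivative_iff_has_vector_derivative
            intro: has_vector_derivative_transform[rotated 2])
      then show "(deriv_on L ^^ Suc k) f x = D (Suc k) x"
        using vector_derivative_within_cbox[of 0 L x] x assms(1)
        by (simp add: deriv_on_def)
    qed
  qed
  then show "\<forall>x\<in>{0..L}. (deriv_on L ^^ k) f x = D k x" .
  show "smooth_on L f"
    unfolding smooth_on_def
  proof (intro allI ballI)
    fix k x assume x: "x \<in> {0..L}"
    have "((deriv_on L ^^ k) f has_vector_derivative D (Suc k) x) (at x within {0..L})"
      using D[OF x, of k] *[of k] x
      by (auto simp: has_real_derivative_iff_has_vector_derivative
          intro: has_vector_derivative_transform[rotated 2])
    then show "(deriv_on L ^^ k) f differentiable (at x within {0..L})"
      by (rule differentiableI_vector)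
  qed
qed

lemma lifting_exists:
  assumes "L > 0"
  shows "lifting L (\<lambda>x. 1) (\<lambda>x. x\<^sup>2 / 2 - L * x)"
proof -
  define D :: "nat \<Rightarrow> real \<Rightarrow> real" where "D k x = (if k = 0 then 1 else 0)" for k x
  define E :: "nat \<Rightarrow> real \<Rightarrow> real" where
    "E k x = (if k = 0 then x\<^sup>2 / 2 - L * x else if k = 1 then x - L else if k = 2 then 1 else 0)" for k x
  have D: "(D k has_real_derivative D (Suc k) x) (at x within {0..L})" for k x
    unfolding D_def by simp
  have E: "(E k has_real_derivative E (Suc k) x) (at x within {0..L})" for k x
  proof -
    consider "k = 0" | "k = 1" | "k = 2" | "k > 2" by linarith
    then show ?thesis
      unfolding E_def by cases (auto intro!: derivative_eq_intros)
  qed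
  note d = deriv_on_iterate[where D = D, OF assms _ D] deriv_on_iterate[where D = E, OF assms _ E]
  have D0: "D 0 = (\<lambda>x. 1)" and E0: "E 0 = (\<lambda>x. x\<^sup>2 / 2 - L * x)"
    by (auto simp: D_def E_def)
  have "(deriv_on L ^^ k) (\<lambda>x. 1) x = D k x" "(deriv_on L ^^ k) (\<lambda>x. x\<^sup>2 / 2 - L * x) x = E k x"
    if "x \<in> {0..L}" for k x
    using d(1)[OF D0, of k] d(3)[OF E0, of k] that by blast+
  from this[of 0 2] this[of L 1] this[of L 3] show ?thesis
    using assms d(2)[OF D0] d(4)[OF E0] by (simp add: lifting_def D_def E_def)
qed

end

theory Submission
  imports Defs "HOL-Complex_Analysis.Complex_Analysis"
begin

text \<open>
  Expand the state in the eigenfunctions \<open>sin (\<mu>\<^sub>k x)\<close>, \<open>\<mu>\<^sub>k = (k + 1/2) \<pi> / L\<close>, of the operator, with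
  eigenvalues \<open>\<nu>\<^sub>k = \<mu>\<^sub>k\<^sup>2 (\<mu>\<^sub>k\<^sup>2 - lam)\<close>. Independently of the lifting, the \<open>k\<close>-th coefficient \<open>a\<^sub>k\<close> of a solution
  satisfies \<open>a\<^sub>k' = - \<nu>\<^sub>k a\<^sub>k + c \<mu>\<^sub>k ((\<mu>\<^sub>k\<^sup>2 - lam) u\<^sup>1 - u\<^sup>2)\<close> with a constant \<open>c\<close> (lemma \<open>state_coef\<close>), so the state vanishes
  at time \<open>T\<close> as soon as the controls satisfy one integral identity for each \<open>k\<close>.

  Such controls are found by flatness, which is insensitive to coinciding eigenvalues. Reading the
  equation as an evolution in the space variable from \<open>x = L\<close>, where \<open>y\<^sub>x = y\<^sub>x\<^sub>x\<^sub>x = 0\<close>, a solution is determined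
  by its two traces \<open>y(\<cdot>,L)\<close> and \<open>y\<^sub>x\<^sub>x(\<cdot>,L)\<close>, which can be prescribed freely: the resulting power series in
  \<open>(x - L)\<^sup>2\<close> converges whenever the traces are of Gevrey order 2 in time (\<open>jet_series_majorant\<close>). Let the
  uncontrolled solution evolve; by parabolic smoothing its traces satisfy Gevrey bounds for positive times
  (\<open>trace_gevrey\<close>). Multiply them by a cutoff of Gevrey order 2 that decreases from 1 to 0 before \<open>T\<close>, and
  take as controls the values at \<open>x = 0\<close> of the solution with these traces and of its second derivative
  (\<open>flat_controls\<close>). It joins the uncontrolled solution to the zero solution. That its Fourier
  coefficients obey the differential equation above is an identity between the power series
  (\<open>series_balance\<close>).

  The remaining work connects this computation to mild solutions. The diagonal semigroup has to be
  identified with the one generated by the operator on its domain in \<open>H\<^sup>4(0,L)\<close>. This rests on the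
  completeness of the eigenfunctions, a consequence of the Stone--Weierstrass theorem, and on the
  inverse of the second derivative under the conditions \<open>f(0) = f'(L) = 0\<close>: the domain of the operator is
  the range of its square (\<open>KS_domain_imp_inv_dxx\<close>, \<open>inv_dxx_in_KS_domain\<close>), since an element of \<open>H\<^sup>1\<close> is a
  constant plus the primitive of its weak derivative (\<open>has_weak_deriv_imp_prim\<close>).
\<close>

section \<open>Gevrey functions and cutoffs\<close>

text \<open>
  \<open>D n\<close> plays the role of the \<open>n\<close>-th derivative of \<open>D 0\<close> on \<open>I\<close>. Carrying the whole tower along makes
  products and differential recursions explicit. The growth allowed is that of Gevrey order 2: unlike
  an analytic bound (\<open>fact n\<close> without the square) it is compatible with functions that vanish on an
  interval without vanishing identically.
\<close>
definition gevrey :: "real set \<Rightarrow> (nat \<Rightarrow> real \<Rightarrow> real) \<Rightarrow> bool" where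
  "gevrey I D \<longleftrightarrow> (\<forall>n. \<forall>t\<in>I. (D n has_real_derivative D (Suc n) t) (at t)) \<and>
     (\<exists>C\<ge>0. \<exists>R\<ge>0. \<forall>n. \<forall>t\<in>I. \<bar>D n t\<bar> \<le> C * R ^ n * (fact n)\<^sup>2)"

lemma gevreyI:
  assumes "\<And>n t. t \<in> I \<Longrightarrow> (D n has_real_derivative D (Suc n) t) (at t)"
    and "C \<ge> 0" "R \<ge> 0" "\<And>n t. t \<in> I \<Longrightarrow> \<bar>D n t\<bar> \<le> C * R ^ n * (fact n)\<^sup>2"
  shows "gevrey I D"
  unfolding gevrey_def using assms by (intro conjI exI[of _ C] exI[of _ R]) auto

definition leibniz :: "(nat \<Rightarrow> real \<Rightarrow> real) \<Rightarrow> (nat \<Rightarrow> real \<Rightarrow> real) \<Rightarrow> nat \<Rightarrow> real \<Rightarrow> real" where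
  "leibniz D E n t = (\<Sum>l\<le>n. real (n choose l) * D l t * E (n - l) t)"

lemma leibniz_deriv:
  assumes "\<And>n. (D n has_real_derivative D (Suc n) t) (at t)"
    and "\<And>n. (E n has_real_derivative E (Suc n) t) (at t)"
  shows "(leibniz D E n has_real_derivative leibniz D E (Suc n) t) (at t)"
proof -
  have "leibniz D E (Suc n) t =
      (\<Sum>l\<le>n. real (n choose l) * D (Suc l) t * E (n - l) t) +
      (\<Sum>l\<le>n. real (n choose l) * D l t * E (Suc (n - l)) t)"
  proof -
    have "leibniz D E (Suc n) t = D 0 t * E (Suc n) t +
        (\<Sum>l\<le>n. real (Suc n choose Suc l) * D (Suc l) t * E (n - l) t)"
      unfolding leibniz_def by (subst sum.atMost_Suc_shift) simp
    also have "(\<Sum>l\<le>n. real (Suc n choose Suc l) * D (Suc l) t * E (n - l) t) =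
        (\<Sum>l\<le>n. real (n choose l) * D (Suc l) t * E (n - l) t) +
        (\<Sum>l\<le>n. real (n choose Suc l) * D (Suc l) t * E (n - l) t)"
      by (simp add: sum.distrib algebra_simps)
    also have "D 0 t * E (Suc n) t + (\<dots>) = (\<Sum>l\<le>n. real (n choose l) * D (Suc l) t * E (n - l) t) +
       (\<Sum>l\<le>Suc n. real (n choose l) * D l t * E (Suc n - l) t)"
      by (subst sum.atMost_Suc_shift[of _ n]) simp
    also have "(\<Sum>l\<le>Suc n. real (n choose l) * D l t * E (Suc n - l) t) =
        (\<Sum>l\<le>n. real (n choose l) * D l t * E (Suc (n - l)) t)"
      by (simp add: Suc_diff_le)
    finally show ?thesis .
  qed
  also have "\<dots> = (\<Sum>l\<le>n. real (n choose l) * D (Suc l) t * E (n - l) t + real (n choose l) * D l t * E (Suc (n - l)) t)"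
    by (simp add: sum.distrib)
  finally have *: "leibniz D E (Suc n) t = \<dots>" .
  have "((\<lambda>t. \<Sum>l\<le>n. real (n choose l) * D l t * E (n - l) t) has_real_derivative
      (\<Sum>l\<le>n. real (n choose l) * D (Suc l) t * E (n - l) t + real (n choose l) * D l t * E (Suc (n - l)) t)) (at t)"
  proof (rule DERIV_sum)
    fix l
    show "((\<lambda>t. real (n choose l) * D l t * E (n - l) t) has_real_derivative
      real (n choose l) * D (Suc l) t * E (n - l) t + real (n choose l) * D l t * E (Suc (n - l)) t) (at t)"
      by (rule DERIV_cong[OF DERIV_mult[OF DERIV_cmult[OF assms(1)] assms(2)]]) simp
  qed
  moreover have "leibniz D E n = (\<lambda>t. \<Sum>l\<le>n. real (n choose l) * D l t * E (n - l) t)"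
    by (rule ext) (rule leibniz_def)
  ultimately show ?thesis
    by (simp only: *)
qed

text \<open>
  The squares leave room to spare: a binomial coefficient times \<open>(fact l)\<^sup>2 (fact (n - l))\<^sup>2\<close> equals
  \<open>fact n * fact l * fact (n - l)\<close>, which is at most \<open>(fact n)\<^sup>2\<close>, so the Leibniz sum only costs its
  number of terms, and \<open>n + 1 \<le> 2 ^ n\<close>.
\<close>
lemma gevrey_mult:
  assumes "gevrey I D" "gevrey I E"
  shows "gevrey I (leibniz D E)"
proof -
  obtain C R where C: "C \<ge> 0" "R \<ge> 0" "\<And>n t. t \<in> I \<Longrightarrow> \<bar>D n t\<bar> \<le> C * R ^ n * (fact n)\<^sup>2"
    using assms(1) by (auto simp: gevrey_def)
  obtain C' R' where C': "C' \<ge> 0" "R' \<ge> 0" "\<And>n t. t \<in> I \<Longrightarrow> \<bar>E n t\<bar> \<le> C' * R' ^ n * (fact n)\<^sup>2"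
    using assms(2) by (auto simp: gevrey_def)
  define M where "M = max R R'"
  have "\<bar>leibniz D E n t\<bar> \<le> (C * C') * (2 * M) ^ n * (fact n)\<^sup>2" if t: "t \<in> I" for n t
  proof -
    have "\<bar>real (n choose l) * D l t * E (n - l) t\<bar> \<le> C * C' * M ^ n * (fact n)\<^sup>2" if l: "l \<le> n" for l
    proof -
      have "\<bar>real (n choose l) * D l t * E (n - l) t\<bar>
         \<le> real (n choose l) * (C * R ^ l * (fact l)\<^sup>2) * (C' * R' ^ (n - l) * (fact (n - l))\<^sup>2)"
        unfolding abs_mult using C C' t
        by (intro mult_mono) auto
      also have "\<dots> \<le> real (n choose l) * (C * M ^ l * (fact l)\<^sup>2) * (C' * M ^ (n - l) * (fact (n - l))\<^sup>2)"
        using C C' by (intro mult_mono mult_nonneg_nonneg power_mono) (auto simp: M_def)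
      also have "\<dots> = C * C' * (M ^ l * M ^ (n - l)) * ((fact l * fact (n - l) * real (n choose l)) * (fact l * fact (n - l)))"
        by (simp add: power2_eq_square)
      also have "fact l * fact (n - l) * real (n choose l) = fact n"
        using arg_cong[OF binomial_fact_lemma[OF l], of real] by simp
      also have "M ^ l * M ^ (n - l) = M ^ n"
        using l by (simp flip: power_add)
      also have "C * C' * M ^ n * (fact n * (fact l * fact (n - l))) \<le> C * C' * M ^ n * (fact n * fact n)"
      proof (intro mult_left_mono)
        have "fact l * fact (n - l) \<le> (fact n :: nat)"
          using fact_fact_dvd_fact[of l "n - l"] l by (intro dvd_imp_le) auto
        from of_nat_mono[OF this, where 'a = real] show "fact l * fact (n - l) \<le> (fact n :: real)"
          by simp
      qed (use C C' in \<open>auto simp: M_def\<close>)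
      finally show ?thesis by (simp add: power2_eq_square)
    qed
    then have "\<bar>leibniz D E n t\<bar> \<le> (\<Sum>l\<le>n. C * C' * M ^ n * (fact n)\<^sup>2)"
      unfolding leibniz_def by (intro order_trans[OF sum_abs] sum_mono) auto
    also have "\<dots> = real (Suc n) * (C * C' * M ^ n * (fact n)\<^sup>2)" by simp
    also have "\<dots> \<le> 2 ^ n * (C * C' * M ^ n * (fact n)\<^sup>2)"
    proof (intro mult_right_mono)
      have "Suc n \<le> 2 ^ n" by (induction n) auto
      from of_nat_mono[OF this, where 'a = real] show "real (Suc n) \<le> 2 ^ n" by simp
    qed (use C C' in \<open>auto simp: M_def\<close>)
    finally show ?thesis by (simp add: power_mult_distrib mult_ac)
  qed
  moreover have "C * C' \<ge> 0" "2 * M \<ge> 0" using C C' by (auto simp: M_def)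
  moreover have "(leibniz D E n has_real_derivative leibniz D E (Suc n) t) (at t)" if "t \<in> I" for n t
    by (rule leibniz_deriv) (use assms that in \<open>auto simp: gevrey_def\<close>)
  ultimately show ?thesis by (intro gevreyI[of I _ "C * C'" "2 * M"])
qed

lemma gevrey_affine:
  assumes "gevrey UNIV D"
  shows "gevrey UNIV (\<lambda>n t. s ^ n * D n (s * t + c))"
proof -
  obtain C R where C: "C \<ge> 0" "R \<ge> 0" "\<And>n t. \<bar>D n t\<bar> \<le> C * R ^ n * (fact n)\<^sup>2"
    using assms(1) by (auto simp: gevrey_def)
  have D: "(D n has_real_derivative D (Suc n) t) (at t)" for n t
    using assms by (auto simp: gevrey_def)
  have "\<bar>s ^ n * D n (s * t + c)\<bar> \<le> C * (\<bar>s\<bar> * R) ^ n * (fact n)\<^sup>2" for n t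
    using mult_left_mono[OF C(3)[of n "s * t + c"], of "\<bar>s\<bar> ^ n"]
    by (simp add: abs_mult power_abs power_mult_distrib mult_ac)
  moreover have "((\<lambda>t. s ^ n * D n (s * t + c)) has_real_derivative s ^ Suc n * D (Suc n) (s * t + c)) (at t)" for n t
  proof -
    have "((\<lambda>t. s * t + c) has_real_derivative s) (at t)"
      by (auto intro!: derivative_eq_intros)
    from DERIV_cmult[OF DERIV_chain2[OF D this], of "s ^ n"] show ?thesis
      by (simp add: mult_ac)
  qed
  moreover have "\<bar>s\<bar> * R \<ge> 0" using C by simp
  ultimately show ?thesis
    using C(1) by (intro gevreyI[of _ _ C "\<bar>s\<bar> * R"])
qed

lemma power_exp_le_fact:
  assumes "x \<ge> (0::real)" shows "x ^ n \<le> fact n * exp x"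
proof -
  have "x ^ n / fact n \<le> (\<Sum>k. x ^ k / fact k)"
    using sum_le_suminf[OF summable_exp_generic[of x], of "{n}"] assms
    by (simp add: field_simps scaleR_conv_of_real)
  also have "\<dots> = exp x" by (simp add: exp_def field_simps scaleR_conv_of_real)
  finally show ?thesis by (simp add: field_simps)
qed

text \<open>
  On the disc of radius \<open>t / 2\<close> about \<open>t > 0\<close> the real part of \<open>1 / z\<close> is at least \<open>2 / (9 t)\<close>. Cauchy's
  inequality therefore bounds the \<open>n\<close>-th derivative of \<open>exp (- 1 / t)\<close> by
  \<open>fact n * (2 / t) ^ n * exp (- 2 / (9 t))\<close>, and \<open>x ^ n \<le> fact n * exp x\<close> turns the negative power of
  \<open>t\<close> into a second factorial. Spending two more powers of \<open>t\<close> in the same way gives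
  differentiability of every derivative at the origin.
\<close>
lemma gevrey_flat:
  obtains D where "gevrey UNIV D" "\<And>t. D 0 t = (if t > 0 then exp (- 1 / t) else 0)"
proof -
  define f where "f z = exp (- 1 / z)" for z :: complex
  define H where "H = {z. Re z > 0}"
  have H: "open H" unfolding H_def by (simp add: open_halfspace_Re_gt)
  have hol: "f holomorphic_on H"
    unfolding f_def H_def by (intro holomorphic_intros) auto
  define D where "D n t = (if t > 0 then Re ((deriv ^^ n) f (of_real t)) else 0)" for n t
  have bound1: "\<bar>D n t\<bar> \<le> fact n * (2 / t) ^ n * exp (- (2 / (9 * t)))" if t: "t > 0" for n t
  proof -
    have sub: "cball (of_real t) (t / 2) \<subseteq> H"
    proof
      fix z :: complex assume "z \<in> cball (complex_of_real t) (t / 2)"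
      then have "\<bar>Re (of_real t - z)\<bar> \<le> t / 2"
        using abs_Re_le_cmod[of "of_real t - z"] by (auto simp: dist_norm)
      then have "\<bar>t - Re z\<bar> \<le> t / 2" by simp
      then have "Re z > 0" using t by linarith
      then show "z \<in> H" by (simp add: H_def)
    qed
    have "norm ((deriv ^^ n) f (of_real t)) \<le> fact n * exp (- (2 / (9 * t))) / (t / 2) ^ n"
    proof (rule Cauchy_inequality)
      show "f holomorphic_on ball (of_real t) (t / 2)"
        using hol sub ball_subset_cball by (blast intro: holomorphic_on_subset)
      show "continuous_on (cball (of_real t) (t / 2)) f"
        using hol sub by (blast intro: holomorphic_on_subset holomorphic_on_imp_continuous_on)
      show "0 < t / 2" using t by simp
      fix z :: complex assume z: "norm (of_real t - z) = t / 2"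
      then have "\<bar>t - Re z\<bar> \<le> t / 2"
        using abs_Re_le_cmod[of "of_real t - z"] by simp
      then have 1: "Re z \<ge> t / 2" by linarith
      have "norm z \<le> 3 * t / 2"
        using norm_triangle_ineq4[of "of_real t" "of_real t - z"] z t by simp
      then have 2: "(norm z)\<^sup>2 \<le> (3 * t / 2)\<^sup>2" by (intro power_mono) auto
      have 3: "(norm z)\<^sup>2 > 0" using 1 t by auto
      have "2 / (9 * t) = (t / 2) / (3 * t / 2)\<^sup>2" using t by (simp add: field_simps power2_eq_square)
      also have "\<dots> \<le> Re z / (norm z)\<^sup>2"
        using 1 2 3 t by (intro frac_le) auto
      also have "\<dots> = Re (1 / z)"
        by (simp add: Re_divide cmod_power2)
      finally have "Re (- 1 / z) \<le> - (2 / (9 * t))" by simp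
      then show "norm (f z) \<le> exp (- (2 / (9 * t)))"
        by (simp add: f_def)
    qed
    moreover have "\<bar>D n t\<bar> \<le> norm ((deriv ^^ n) f (of_real t))"
      using t abs_Re_le_cmod by (auto simp: D_def)
    moreover have "fact n * exp (- (2 / (9 * t))) / (t / 2) ^ n = fact n * (2 / t) ^ n * exp (- (2 / (9 * t)))"
      using t by (simp add: power_divide)
    ultimately show ?thesis by linarith
  qed
  have bound2: "\<bar>D n t\<bar> \<le> (fact n * 2 ^ n * \<bar>t\<bar> ^ j) * ((9/2) ^ (n + j) * fact (n + j))" for n j t
  proof (cases "t > 0")
    case True
    have "(2 / (9 * t)) ^ (n + j) \<le> fact (n + j) * exp (2 / (9 * t))"
      using True by (intro power_exp_le_fact) auto
    from mult_right_mono[OF this exp_ge_zero, of "- (2 / (9 * t))"]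
    have 1: "(2 / (9 * t)) ^ (n + j) * exp (- (2 / (9 * t))) \<le> fact (n + j)"
      by (simp only: mult.assoc exp_minus_inverse mult_1_right)
    have "1 / t = (9/2) * (2 / (9 * t))" using True by simp
    then have "(1 / t) ^ (n + j) = (9/2) ^ (n + j) * (2 / (9 * t)) ^ (n + j)"
      by (subst \<open>1 / t = _\<close>, intro power_mult_distrib)
    then have "(1 / t) ^ (n + j) * exp (- (2 / (9 * t))) \<le> (9/2) ^ (n + j) * fact (n + j)"
      using mult_left_mono[OF 1, of "(9/2) ^ (n + j)"] by (simp only: mult.assoc) simp
    then have "(fact n * 2 ^ n * t ^ j) * ((1 / t) ^ (n + j) * exp (- (2 / (9 * t)))) \<le> (fact n * 2 ^ n * t ^ j) * ((9/2) ^ (n + j) * fact (n + j))"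
      using True by (intro mult_left_mono) auto
    moreover have "(fact n * 2 ^ n * t ^ j) * ((1 / t) ^ (n + j) * exp (- (2 / (9 * t)))) = fact n * (2 / t) ^ n * exp (- (2 / (9 * t)))"
      using True by (simp add: power_add power_divide)
    ultimately show ?thesis
      using order_trans[OF bound1[OF True, of n]] True by simp
  qed (simp add: D_def)
  have bound: "\<bar>D n t\<bar> \<le> 1 * 9 ^ n * (fact n)\<^sup>2" for n t
  proof -
    have "(2::real) ^ n * (9/2) ^ n = 9 ^ n" by (simp flip: power_mult_distrib)
    then have "(fact n * 2 ^ n * \<bar>t\<bar> ^ 0) * ((9/2) ^ (n + 0) * fact (n + 0)) = 1 * 9 ^ n * (fact n)\<^sup>2"
      by (simp add: power2_eq_square)
    then show ?thesis using bound2[of n t 0] by simp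
  qed
  have deriv: "(D n has_real_derivative D (Suc n) t) (at t)" for n t
  proof -
    consider "t > 0" | "t < 0" | "t = 0" by linarith
    then show ?thesis
    proof cases
      case 1
      have "((deriv ^^ n) f has_field_derivative (deriv ^^ Suc n) f (of_real t)) (at (of_real t))"
        using holomorphic_derivI[OF holomorphic_higher_deriv[OF hol H] H, of "of_real t" n UNIV] 1
        by (simp add: H_def)
      then have "((\<lambda>x. Re ((deriv ^^ n) f (of_real x))) has_real_derivative Re ((deriv ^^ Suc n) f (of_real t))) (at t)"
        using has_field_derivative_Re[OF has_vector_derivative_real_field] by blast
      then have "((\<lambda>x. Re ((deriv ^^ n) f (of_real x))) has_real_derivative D (Suc n) t) (at t)"
        using 1 by (simp add: D_def)
      then show ?thesis
        by (rule has_field_derivative_transform_within_open[where S = "{0<..}"]) (use 1 in \<open>auto simp: D_def\<close>)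
    next
      case 2
      have "((\<lambda>x. 0) has_real_derivative D (Suc n) t) (at t)" using 2 by (simp add: D_def)
      then show ?thesis
        by (rule has_field_derivative_transform_within_open[where S = "{..<0}"]) (use 2 in \<open>auto simp: D_def\<close>)
    next
      case 3
      define M where "M = fact n * 2 ^ n * ((9/2) ^ (n + 2) * (fact (n + 2) :: real))"
      have "(\<lambda>h. D n h / h) \<midarrow>0\<rightarrow> 0"
      proof (rule Lim_null_comparison)
        show "\<forall>\<^sub>F h in at 0. norm (D n h / h) \<le> M * \<bar>h\<bar>"
        proof (rule eventually_at_filter[THEN iffD2], intro always_eventually allI impI)
          fix h :: real assume "h \<noteq> 0"
          moreover have "\<bar>D n h\<bar> \<le> M * \<bar>h\<bar> * \<bar>h\<bar>"
            using bound2[of n h 2] by (simp only: M_def power2_eq_square mult_ac)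
          ultimately show "norm (D n h / h) \<le> M * \<bar>h\<bar>"
            by (simp add: pos_divide_le_eq)
        qed
        show "(\<lambda>h. M * \<bar>h\<bar>) \<midarrow>0\<rightarrow> 0" by (rule tendsto_eq_intros refl | simp)+
      qed
      then show ?thesis using 3 by (simp add: DERIV_def D_def)
    qed
  qed
  have "gevrey UNIV D"
    using bound deriv by (intro gevreyI[of _ _ 1 9]) auto
  moreover have "D 0 t = (if t > 0 then exp (- 1 / t) else 0)" for t
  proof -
    have "exp (- 1 / complex_of_real t) = of_real (exp (- 1 / t))"
      by (simp flip: exp_of_real)
    then show ?thesis by (simp add: D_def f_def)
  qed
  ultimately show thesis using that by blast
qed

lemma antiderivative_exists:
  fixes f :: "real \<Rightarrow> real"
  assumes "continuous_on UNIV f"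
  obtains F where "\<And>t. (F has_real_derivative f t) (at t)"
proof -
  have "\<exists>F. \<forall>x. -\<infinity> < ereal x \<longrightarrow> ereal x < \<infinity> \<longrightarrow> (F has_vector_derivative f x) (at x)"
    by (rule einterval_antiderivative) (use assms in \<open>auto simp: continuous_on_eq_continuous_at\<close>)
  then show thesis using that by (auto simp: has_real_derivative_iff_has_vector_derivative)
qed

lemma zero_deriv_imp_eq:
  fixes F :: "real \<Rightarrow> real"
  assumes F: "\<And>t. (F has_real_derivative f t) (at t)" and "s \<le> t" "\<And>x. x \<in> {s..t} \<Longrightarrow> f x = 0"
  shows "F s = F t"
proof -
  have "(F has_real_derivative 0) (at x within {s..t})" if "x \<in> {s..t}" for x
    using has_field_derivative_at_within[OF F, of x "{s..t}"] assms(3)[OF that] by simp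
  from has_field_derivative_zero_constant[OF convex_real_interval(5) this] show ?thesis
    using assms(2) by force
qed

text \<open>
  The cutoff is a normalised primitive of the product of two flat functions, one vanishing to the left
  of \<open>a\<close> and one to the right of \<open>b\<close>.
\<close>
lemma gevrey_cutoff:
  assumes "a < b"
  obtains D where "gevrey UNIV D" "\<And>t. t \<le> a \<Longrightarrow> D 0 t = 1" "\<And>t. t \<ge> b \<Longrightarrow> D 0 t = 0"
proof -
  obtain F where F: "gevrey UNIV F" "\<And>t. F 0 t = (if t > 0 then exp (- 1 / t) else 0)"
    using gevrey_flat by blast
  define B where "B = leibniz (\<lambda>n t. 1 ^ n * F n (1 * t + (- a))) (\<lambda>n t. (-1) ^ n * F n ((-1) * t + b))"
  have B: "gevrey UNIV B"
    unfolding B_def by (intro gevrey_mult gevrey_affine F)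
  have B0: "B 0 t = F 0 (t - a) * F 0 (b - t)" for t
    by (simp add: B_def leibniz_def algebra_simps)
  have Bd: "(B n has_real_derivative B (Suc n) t) (at t)" for n t
    using B by (auto simp: gevrey_def)
  obtain C R where C: "C \<ge> 0" "R \<ge> 0" "\<And>n t. \<bar>B n t\<bar> \<le> C * R ^ n * (fact n)\<^sup>2"
    using B by (auto simp: gevrey_def)
  have cont: "continuous_on UNIV (B 0)"
    using Bd by (intro continuous_at_imp_continuous_on) (auto intro: DERIV_isCont)
  obtain G where G: "\<And>t. (G has_real_derivative B 0 t) (at t)"
    using antiderivative_exists[OF cont] by blast
  have B0pos: "B 0 t \<ge> 0" for t by (simp add: B0 F)
  have mono: "G x \<le> G y" if "x \<le> y" for x y
    using that by (rule DERIV_nonneg_imp_nondecreasing) (use G B0pos in blast)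
  have Ga: "G t = G a" if "t \<le> a" for t
    by (rule zero_deriv_imp_eq[OF G that]) (simp add: B0 F)
  have Gb: "G t = G b" if "t \<ge> b" for t
    by (rule zero_deriv_imp_eq[OF G that, symmetric]) (simp add: B0 F)
  have "G a < G b"
  proof (rule DERIV_pos_imp_increasing_open[OF assms])
    fix x assume "a < x" "x < b"
    then have "B 0 x > 0" by (simp add: B0 F)
    then show "\<exists>y. (G has_real_derivative y) (at x) \<and> 0 < y" using G by blast
    next show "continuous_on {a..b} G"
      using G by (intro continuous_at_imp_continuous_on ballI) (blast intro: DERIV_isCont)
  qed
  define d where "d = G b - G a"
  have d: "d > 0" using \<open>G a < G b\<close> by (simp add: d_def)
  define D where "D n t = (case n of 0 \<Rightarrow> (G b - G t) / d | Suc m \<Rightarrow> - B m t / d)" for n t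
  have "(D n has_real_derivative D (Suc n) t) (at t)" for n t
  proof (cases n)
    case 0
    have "((\<lambda>t. (G b - G t) / d) has_real_derivative - B 0 t / d) (at t)"
      by (rule DERIV_cong[OF DERIV_cdivide[OF DERIV_diff[OF DERIV_const G]]]) simp
    then show ?thesis using 0 by (simp add: D_def[abs_def])
  next
    case (Suc m)
    have "((\<lambda>t. - B m t / d) has_real_derivative - B (Suc m) t / d) (at t)"
      by (rule DERIV_cdivide[OF DERIV_minus[OF Bd]])
    then show ?thesis using Suc by (simp add: D_def[abs_def])
  qed
  moreover have "\<bar>D n t\<bar> \<le> (1 + C / d) * (1 + R) ^ n * (fact n)\<^sup>2" for n t
  proof (cases n)
    case 0
    have "0 \<le> G b - G t"
      using mono[of t b] Gb[of t] by linarith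
    moreover have "G b - G t \<le> d"
      using mono[of a t] Ga[of t] unfolding d_def by linarith
    ultimately have "\<bar>(G b - G t) / d\<bar> \<le> 1" using d by simp
    also have "\<dots> \<le> 1 + C / d" using C d by simp
    finally show ?thesis using 0 by (simp add: D_def)
  next
    case (Suc m)
    have "\<bar>D n t\<bar> \<le> C / d * R ^ m * (fact m)\<^sup>2"
      using divide_right_mono[OF C(3)[of m t], of d] d by (simp add: Suc D_def)
    also have "\<dots> \<le> (1 + C / d) * (1 + R) ^ n * (fact n)\<^sup>2"
    proof (intro mult_mono power_mono)
      show "R ^ m \<le> (1 + R) ^ n"
        using C(2) by (intro order_trans[OF power_mono[of R "1 + R" m]] power_increasing) (auto simp: Suc)
      show "fact m \<le> (fact n :: real)" by (intro fact_mono) (simp add: Suc)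
    qed (use C d in auto)
    finally show ?thesis .
  qed
  moreover have "1 + C / d \<ge> 0" "1 + R \<ge> 0" using C d by auto
  ultimately have "gevrey UNIV D" by (intro gevreyI[of _ _ "1 + C / d" "1 + R"])
  moreover have "D 0 t = 1" if "t \<le> a" for t using Ga[OF that] d by (simp add: D_def d_def)
  moreover have "D 0 t = 0" if "t \<ge> b" for t using Gb[OF that] d by (simp add: D_def)
  ultimately show thesis using that by blast
qed

section \<open>The equation as an evolution in space\<close>

text \<open>
  The equation \<open>y\<^sub>t + lam y\<^sub>x\<^sub>x + y\<^sub>x\<^sub>x\<^sub>x\<^sub>x = 0\<close>, read as an evolution in space starting from the end \<open>x = L\<close>
  where \<open>y\<^sub>x = y\<^sub>x\<^sub>x\<^sub>x = 0\<close>, has the formal solution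
  \<open>y(t,x) = \<Sum>n. h n t * (x - L) ^ (2 n) / fact (2 n)\<close>, where \<open>h 0 = y(\<cdot>,L)\<close> and \<open>h 1 = y\<^sub>x\<^sub>x(\<cdot>,L)\<close> are free
  and \<open>h (n + 2) = - (h n)' - lam (h (n + 1))\<close>. Given derivative towers \<open>D\<close> and \<open>E\<close> of these two
  traces, \<open>jet lam D E n j\<close> is the \<open>j\<close>-th time derivative of \<open>h n\<close>.
\<close>
fun jet :: "real \<Rightarrow> (nat \<Rightarrow> real \<Rightarrow> real) \<Rightarrow> (nat \<Rightarrow> real \<Rightarrow> real) \<Rightarrow> nat \<Rightarrow> nat \<Rightarrow> real \<Rightarrow> real" where
  "jet lam D E 0 j t = D j t"
| "jet lam D E (Suc 0) j t = E j t"
| "jet lam D E (Suc (Suc n)) j t = - jet lam D E n (Suc j) t - lam * jet lam D E (Suc n) j t"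

lemma fact_sq_le: "(fact n)\<^sup>2 \<le> (fact (2 * n) :: real)"
proof -
  have "fact n * fact n dvd (fact (n + n) :: nat)" by (rule fact_fact_dvd_fact)
  then have "fact n * fact n \<le> (fact (n + n) :: nat)" by (rule dvd_imp_le) simp
  from of_nat_mono[OF this, where 'a = real] show ?thesis
    by (simp add: power2_eq_square mult_2)
qed

lemma jet_fun:
  "jet lam D E 0 j = D j" "jet lam D E (Suc 0) j = E j"
  "jet lam D E (Suc (Suc n)) j = (\<lambda>t. - jet lam D E n (Suc j) t - lam * jet lam D E (Suc n) j t)"
  by (auto intro!: ext)

lemma jet_deriv:
  assumes "\<And>n. (D n has_real_derivative D (Suc n) t) (at t)"
    and "\<And>n. (E n has_real_derivative E (Suc n) t) (at t)"
  shows "(jet lam D E n j has_real_derivative jet lam D E n (Suc j) t) (at t)"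
proof (induction n arbitrary: j rule: induct_nat_012)
  case 0
  then show ?case using assms(1) by (simp add: jet_fun)
next
  case 1
  then show ?case using assms(2) by (simp add: jet_fun)
next
  case (ge2 n)
  have "((\<lambda>t. - jet lam D E n (Suc j) t - lam * jet lam D E (Suc n) j t) has_real_derivative
      - jet lam D E n (Suc (Suc j)) t - lam * jet lam D E (Suc n) (Suc j) t) (at t)"
    by (intro DERIV_diff DERIV_minus DERIV_cmult ge2)
  then show ?case by (simp add: jet_fun(3))
qed

text \<open>
  Two steps in \<open>n\<close> cost one time derivative, hence the weight \<open>fact (n + 2 * j)\<close>. The factor \<open>2 ^ n\<close>
  absorbs the two terms of the recursion: for \<open>R \<ge> lam\<close> they add up to at most \<open>1 + 2 \<le> 2 ^ 2\<close> times the
  bound for \<open>n\<close>.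
\<close>
lemma jet_bound:
  assumes "gevrey I D" "gevrey I E" "lam \<ge> 0"
  obtains C R where "C \<ge> 0" "R \<ge> 1"
    "\<And>n j t. t \<in> I \<Longrightarrow> \<bar>jet lam D E n j t\<bar> \<le> C * 2 ^ n * R ^ (n + 2 * j) * fact (n + 2 * j)"
proof -
  obtain C1 R1 where 1: "C1 \<ge> 0" "R1 \<ge> 0" "\<And>n t. t \<in> I \<Longrightarrow> \<bar>D n t\<bar> \<le> C1 * R1 ^ n * (fact n)\<^sup>2"
    using assms(1) by (auto simp: gevrey_def)
  obtain C2 R2 where 2: "C2 \<ge> 0" "R2 \<ge> 0" "\<And>n t. t \<in> I \<Longrightarrow> \<bar>E n t\<bar> \<le> C2 * R2 ^ n * (fact n)\<^sup>2"
    using assms(2) by (auto simp: gevrey_def)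
  define C where "C = C1 + C2"
  define R where "R = 1 + R1 + R2 + lam"
  have R: "R \<ge> 1" "R \<ge> lam" "R1 \<le> R" "R2 \<le> R" using 1 2 assms(3) by (auto simp: R_def)
  have C: "C \<ge> 0" "C1 \<le> C" "C2 \<le> C" using 1 2 by (auto simp: C_def)
  have sq: "x ^ j \<le> R ^ (2 * j)" if "0 \<le> x" "x \<le> R" for x j
  proof -
    have "x ^ j \<le> R ^ j" using that by (intro power_mono)
    also have "\<dots> \<le> R ^ (2 * j)" using R by (intro power_increasing) auto
    finally show ?thesis .
  qed
  have "\<bar>jet lam D E n j t\<bar> \<le> C * 2 ^ n * R ^ (n + 2 * j) * fact (n + 2 * j)" if t: "t \<in> I" for n j t
  proof (induction n arbitrary: j rule: induct_nat_012)
    case 0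
    have "\<bar>D j t\<bar> \<le> C1 * R1 ^ j * (fact j)\<^sup>2" using 1 t by blast
    also have "\<dots> \<le> C * R ^ (2 * j) * fact (2 * j)"
      using 1 C R by (intro mult_mono sq fact_sq_le) auto
    finally show ?case by simp
  next
    case 1
    have "\<bar>E j t\<bar> \<le> C2 * R2 ^ j * (fact j)\<^sup>2" using 2 t by blast
    also have "\<dots> \<le> C * R ^ (2 * j) * fact (2 * j)"
      using 2 C R by (intro mult_mono sq fact_sq_le) auto
    also have "\<dots> \<le> (C * 2) * R ^ (1 + 2 * j) * fact (1 + 2 * j)"
    proof (intro mult_mono)
      show "R ^ (2 * j) \<le> R ^ (1 + 2 * j)" using R by (intro power_increasing) auto
      show "fact (2 * j) \<le> (fact (1 + 2 * j) :: real)" by (intro fact_mono) simp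
    qed (use C R in auto)
    finally show ?case by simp
  next
    case (ge2 n)
    define N where "N = n + 2 * j"
    have "\<bar>jet lam D E (Suc (Suc n)) j t\<bar> \<le> \<bar>jet lam D E n (Suc j) t\<bar> + lam * \<bar>jet lam D E (Suc n) j t\<bar>"
      using assms(3) abs_triangle_ineq4[of "- jet lam D E n (Suc j) t" "lam * jet lam D E (Suc n) j t"]
      by (simp add: abs_mult)
    also have "\<dots> \<le> C * 2 ^ n * R ^ (N + 2) * fact (N + 2) + R * (C * 2 ^ Suc n * R ^ (N + 1) * fact (N + 1))"
      using ge2(1)[of "Suc j"] ge2(2)[of j] R assms(3)
      by (intro add_mono mult_mono) (auto simp: N_def)
    also have "R * (C * 2 ^ Suc n * R ^ (N + 1) * fact (N + 1)) \<le> R * (C * 2 ^ Suc n * R ^ (N + 1) * fact (N + 2))"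
      using C R by (intro mult_left_mono fact_mono) auto
    also have "C * 2 ^ n * R ^ (N + 2) * fact (N + 2) + R * (C * 2 ^ Suc n * R ^ (N + 1) * fact (N + 2))
        = 3 * (C * 2 ^ n * R ^ (N + 2) * fact (N + 2))"
      by (simp add: power_add power2_eq_square)
    also have "\<dots> \<le> 4 * (C * 2 ^ n * R ^ (N + 2) * fact (N + 2))"
      using C R by (intro mult_right_mono) auto
    also have "\<dots> = C * 2 ^ Suc (Suc n) * R ^ (Suc (Suc n) + 2 * j) * fact (Suc (Suc n) + 2 * j)"
      by (simp add: N_def algebra_simps)
    finally show ?case by simp
  qed
  then show thesis using that C R by blast
qed

text \<open>
  Since \<open>(fact n)\<^sup>2 \<le> fact (2 * n)\<close>, traces of Gevrey order 2 give a series that converges for every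
  \<open>x\<close>, uniformly in time. The index \<open>k = 1\<close> belongs to the second space derivative, \<open>j = 1\<close> to the time
  derivative.
\<close>
lemma jet_series_majorant:
  assumes "gevrey I D" "gevrey I E" "lam \<ge> 0" "X \<ge> 0"
  obtains M where "summable M"
    "\<And>n k j t. t \<in> I \<Longrightarrow> k \<le> 1 \<Longrightarrow> j \<le> 1 \<Longrightarrow> \<bar>jet lam D E (n + k) j t\<bar> * (X ^ (2 * n) / fact (2 * n)) \<le> M n"
proof -
  obtain C R where C: "C \<ge> 0" "R \<ge> 1"
    "\<And>n j t. t \<in> I \<Longrightarrow> \<bar>jet lam D E n j t\<bar> \<le> C * 2 ^ n * R ^ (n + 2 * j) * fact (n + 2 * j)"
    using jet_bound[OF assms(1-3)] by blast
  define M where "M n = 12 * C * R ^ 3 * ((16 * R * X\<^sup>2) ^ n / fact n)" for n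
  have "summable M"
    unfolding M_def using summable_exp_generic[of "16 * R * X\<^sup>2"]
    by (intro summable_mult) (simp add: divide_inverse mult.commute)
  moreover have "\<bar>jet lam D E (n + k) j t\<bar> * (X ^ (2 * n) / fact (2 * n)) \<le> M n"
    if "t \<in> I" "k \<le> 1" "j \<le> 1" for n k j t
  proof -
    have "fact (n + k + 2 * j) \<le> (fact (n + 3) :: real)" using that by (intro fact_mono) simp
    also have "\<dots> = real (n + 3) * real (n + 2) * real (n + 1) * fact n"
      by (simp add: numeral_3_eq_3 algebra_simps)
    also have "\<dots> \<le> (3 * 2 ^ n) * (2 * 2 ^ n) * 2 ^ n * fact n"
    proof (intro mult_mono)
      have "n + 3 \<le> 3 * 2 ^ n" "n + 2 \<le> 2 * 2 ^ n" "n + 1 \<le> 2 ^ n" by (induction n) auto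
      from this[THEN of_nat_mono[where 'a = real]]
      show "real (n + 3) \<le> 3 * 2 ^ n" "real (n + 2) \<le> 2 * 2 ^ n" "real (n + 1) \<le> 2 ^ n" by simp_all
    qed auto
    also have "\<dots> = 6 * 8 ^ n * fact n"
    proof -
      have "(8::real) ^ n = 2 ^ n * 2 ^ n * 2 ^ n" by (simp flip: power_mult_distrib)
      then show ?thesis by simp
    qed
    finally have f: "fact (n + k + 2 * j) \<le> 6 * 8 ^ n * (fact n :: real)" .
    have "\<bar>jet lam D E (n + k) j t\<bar> \<le> C * 2 ^ (n + k) * R ^ (n + k + 2 * j) * fact (n + k + 2 * j)"
      using C(3) that by blast
    also have "\<dots> \<le> C * (2 * 2 ^ n) * (R ^ 3 * R ^ n) * (6 * 8 ^ n * fact n)"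
    proof (intro mult_mono f)
      have "(2::real) ^ (n + k) \<le> 2 ^ Suc n" using that by (intro power_increasing) auto
      then show "(2::real) ^ (n + k) \<le> 2 * 2 ^ n" by simp
      have "R ^ (n + k + 2 * j) \<le> R ^ (3 + n)" using that C by (intro power_increasing) auto
      then show "R ^ (n + k + 2 * j) \<le> R ^ 3 * R ^ n" by (simp add: power_add)
    qed (use C in auto)
    also have "\<dots> = 12 * C * R ^ 3 * (16 * R) ^ n * fact n"
    proof -
      have e: "(16::real) ^ n = 2 ^ n * 8 ^ n" by (subst power_mult_distrib[symmetric]) simp
      have e': "(12::real) = 2 * 6" by simp
      show ?thesis unfolding power_mult_distrib e e' by (simp only: mult_ac)
    qed
    finally have "\<bar>jet lam D E (n + k) j t\<bar> * (X ^ (2 * n) / fact (2 * n)) \<le>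
        12 * C * R ^ 3 * (16 * R) ^ n * fact n * (X ^ (2 * n) / fact (2 * n))"
      using assms(4) by (intro mult_right_mono) auto
    also have "\<dots> = 12 * C * R ^ 3 * (16 * R) ^ n * X ^ (2 * n) * (fact n / fact (2 * n))"
      by simp
    also have "\<dots> \<le> 12 * C * R ^ 3 * (16 * R) ^ n * X ^ (2 * n) * (1 / fact n)"
      using fact_sq_le[of n] C assms(4) by (intro mult_left_mono) (auto simp: field_simps power2_eq_square)
    also have "\<dots> = M n"
      by (simp add: M_def power_mult_distrib power_mult)
    finally show ?thesis .
  qed
  ultimately show thesis using that by blast
qed

text \<open>
  Here \<open>X\<close> is the distance from the end where the traces are prescribed. A sequence \<open>w\<close> of weights
  stands for a linear functional of the profile \<open>y(t,\<cdot>)\<close>, given by its values on the monomials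
  \<open>(x - L) ^ (2 n) / fact (2 n)\<close>: the weights \<open>q\<close> evaluate at the far end, and integrals against a
  function are of this form as well. Then \<open>series 0 0 w\<close> is the functional applied to \<open>y\<close>, \<open>series 1 0 w\<close>
  applied to \<open>y\<^sub>x\<^sub>x\<close> and \<open>series 0 1 w\<close> applied to \<open>y\<^sub>t\<close>.
\<close>
locale flat_system =
  fixes lam X :: real and D E :: "nat \<Rightarrow> real \<Rightarrow> real" and I :: "real set"
  assumes D: "gevrey I D" and E: "gevrey I E" and lam: "lam \<ge> 0" and X: "X \<ge> 0"
    and I: "open I" "convex I"
begin

definition q :: "nat \<Rightarrow> real" where "q n = X ^ (2 * n) / fact (2 * n)"

definition weight :: "(nat \<Rightarrow> real) \<Rightarrow> bool" where
  "weight w \<longleftrightarrow> (\<exists>c\<ge>0. \<forall>n. \<bar>w n\<bar> \<le> c * q n)"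

definition series :: "nat \<Rightarrow> nat \<Rightarrow> (nat \<Rightarrow> real) \<Rightarrow> real \<Rightarrow> real" where
  "series k j w t = (\<Sum>n. jet lam D E (n + k) j t * w n)"

lemma jet_has_deriv:
  assumes "t \<in> I"
  shows "(jet lam D E n j has_real_derivative jet lam D E n (Suc j) t) (at t)"
proof (rule jet_deriv)
  show "(D n has_real_derivative D (Suc n) t) (at t)" "(E n has_real_derivative E (Suc n) t) (at t)" for n
    using D E assms unfolding gevrey_def by blast+
qed

lemma weight_q: "weight q"
  unfolding weight_def by (rule exI[of _ 1]) (use X in \<open>auto simp: q_def\<close>)

lemma majorant:
  assumes "weight w"
  shows "\<exists>M. summable M \<and> (\<forall>n. \<forall>t\<in>I. \<forall>k\<le>1. \<forall>j\<le>1. norm (jet lam D E (n + k) j t * w n) \<le> M n)"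
proof -
  obtain c where c: "c \<ge> 0" "\<And>n. \<bar>w n\<bar> \<le> c * q n" using assms by (auto simp: weight_def)
  obtain M where M: "summable M"
    "\<And>n k j t. t \<in> I \<Longrightarrow> k \<le> 1 \<Longrightarrow> j \<le> 1 \<Longrightarrow> \<bar>jet lam D E (n + k) j t\<bar> * (X ^ (2 * n) / fact (2 * n)) \<le> M n"
    using jet_series_majorant[OF D E lam X] by blast
  show ?thesis
  proof (intro exI[of _ "\<lambda>n. c * M n"] conjI ballI allI impI)
    show "summable (\<lambda>n. c * M n)" using M(1) by (rule summable_mult)
    fix n t k j assume *: "t \<in> I" "k \<le> (1::nat)" "j \<le> (1::nat)"
    have "norm (jet lam D E (n + k) j t * w n) \<le> \<bar>jet lam D E (n + k) j t\<bar> * (c * q n)"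
      using c by (simp add: abs_mult mult_left_mono)
    also have "\<dots> \<le> c * M n"
      using mult_left_mono[OF M(2)[OF *] c(1)] by (simp add: q_def mult_ac)
    finally show "norm (jet lam D E (n + k) j t * w n) \<le> c * M n" .
  qed
qed

lemma summable_series:
  assumes "weight w" "t \<in> I" "k \<le> 1" "j \<le> 1"
  shows "summable (\<lambda>n. jet lam D E (n + k) j t * w n)"
proof -
  obtain M where M0: "summable M \<and> (\<forall>n. \<forall>t\<in>I. \<forall>k\<le>1. \<forall>j\<le>1. norm (jet lam D E (n + k) j t * w n) \<le> M n)"
    using majorant[OF assms(1)] ..
  have M1: "summable M" using M0 ..
  have M2: "norm (jet lam D E (n + k) j t * w n) \<le> M n" if "t \<in> I" "k \<le> 1" "j \<le> 1" for n k j t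
    using M0 that by blast
  note M = M1 M2
  show ?thesis
    by (rule summable_comparison_test'[OF M1, of 0]) (rule M2[OF assms(2-4)])
qed

lemma series_deriv:
  assumes w: "weight w" and "t \<in> I" "k \<le> 1"
  shows "(series k 0 w has_real_derivative series k 1 w t) (at t)"
proof -
  obtain M where M0: "summable M \<and> (\<forall>n. \<forall>t\<in>I. \<forall>k\<le>1. \<forall>j\<le>1. norm (jet lam D E (n + k) j t * w n) \<le> M n)"
    using majorant[OF w] ..
  have M1: "summable M" using M0 ..
  have M2: "norm (jet lam D E (n + k) j t * w n) \<le> M n" if "t \<in> I" "k \<le> 1" "j \<le> 1" for n k j t
    using M0 that by blast
  note M = M1 M2
  have "((\<lambda>t. \<Sum>n. jet lam D E (n + k) 0 t * w n) has_real_derivative (\<Sum>n. jet lam D E (n + k) 1 t * w n)) (at t)"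
  proof (rule has_field_derivative_series'(2)[where ?x0.0 = t and S = I
      and f = "\<lambda>n t. jet lam D E (n + k) 0 t * w n" and f' = "\<lambda>n t. jet lam D E (n + k) 1 t * w n"])
    show "convex I" "t \<in> I" by (rule I(2) assms(2))+
    show "summable (\<lambda>n. jet lam D E (n + k) 0 t * w n)"
      by (rule summable_series[OF w assms(2,3)]) simp
    show "((\<lambda>t. jet lam D E (n + k) 0 t * w n) has_real_derivative jet lam D E (n + k) 1 x * w n) (at x within I)"
      if "x \<in> I" for n x
      using DERIV_cmult_right[OF jet_has_deriv[OF that, of "n + k" 0], of "w n"]
      unfolding One_nat_def by (rule has_field_derivative_at_within)
    show "uniformly_convergent_on I (\<lambda>n x. \<Sum>i<n. jet lam D E (i + k) 1 x * w i)"
      by (rule Weierstrass_m_test'[OF _ M1]) (rule M2[OF _ assms(3) order_refl])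
    show "t \<in> interior I" using I assms(2) by (simp add: interior_open)
  qed
  then show ?thesis by (simp only: series_def[abs_def])
qed

lemma series_deriv_continuous:
  assumes w: "weight w" and "k \<le> 1"
  shows "continuous_on I (series k 1 w)"
proof -
  obtain M where M0: "summable M \<and> (\<forall>n. \<forall>t\<in>I. \<forall>k\<le>1. \<forall>j\<le>1. norm (jet lam D E (n + k) j t * w n) \<le> M n)"
    using majorant[OF w] ..
  have M1: "summable M" using M0 ..
  have M2: "norm (jet lam D E (n + k) j t * w n) \<le> M n" if "t \<in> I" "k \<le> 1" "j \<le> 1" for n k j t
    using M0 that by blast
  note M = M1 M2
  have "continuous_on I (jet lam D E (i + k) 1)" for i
    by (intro continuous_at_imp_continuous_on ballI) (rule DERIV_isCont[OF jet_has_deriv])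
  then show ?thesis
    unfolding series_def[abs_def]
    by (intro uniform_limit_theorem[OF _ Weierstrass_m_test[OF M2[OF _ assms(2) order_refl] M1]] always_eventually allI
        continuous_intros sequentially_bot)
qed

text \<open>
  The recursion for \<open>w\<close> expresses two integrations by parts against \<open>sin (mu x)\<close> whose boundary terms
  vanish at \<open>x = L\<close>. Together with the recursion for the \<open>h n\<close> it yields the ordinary differential
  equation of one Fourier coefficient, driven by the values of \<open>y\<close> and \<open>y\<^sub>x\<^sub>x\<close> at \<open>x = 0\<close>.
\<close>
lemma series_balance:
  assumes w: "weight w" and t: "t \<in> I" and mu: "mu \<noteq> 0" "m = mu\<^sup>2"
    and w0: "w 0 = 1 / mu" and rec: "\<And>n. w n = mu * q (Suc n) - m * w (Suc n)"
  shows "series 0 1 w t = - (m * (m - lam)) * series 0 0 w t + mu * ((m - lam) * series 0 0 q t - series 1 0 q t)"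
proof -
  note sw = summable_series[OF w t] and sq = summable_series[OF weight_q t]
  let ?H = "\<lambda>n. jet lam D E n 0 t"
  have shift: "(\<Sum>n. ?H (Suc n + k) * w n) = mu * series k 0 q t - m * series k 0 w t" if k: "k \<le> 1" for k
  proof -
    have s1: "summable (\<lambda>n. ?H (n + k) * q n)" "summable (\<lambda>n. ?H (n + k) * w n)"
      using sq[OF k, of 0] sw[OF k, of 0] by auto
    note s2 = s1[THEN summable_ignore_initial_segment[of _ 1]]
    have "(\<Sum>n. ?H (Suc n + k) * w n) = (\<Sum>n. mu * (?H (Suc n + k) * q (Suc n)) - m * (?H (Suc n + k) * w (Suc n)))"
      by (subst rec) (simp add: algebra_simps)
    also have "\<dots> = mu * (\<Sum>n. ?H (Suc n + k) * q (Suc n)) - m * (\<Sum>n. ?H (Suc n + k) * w (Suc n))"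
      using s2 by (simp add: suminf_diff[symmetric] suminf_mult summable_mult)
    also have "(\<Sum>n. ?H (Suc n + k) * q (Suc n)) = series k 0 q t - ?H k * q 0"
      using suminf_split_head[OF s1(1)] by (simp add: series_def)
    also have "(\<Sum>n. ?H (Suc n + k) * w (Suc n)) = series k 0 w t - ?H k * w 0"
      using suminf_split_head[OF s1(2)] by (simp add: series_def)
    finally have "(\<Sum>n. ?H (Suc n + k) * w n) =
        mu * (series k 0 q t - ?H k * q 0) - m * (series k 0 w t - ?H k * w 0)" .
    moreover have "q 0 = 1" by (simp add: q_def)
    moreover have "m * (?H k * w 0) = mu * ?H k" using mu by (simp add: w0 power2_eq_square)
    ultimately show ?thesis
      by (simp add: right_diff_distrib)
  qed
  have eq: "jet lam D E n 1 t = - ?H (Suc n + 1) - lam * ?H (Suc n)" for n by simp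
  have s1: "summable (\<lambda>n. ?H (Suc n) * w n)" using sw[of 1 0] by simp
  have "summable (\<lambda>n. - (jet lam D E n 1 t * w n) - lam * (?H (Suc n) * w n))"
    using sw[of 0 1] s1 by (intro summable_diff summable_minus summable_mult) auto
  then have s2: "summable (\<lambda>n. ?H (Suc n + 1) * w n)"
    by (simp add: algebra_simps)
  have "series 0 1 w t = (\<Sum>n. - (?H (Suc n + 1) * w n) - lam * (?H (Suc n + 0) * w n))"
    unfolding series_def add_0_right eq by (simp add: algebra_simps)
  also have "\<dots> = - (\<Sum>n. ?H (Suc n + 1) * w n) - lam * (\<Sum>n. ?H (Suc n + 0) * w n)"
    using s1 s2 by (simp add: suminf_diff[symmetric] suminf_mult suminf_minus summable_mult summable_minus)
  also have "\<dots> = - (mu * series 1 0 q t - m * series 1 0 w t) - lam * (mu * series 0 0 q t - m * series 0 0 w t)"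
    using shift[of 0] shift[of 1] by simp
  also have "series 1 0 w t = mu * series 0 0 q t - m * series 0 0 w t"
    using shift[of 0] by (simp add: series_def)
  finally show ?thesis by (simp add: algebra_simps)
qed

end

section \<open>Orthonormal expansions in Hilbert space\<close>

locale orthonormal_sequence =
  fixes e :: "nat \<Rightarrow> 'a::{real_inner,banach}"
  assumes ortho: "inner (e i) (e j) = (if i = j then 1 else 0)"
begin

definition combo :: "(nat \<Rightarrow> real) \<Rightarrow> 'a" where "combo a = (\<Sum>k. a k *\<^sub>R e k)"

lemma inner_sum_e: "finite A \<Longrightarrow> inner (\<Sum>k\<in>A. a k *\<^sub>R e k) (e j) = (if j \<in> A then a j else 0)"
  by (simp add: inner_sum_left ortho if_distrib cong: if_cong)

lemma norm_sum_sq: "finite A \<Longrightarrow> (norm (\<Sum>k\<in>A. a k *\<^sub>R e k))\<^sup>2 = (\<Sum>k\<in>A. (a k)\<^sup>2)"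
  unfolding power2_norm_eq_inner by (simp add: inner_sum_right inner_sum_e power2_eq_square)

lemma summable_combo:
  assumes "summable (\<lambda>k. (a k)\<^sup>2)"
  shows "summable (\<lambda>k. a k *\<^sub>R e k)"
  unfolding summable_Cauchy
proof (intro allI impI)
  fix r :: real assume r: "r > 0"
  then have "r\<^sup>2 > 0" by simp
  then obtain N where N: "\<forall>m\<ge>N. \<forall>n. norm (\<Sum>k\<in>{m..<n}. (a k)\<^sup>2) < r\<^sup>2"
    using assms unfolding summable_Cauchy by blast
  have "norm (\<Sum>k\<in>{m..<n}. a k *\<^sub>R e k) < r" if "m \<ge> N" for m n
  proof (rule power2_less_imp_less)
    have "norm (\<Sum>k\<in>{m..<n}. (a k)\<^sup>2) < r\<^sup>2" using N that by blast
    then show "(norm (\<Sum>k\<in>{m..<n}. a k *\<^sub>R e k))\<^sup>2 < r\<^sup>2"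
      by (simp add: norm_sum_sq)
  qed (use r in simp)
  then show "\<exists>N. \<forall>m\<ge>N. \<forall>n. norm (\<Sum>k\<in>{m..<n}. a k *\<^sub>R e k) < r" by blast
qed

lemma inner_combo:
  assumes "summable (\<lambda>k. (a k)\<^sup>2)"
  shows "inner (combo a) (e j) = a j"
proof -
  have "inner (combo a) (e j) = (\<Sum>k. inner (a k *\<^sub>R e k) (e j))"
    unfolding combo_def
    by (rule bounded_linear.suminf[OF bounded_linear_inner_left summable_combo[OF assms]])
  also have "\<dots> = (\<Sum>k\<in>{j}. inner (a k *\<^sub>R e k) (e j))"
    by (rule suminf_finite) (auto simp: ortho)
  finally show ?thesis by (simp add: ortho)
qed

lemma norm_combo:
  assumes "summable (\<lambda>k. (a k)\<^sup>2)"
  shows "(norm (combo a))\<^sup>2 = (\<Sum>k. (a k)\<^sup>2)"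
proof (rule LIMSEQ_unique)
  show "(\<lambda>n. (norm (\<Sum>k<n. a k *\<^sub>R e k))\<^sup>2) \<longlonglongrightarrow> (norm (combo a))\<^sup>2"
    unfolding combo_def using summable_LIMSEQ[OF summable_combo[OF assms]] by (intro tendsto_intros)
  show "(\<lambda>n. (norm (\<Sum>k<n. a k *\<^sub>R e k))\<^sup>2) \<longlonglongrightarrow> (\<Sum>k. (a k)\<^sup>2)"
    using summable_LIMSEQ[OF assms] by (simp add: norm_sum_sq)
qed

lemma bessel:
  shows "summable (\<lambda>k. (inner f (e k))\<^sup>2)" "(\<Sum>k. (inner f (e k))\<^sup>2) \<le> (norm f)\<^sup>2"
proof -
  have le: "(\<Sum>k<n. (inner f (e k))\<^sup>2) \<le> (norm f)\<^sup>2" for n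
  proof -
    let ?s = "\<Sum>k<n. inner f (e k) *\<^sub>R e k"
    have 1: "inner ?s ?s = (\<Sum>k<n. (inner f (e k))\<^sup>2)"
      using norm_sum_sq[of "{..<n}" "\<lambda>k. inner f (e k)"] by (simp add: power2_norm_eq_inner)
    have 2: "inner f ?s = (\<Sum>k<n. (inner f (e k))\<^sup>2)"
      by (simp add: inner_sum_right power2_eq_square)
    have "0 \<le> inner (f - ?s) (f - ?s)" by simp
    also have "\<dots> = inner f f - (\<Sum>k<n. (inner f (e k))\<^sup>2)"
      using 1 2 by (simp add: inner_diff inner_commute)
    finally show ?thesis by (simp add: power2_norm_eq_inner)
  qed
  show 1: "summable (\<lambda>k. (inner f (e k))\<^sup>2)"
    by (rule summableI_nonneg_bounded[OF _ le]) simp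
  show "(\<Sum>k. (inner f (e k))\<^sup>2) \<le> (norm f)\<^sup>2"
    using le by (rule suminf_le_const[OF 1])
qed

text \<open>
  Tannery's theorem applied to the squared norm of the difference. Strong continuity of the semigroup
  and convergence of its difference quotients are both instances.
\<close>
lemma combo_tendsto:
  assumes lim: "\<And>k. ((\<lambda>t. a k t) \<longlongrightarrow> b k) F"
    and bound: "\<forall>\<^sub>F t in F. \<forall>k. \<bar>a k t\<bar> \<le> M k"
    and M: "summable (\<lambda>k. (M k)\<^sup>2)" and F: "F \<noteq> bot"
  shows "summable (\<lambda>k. (b k)\<^sup>2)" "((\<lambda>t. combo (\<lambda>k. a k t)) \<longlongrightarrow> combo b) F"
proof -
  have sq: "x\<^sup>2 \<le> y\<^sup>2" if "\<bar>x\<bar> \<le> y" for x y :: real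
    using power_mono[OF that, of 2] by simp
  have bM: "\<bar>b k\<bar> \<le> M k" for k
  proof (rule tendsto_upperbound[OF tendsto_rabs[OF lim] _ F])
    show "\<forall>\<^sub>F t in F. \<bar>a k t\<bar> \<le> M k" using bound by eventually_elim auto
  qed
  show sb: "summable (\<lambda>k. (b k)\<^sup>2)"
    by (rule summable_comparison_test'[OF M, of 0]) (use bM sq in auto)
  have sa: "\<forall>\<^sub>F t in F. summable (\<lambda>k. (a k t)\<^sup>2)"
    using bound
  proof eventually_elim
    case (elim t)
    show ?case by (rule summable_comparison_test'[OF M, of 0]) (use elim sq in auto)
  qed
  have s4: "summable (\<lambda>k. 4 * (M k)\<^sup>2)" using M by (rule summable_mult)
  have le4: "norm ((a k t - b k)\<^sup>2) \<le> 4 * (M k)\<^sup>2" if "\<forall>k. \<bar>a k t\<bar> \<le> M k" for k t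
  proof -
    have "\<bar>a k t - b k\<bar> \<le> 2 * M k" using that bM[of k] spec[OF that, of k] by linarith
    from sq[OF this] show ?thesis by (simp add: power_mult_distrib)
  qed
  have lim0: "((\<lambda>t. \<Sum>k. (a k t - b k)\<^sup>2) \<longlongrightarrow> (\<Sum>k::nat. 0)) F"
  proof (rule tannerys_theorem[THEN conjunct2, THEN conjunct2])
    show "((\<lambda>t. (a k t - b k)\<^sup>2) \<longlongrightarrow> 0) F" for k
      using tendsto_power[OF tendsto_diff[OF lim[of k] tendsto_const[of "b k"]], of 2] by simp
    have "\<forall>\<^sub>F (k,t) in at_top \<times>\<^sub>F F. \<forall>k. \<bar>a k t\<bar> \<le> M k"
      using eventually_prodI[OF eventually_True[of at_top] bound] by (simp add: case_prod_unfold)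
    then show "\<forall>\<^sub>F (k,t) in at_top \<times>\<^sub>F F. norm ((a k t - b k)\<^sup>2) \<le> 4 * (M k)\<^sup>2"
      by eventually_elim (use le4 in auto)
  qed (use s4 F in auto)
  have "\<forall>\<^sub>F t in F. (norm (combo (\<lambda>k. a k t) - combo b))\<^sup>2 = (\<Sum>k. (a k t - b k)\<^sup>2)"
    using sa bound
  proof eventually_elim
    case (elim t)
    have "combo (\<lambda>k. a k t) - combo b = combo (\<lambda>k. a k t - b k)"
      unfolding combo_def
      by (simp add: suminf_diff summable_combo elim(1) sb scaleR_diff_left)
    moreover have "summable (\<lambda>k. (a k t - b k)\<^sup>2)"
      by (rule summable_comparison_test'[OF s4, of 0]) (use le4 elim in blast)
    ultimately show ?case by (simp add: norm_combo)
  qed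
  then have "((\<lambda>t. (norm (combo (\<lambda>k. a k t) - combo b))\<^sup>2) \<longlongrightarrow> 0) F"
    using lim0 tendsto_cong by force
  from tendsto_real_sqrt[OF this] have "((\<lambda>t. norm (combo (\<lambda>k. a k t) - combo b)) \<longlongrightarrow> 0) F"
    by simp
  then show "((\<lambda>t. combo (\<lambda>k. a k t)) \<longlongrightarrow> combo b) F"
    by (rule LIM_zero_cancel[OF tendsto_norm_zero_cancel])
qed

end

section \<open>Orthogonality in square integrable functions\<close>

lemma inner_abs_L2:
  "square_integrable f \<Longrightarrow> square_integrable g \<Longrightarrow> inner (abs_L2 f) (abs_L2 g) = (LINT x|lborel. f x * g x)"
  by (simp add: inner_L2.abs_eq L2_rel_refl)

lemma inner_rep_abs_L2:
  "square_integrable g \<Longrightarrow> inner f (abs_L2 g) = (LINT x|lborel. rep_L2 f x * g x)"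
  using inner_abs_L2[OF square_integrable_rep[of f], of g] by (simp add: abs_rep_L2)

lemma rep_L2_measurable [measurable]: "rep_L2 f \<in> borel_measurable borel"
  using square_integrable_rep[of f] by (simp add: square_integrable_def)

lemma continuous_on_indicator_measurable:
  fixes f :: "real \<Rightarrow> real"
  assumes "continuous_on {0..b} f"
  shows "(\<lambda>x. indicator {0<..<b} x * f x) \<in> borel_measurable borel"
  using borel_measurable_continuous_on_indicator[of "{0<..<b}" f] assms
  by (simp add: continuous_on_subset[OF assms] greaterThanLessThan_subseteq_atLeastAtMost_iff)

lemma square_integrable_bounded_interval:
  assumes "(\<lambda>x. indicator {0<..<b} x * f x) \<in> borel_measurable borel" "\<And>x. x \<in> {0<..<b} \<Longrightarrow> \<bar>f x\<bar> \<le> C"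
  shows "square_integrable (\<lambda>x. indicator {0<..<b} x * f x)"
proof (rule square_integrable_bounded)
  show "square_integrable (\<lambda>x. C * indicator {0<..<b} x)"
    by (intro square_integrable_scale square_integrable_interval)
  show "AE x in lborel. \<bar>indicator {0<..<b} x * f x\<bar> \<le> \<bar>C * indicator {0<..<b} x\<bar>"
    using assms(2) by (intro AE_I2) (force simp: indicator_def)
qed (use assms in simp)

lemma continuous_on_bounded_abs:
  fixes f :: "real \<Rightarrow> real"
  assumes "continuous_on {a..b} f"
  obtains C where "C \<ge> 0" "\<And>x. x \<in> {a..b} \<Longrightarrow> \<bar>f x\<bar> \<le> C"
proof -
  have "bounded (f ` {a..b})"
    using assms by (intro compact_imp_bounded compact_continuous_image) auto
  then obtain C where "\<And>x. x \<in> {a..b} \<Longrightarrow> \<bar>f x\<bar> \<le> C"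
    unfolding bounded_iff by (metis imageI real_norm_def)
  then have "\<And>x. x \<in> {a..b} \<Longrightarrow> \<bar>f x\<bar> \<le> \<bar>C\<bar>" by force
  then show thesis using that[of "\<bar>C\<bar>"] by simp
qed

lemma square_integrable_continuous:
  assumes "continuous_on {0..b} f"
  shows "square_integrable (\<lambda>x. indicator {0<..<b} x * f x)"
proof -
  obtain C where "\<And>x. x \<in> {0..b} \<Longrightarrow> \<bar>f x\<bar> \<le> C"
    using continuous_on_bounded_abs[OF assms] by blast
  then show ?thesis
    using continuous_on_indicator_measurable[OF assms] by (intro square_integrable_bounded_interval[of b f C]) auto
qed

lemma inner_L2_of:
  assumes "continuous_on {0..b} g"
  shows "inner f (L2_of b g) = (LINT x:{0<..<b}|lborel. rep_L2 f x * g x)"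
  unfolding L2_of_def set_lebesgue_integral_def
  by (subst inner_rep_abs_L2[OF square_integrable_continuous[OF assms]]) (simp add: mult_ac)

lemma set_integrable_continuous_Ioo:
  fixes f :: "real \<Rightarrow> real"
  assumes "continuous_on {0..b} f"
  shows "set_integrable lborel {0..b} f" "set_integrable lborel {0<..<b} f"
proof -
  show 1: "set_integrable lborel {0..b} f"
    unfolding set_integrable_def using borel_integrable_compact[OF _ assms] by simp
  show "set_integrable lborel {0<..<b} f"
    by (rule set_integrable_subset[OF 1]) auto
qed

lemma set_integral_Ioo_eq_integral:
  fixes f :: "real \<Rightarrow> real"
  assumes "continuous_on {0..b} f"
  shows "(LINT x:{0<..<b}|lborel. f x) = integral {0..b} f"
proof -
  have "(LINT x:{0<..<b}|lborel. f x) = (LINT x:{0..b}|lborel. f x)"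
  proof (rule set_integral_cong_set)
    show "set_borel_measurable lborel {0<..<b} f" "set_borel_measurable lborel {0..b} f"
      using set_integrable_continuous_Ioo[OF assms]
      by (auto simp: set_integrable_def set_borel_measurable_def dest: borel_measurable_integrable)
    have "AE x in lborel. x \<noteq> 0 \<and> x \<noteq> b"
      by (intro AE_conjI AE_lborel_singleton)
    then show "AE x in lborel. (x \<in> {0..b}) = (x \<in> {0<..<b})"
      by eventually_elim auto
  qed
  also have "\<dots> = integral {0..b} f"
    by (rule set_borel_integral_eq_integral(2)[OF set_integrable_continuous_Ioo(1)[OF assms]])
  finally show ?thesis .
qed

lemma inner_L2_of_L2_of:
  assumes "continuous_on {0..b} f" "continuous_on {0..b} g"
  shows "inner (L2_of b f) (L2_of b g) = integral {0..b} (\<lambda>x. f x * g x)"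
proof -
  have "inner (L2_of b f) (L2_of b g) = (LINT x|lborel. (indicator {0<..<b} x * f x) * (indicator {0<..<b} x * g x))"
    unfolding L2_of_def by (intro inner_abs_L2 square_integrable_continuous assms)
  also have "\<dots> = (LINT x:{0<..<b}|lborel. f x * g x)"
    unfolding set_lebesgue_integral_def by (intro Bochner_Integration.integral_cong) (auto simp: indicator_def)
  also have "\<dots> = integral {0..b} (\<lambda>x. f x * g x)"
    by (rule set_integral_Ioo_eq_integral) (intro continuous_intros assms)
  finally show ?thesis .
qed

lemma L2_of_add:
  assumes "continuous_on {0..b} f" "continuous_on {0..b} g"
  shows "L2_of b (\<lambda>x. f x + g x) = L2_of b f + L2_of b g"
  unfolding L2_of_def
  by (subst abs_L2_add) (auto simp: square_integrable_continuous assms distrib_left right_diff_distrib mult.left_commute)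

lemma L2_of_scale:
  assumes "continuous_on {0..b} f"
  shows "L2_of b (\<lambda>x. c * f x) = c *\<^sub>R L2_of b f"
  unfolding L2_of_def
  by (subst abs_L2_scaleR) (auto simp: square_integrable_continuous assms distrib_left right_diff_distrib mult.left_commute)

lemma L2_of_diff:
  assumes "continuous_on {0..b} f" "continuous_on {0..b} g"
  shows "L2_of b (\<lambda>x. f x - g x) = L2_of b f - L2_of b g"
  unfolding L2_of_def
  by (subst abs_L2_diff) (auto simp: square_integrable_continuous assms distrib_left right_diff_distrib mult.left_commute)

lemma L2_of_cong:
  "(\<And>x. x \<in> {0<..<b} \<Longrightarrow> f x = g x) \<Longrightarrow> L2_of b f = L2_of b g"
  unfolding L2_of_def by (rule arg_cong[of _ _ abs_L2]) (auto simp: indicator_def)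

lemma L2_of_in_L2_on:
  assumes "square_integrable (\<lambda>x. indicator {0<..<b} x * f x)"
  shows "L2_of b f \<in> L2_on b"
  using rep_abs_L2[OF assms] by (auto simp: L2_of_def L2_on_def elim!: eventually_mono)

lemma norm_L2_of_le:
  assumes "continuous_on {0..b} f" "b > 0" "\<And>x. x \<in> {0..b} \<Longrightarrow> \<bar>f x\<bar> \<le> c" "c \<ge> 0"
  shows "norm (L2_of b f) \<le> sqrt b * c"
proof (rule power2_le_imp_le)
  have "(norm (L2_of b f))\<^sup>2 = integral {0..b} (\<lambda>x. f x * f x)"
    by (simp add: power2_norm_eq_inner inner_L2_of_L2_of assms)
  also have "\<dots> \<le> integral {0..b} (\<lambda>x. c * c)"
  proof (rule integral_le)
    show "(\<lambda>x. f x * f x) integrable_on {0..b}"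
      by (intro integrable_continuous_real continuous_intros assms)
    show "f x * f x \<le> c * c" if "x \<in> {0..b}" for x
      using power_mono[OF assms(3)[OF that], of 2] by (simp add: power2_eq_square)
  qed (rule integrable_const_ivl)
  also have "\<dots> = (sqrt b * c)\<^sup>2"
    using assms(2) by (simp add: power_mult_distrib power2_eq_square)
  finally show "(norm (L2_of b f))\<^sup>2 \<le> (sqrt b * c)\<^sup>2" .
qed (use assms in auto)

text \<open>
  Rational combinations of indicators of intervals are dense in \<open>L\<^sup>2(\<real>)\<close>.
\<close>
lemma orthogonal_intervals_imp_zero:
  assumes "\<And>a c. inner f (abs_L2 (indicator {a<..<c})) = 0"
  shows "f = 0"
proof -
  have "inner f (rat_step l) = 0" for l
    by (induction l) (auto simp: rat_step_def inner_add_right assms)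
  then have "range rat_step \<subseteq> {g. inner f g = 0}" by auto
  moreover have "closed {g. inner f g = 0}"
    by (intro closed_Collect_eq continuous_intros)
  ultimately have "closure (range rat_step) \<subseteq> {g. inner f g = 0}"
    by (rule closure_minimal)
  then have "f \<in> {g. inner f g = 0}" unfolding closure_rat_step by blast
  then show ?thesis by simp
qed

lemma inner_L2_on_restrict:
  assumes "f \<in> L2_on b" "square_integrable g"
  shows "inner f (abs_L2 g) = inner f (abs_L2 (\<lambda>x. indicator {0<..<b} x * g x))"
proof -
  have g: "square_integrable (\<lambda>x. indicator {0<..<b} x * g x)"
    by (rule square_integrable_bounded[OF _ assms(2)])
      (use assms(2) in \<open>auto simp: square_integrable_def indicator_def\<close>)
  have "AE x in lborel. rep_L2 f x * g x = rep_L2 f x * (indicator {0<..<b} x * g x)"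
    using assms(1) unfolding L2_on_def mem_Collect_eq by eventually_elim (auto simp: indicator_def)
  then show ?thesis
    using assms(2) g unfolding inner_rep_abs_L2[OF assms(2)] inner_rep_abs_L2[OF g]
    by (intro integral_cong_AE) (auto simp: square_integrable_def)
qed

text \<open>
  Indicators of intervals are limits of trapezoidal functions supported strictly inside the interval
  and inside \<open>(0,b)\<close>.
\<close>
lemma orthogonal_compact_support_imp_zero:
  assumes f: "f \<in> L2_on b"
    and ortho: "\<And>g K. continuous_on UNIV g \<Longrightarrow> compact K \<Longrightarrow> K \<subseteq> {0<..<b} \<Longrightarrow> (\<And>x. x \<notin> K \<Longrightarrow> g x = 0) \<Longrightarrow> inner f (L2_of b g) = 0"
  shows "f = 0"
proof (rule orthogonal_intervals_imp_zero)
  fix a c :: real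
  define a' where "a' = max a 0"
  define c' where "c' = min c b"
  define g where "g n x = min 1 (real n * max 0 (min (x - a') (c' - x) - 1 / real (Suc n)))" for n x
  have g: "continuous_on A (g n)" for n A
    unfolding g_def by (intro continuous_intros)
  have g01: "0 \<le> g n x" "g n x \<le> 1" for n x
    by (simp_all add: g_def)
  have g0: "g n x = 0" if "min (x - a') (c' - x) \<le> 1 / real (Suc n)" for n x
    using that by (simp add: g_def max_absorb1 del: of_nat_Suc)
  have "(\<lambda>n. abs_L2 (\<lambda>x. indicator {0<..<b} x * g n x)) \<longlonglongrightarrow> abs_L2 (\<lambda>x. indicator {0<..<b} x * indicator {a<..<c} x)"
  proof (rule L2_dominated_convergence(3)[where w = "indicator {0<..<b}"])
    show "(\<lambda>x. indicator {0<..<b} x * g i x) \<in> borel_measurable lborel" for i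
      using continuous_on_indicator_measurable[OF g] by simp
    show "AE x in lborel. \<bar>indicator {0<..<b} x * g i x\<bar> \<le> indicator {0<..<b} x" for i
      using g01[of i] by (intro AE_I2) (simp add: indicator_def)
    have lim: "(\<lambda>i. g i x) \<longlonglongrightarrow> indicator {a<..<c} x" if x: "x \<in> {0<..<b}" for x
    proof (cases "x \<in> {a<..<c}")
      case True
      define d where "d = min (x - a') (c' - x)"
      have d: "d > 0" using True x by (simp add: d_def a'_def c'_def)
      then obtain N where N: "2 < real N * d" using reals_Archimedean3 by blast
      have "\<forall>\<^sub>F i in sequentially. 1 = g i x"
        using eventually_ge_at_top[of N]
      proof eventually_elim
        case (elim i)
        have "real N * d \<le> real i * d" using elim d by (intro mult_right_mono) auto
        moreover have "real i * (1 / real (Suc i)) \<le> 1" by simp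
        ultimately have "1 \<le> real i * (d - 1 / real (Suc i))" using N unfolding right_diff_distrib by linarith
        moreover from this have "d - 1 / real (Suc i) \<ge> 0"
          using mult_nonneg_nonpos[of "real i" "d - 1 / real (Suc i)"] by linarith
        ultimately show ?case by (simp add: g_def d_def[symmetric] del: of_nat_Suc)
      qed
      then show ?thesis using True by (intro tendsto_eventually) (auto elim: eventually_mono)
    next
      case False
      then have "min (x - a') (c' - x) \<le> 0" using x by (auto simp: a'_def c'_def)
      then have "g i x = 0" for i by (rule g0[OF order_trans]) simp
      then show ?thesis using False by simp
    qed
    show "AE x in lborel. (\<lambda>i. indicator {0<..<b} x * g i x) \<longlonglongrightarrow> indicator {0<..<b} x * indicator {a<..<c} x"
    proof (rule AE_I2)
      fix x
      show "(\<lambda>i. indicator {0<..<b} x * g i x) \<longlonglongrightarrow> indicator {0<..<b} x * indicator {a<..<c} x"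
        by (cases "x \<in> {0<..<b}") (intro tendsto_mult tendsto_const lim, simp_all)
    qed
  qed (use square_integrable_interval in auto)
  then have lim: "(\<lambda>n. inner f (L2_of b (g n))) \<longlonglongrightarrow> inner f (abs_L2 (\<lambda>x. indicator {0<..<b} x * indicator {a<..<c} x))"
    unfolding L2_of_def by (intro tendsto_intros)
  have "inner f (L2_of b (g n)) = 0" for n
  proof (rule ortho[OF g])
    have "0 < 1 / real (Suc n)" "0 \<le> a'" "c' \<le> b" by (simp_all add: a'_def c'_def)
    then show "{a' + 1 / real (Suc n)..c' - 1 / real (Suc n)} \<subseteq> {0<..<b}"
      unfolding subset_iff atLeastAtMost_iff greaterThanLessThan_iff by (intro allI impI conjI) linarith+
    show "g n x = 0" if "x \<notin> {a' + 1 / real (Suc n)..c' - 1 / real (Suc n)}" for x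
      by (rule g0) (use that in auto)
  qed simp
  then have "inner f (abs_L2 (\<lambda>x. indicator {0<..<b} x * indicator {a<..<c} x)) = 0"
    using lim by (simp add: LIMSEQ_const_iff)
  then show "inner f (abs_L2 (indicator {a<..<c})) = 0"
    using inner_L2_on_restrict[OF f square_integrable_interval] by simp
qed

lemma orthogonal_continuous_imp_zero:
  assumes f: "f \<in> L2_on b" and b: "b > 0"
    and ortho: "\<And>g. continuous_on {0..b} g \<Longrightarrow> inner f (L2_of b g) = 0"
  shows "f = 0"
  by (rule orthogonal_compact_support_imp_zero[OF f]) (auto intro: ortho continuous_on_subset)

lemma zero_le_of_small_multiples:
  fixes x K :: real
  assumes "\<And>r. r > 0 \<Longrightarrow> x \<le> K * r"
  shows "x \<le> 0"
proof (rule tendsto_lowerbound[of "\<lambda>r. K * r" _ "at_right 0"])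
  show "((\<lambda>r. K * r) \<longlongrightarrow> 0) (at_right 0)" by (auto intro!: tendsto_eq_intros)
  show "\<forall>\<^sub>F r in at_right 0. x \<le> K * r"
    using eventually_at_right_less[of "0::real"] by eventually_elim (use assms in auto)
qed simp

text \<open>
  By Stone--Weierstrass the polynomials in an injective continuous \<open>s\<close> are dense in \<open>C[0,b]\<close>, so the
  product of \<open>f\<close> with the weight vanishes. The weight may vanish at the end points, which is why
  density is applied to the product and not to \<open>f\<close> itself.
\<close>
lemma orthogonal_weighted_powers_imp_zero:
  assumes f: "f \<in> L2_on b" and b: "b > 0"
    and s: "continuous_on {0..b} s" "inj_on s {0..b}"
    and om: "continuous_on {0..b} om" "\<And>x. x \<in> {0<..<b} \<Longrightarrow> om x > 0"
    and ortho: "\<And>n. inner f (L2_of b (\<lambda>x. om x * s x ^ n)) = 0"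
  shows "f = 0"
proof -
  have poly0': "inner f (L2_of b (\<lambda>x. om x * s x ^ n * poly p (s x))) = 0" for n p
  proof (induction p arbitrary: n)
    case 0
    have "L2_of b (\<lambda>x. 0 * om x) = 0 *\<^sub>R L2_of b om" by (rule L2_of_scale[OF om(1)])
    then show ?case by simp
  next
    case (pCons a p)
    have "L2_of b (\<lambda>x. om x * s x ^ n * poly (pCons a p) (s x)) =
        L2_of b (\<lambda>x. a * (om x * s x ^ n) + om x * s x ^ Suc n * poly p (s x))"
      by (rule L2_of_cong) (simp add: algebra_simps)
    also have "\<dots> = L2_of b (\<lambda>x. a * (om x * s x ^ n)) + L2_of b (\<lambda>x. om x * s x ^ Suc n * poly p (s x))"
      by (rule L2_of_add) (intro continuous_intros om s)+
    also have "L2_of b (\<lambda>x. a * (om x * s x ^ n)) = a *\<^sub>R L2_of b (\<lambda>x. om x * s x ^ n)"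
      by (rule L2_of_scale) (intro continuous_intros om s)+
    finally show ?case using pCons.IH[of "Suc n"] ortho[of n] by (simp add: inner_add_right)
  qed
  have poly0: "inner f (L2_of b (\<lambda>x. om x * poly p (s x))) = 0" for p
    using poly0'[of 0 p] by simp
  have contp: "continuous_on {0..b} (\<lambda>x. poly p (s x))" for p
    by (intro continuous_intros s)
  have om0: "inner f (L2_of b (\<lambda>x. om x * g x)) = 0" if g: "continuous_on {0..b} g" for g :: "real \<Rightarrow> real"
  proof -
    have "function_ring_on (range (\<lambda>p x. poly p (s x))) {0..b}"
    proof (rule function_ring_on.intro)
      show "compact {0..b}" by simp
      show "continuous_on {0..b} f" if "f \<in> range (\<lambda>p x. poly p (s x))" for f
        using that contp by blast
      show "\<exists>f\<in>range (\<lambda>p x. poly p (s x)). f x \<noteq> f y" if "x \<in> {0..b}" "y \<in> {0..b}" "x \<noteq> y" for x y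
      proof (rule bexI[OF _ rangeI])
        show "poly [:0, 1:] (s x) \<noteq> poly [:0, 1:] (s y)"
          using that s(2) by (simp add: inj_on_eq_iff)
      qed
      show "(\<lambda>_. c) \<in> range (\<lambda>p x. poly p (s x))" for c
        using rangeI[of "\<lambda>p x. poly p (s x)" "[:c:]"] by simp
      fix f g assume "f \<in> range (\<lambda>p x. poly p (s x))" "g \<in> range (\<lambda>p x. poly p (s x))"
      then obtain p q where pq: "f = (\<lambda>x. poly p (s x))" "g = (\<lambda>x. poly q (s x))" by blast
      show "(\<lambda>x. f x + g x) \<in> range (\<lambda>p x. poly p (s x))"
        using rangeI[of "\<lambda>p x. poly p (s x)" "p + q"] by (simp add: pq)
      show "(\<lambda>x. f x * g x) \<in> range (\<lambda>p x. poly p (s x))"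
        using rangeI[of "\<lambda>p x. poly p (s x)" "p * q"] by (simp add: pq)
    qed
    then interpret function_ring_on "range (\<lambda>p x. poly p (s x))" "{0..b}" .
    obtain C where C0: "C \<ge> 0" and C: "\<And>x. x \<in> {0..b} \<Longrightarrow> \<bar>om x\<bar> \<le> C"
      using continuous_on_bounded_abs[OF om(1)] by blast
    have "\<bar>inner f (L2_of b (\<lambda>x. om x * g x))\<bar> \<le> (norm f * sqrt b * C) * r" if r: "r > 0" for r
    proof -
      obtain p where p: "\<And>x. x \<in> {0..b} \<Longrightarrow> \<bar>g x - poly p (s x)\<bar> < r"
        using Stone_Weierstrass_basic[OF g r] by blast
      have "L2_of b (\<lambda>x. om x * g x) - L2_of b (\<lambda>x. om x * poly p (s x)) = L2_of b (\<lambda>x. om x * g x - om x * poly p (s x))"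
        by (rule L2_of_diff[symmetric]) (intro continuous_intros om g s)+
      moreover have "norm (L2_of b (\<lambda>x. om x * g x - om x * poly p (s x))) \<le> sqrt b * (C * r)"
      proof (rule norm_L2_of_le[OF _ b])
        show "\<bar>om x * g x - om x * poly p (s x)\<bar> \<le> C * r" if "x \<in> {0..b}" for x
          using mult_mono[OF C[OF that] less_imp_le[OF p[OF that]]] C0
          by (simp add: abs_mult right_diff_distrib[symmetric])
      qed (use r in \<open>auto intro!: continuous_intros om g s simp: C0\<close>)
      ultimately have "\<bar>inner f (L2_of b (\<lambda>x. om x * g x) - L2_of b (\<lambda>x. om x * poly p (s x)))\<bar> \<le> norm f * (sqrt b * (C * r))"
        by (intro order_trans[OF Cauchy_Schwarz_ineq2] mult_left_mono) auto
      then show ?thesis by (simp add: inner_diff_right poly0 mult_ac)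
    qed
    then have "\<bar>inner f (L2_of b (\<lambda>x. om x * g x))\<bar> \<le> 0"
      by (rule zero_le_of_small_multiples)
    then show ?thesis by simp
  qed
  define F where "F = L2_of b (\<lambda>x. om x * rep_L2 f x)"
  obtain C where C: "C \<ge> 0" "\<And>x. x \<in> {0..b} \<Longrightarrow> \<bar>om x\<bar> \<le> C"
    using continuous_on_bounded_abs[OF om(1)] by blast
  have F: "square_integrable (\<lambda>x. indicator {0<..<b} x * (om x * rep_L2 f x))"
  proof (rule square_integrable_bounded)
    show "square_integrable (\<lambda>x. C * rep_L2 f x)"
      by (intro square_integrable_scale square_integrable_rep)
    show "(\<lambda>x. indicator {0<..<b} x * (om x * rep_L2 f x)) \<in> borel_measurable lborel"
      using borel_measurable_times[OF continuous_on_indicator_measurable[OF om(1)] rep_L2_measurable[of f]]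
      by (simp add: mult.assoc)
    show "AE x in lborel. \<bar>indicator {0<..<b} x * (om x * rep_L2 f x)\<bar> \<le> \<bar>C * rep_L2 f x\<bar>"
      using C by (intro AE_I2) (force simp: indicator_def abs_mult intro!: mult_right_mono)
  qed
  have "F = 0"
  proof (rule orthogonal_continuous_imp_zero[OF _ b])
    show "F \<in> L2_on b" unfolding F_def by (rule L2_of_in_L2_on[OF F])
    fix g :: "real \<Rightarrow> real" assume g: "continuous_on {0..b} g"
    have "inner F (L2_of b g) = (LINT x|lborel. (indicator {0<..<b} x * (om x * rep_L2 f x)) * (indicator {0<..<b} x * g x))"
      unfolding F_def L2_of_def by (intro inner_abs_L2 F square_integrable_continuous g)
    also have "\<dots> = (LINT x:{0<..<b}|lborel. rep_L2 f x * (om x * g x))"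
      unfolding set_lebesgue_integral_def by (intro Bochner_Integration.integral_cong) (auto simp: indicator_def)
    also have "\<dots> = inner f (L2_of b (\<lambda>x. om x * g x))"
      by (rule inner_L2_of[symmetric]) (intro continuous_intros om g)
    finally show "inner F (L2_of b g) = 0" using om0[OF g] by simp
  qed
  then have "L2_rel (\<lambda>x. indicator {0<..<b} x * (om x * rep_L2 f x)) (\<lambda>x. 0)"
    unfolding F_def L2_of_def abs_L2_zero[symmetric]
    using Quotient3_rel[OF Quotient3_L2] F square_integrable_zero L2_rel_refl by blast
  then have "AE x in lborel. indicator {0<..<b} x * (om x * rep_L2 f x) = 0"
    by (simp add: L2_rel_def)
  then have "AE x in lborel. rep_L2 f x = 0"
    using f unfolding L2_on_def mem_Collect_eq
  proof eventually_elim
    case (elim x)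
    then show ?case using om(2)[of x] by (cases "x \<in> {0<..<b}") auto
  qed
  then have "abs_L2 (rep_L2 f) = abs_L2 (\<lambda>x. 0)"
    by (intro abs_L2_cong square_integrable_rep square_integrable_zero)
  then show ?thesis by (simp add: abs_rep_L2 abs_L2_zero)
qed

section \<open>Completeness of the eigenfunctions\<close>

text \<open>
  The recursion puts every \<open>w 0 x * s x ^ n\<close> into the span of the \<open>w j\<close>. With \<open>s\<close> a cosine it is satisfied
  by families of equally spaced sines.
\<close>
lemma three_term_orthogonal_imp_zero:
  fixes w :: "int \<Rightarrow> real \<Rightarrow> real"
  assumes f: "f \<in> L2_on b" and b: "b > 0"
    and s: "continuous_on {0..b} s" "inj_on s {0..b}"
    and w: "\<And>j. continuous_on {0..b} (w j)" "\<And>x. x \<in> {0<..<b} \<Longrightarrow> w 0 x > 0"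
    and rec: "\<And>j x. w j x * s x = (w (j + 1) x + w (j - 1) x) / 2"
    and ortho: "\<And>j. inner f (L2_of b (w j)) = 0"
  shows "f = 0"
proof -
  have "inner f (L2_of b (\<lambda>x. w j x * s x ^ n)) = 0" for j n
  proof (induction n arbitrary: j)
    case 0
    then show ?case using ortho by simp
  next
    case (Suc n)
    have "L2_of b (\<lambda>x. w j x * s x ^ Suc n) =
        L2_of b (\<lambda>x. (1/2) * (w (j + 1) x * s x ^ n) + (1/2) * (w (j - 1) x * s x ^ n))"
    proof (rule L2_of_cong)
      fix x
      have "w j x * s x ^ Suc n = (w j x * s x) * s x ^ n" by simp
      also have "\<dots> = (1/2) * (w (j + 1) x * s x ^ n) + (1/2) * (w (j - 1) x * s x ^ n)"
        unfolding rec by (simp add: algebra_simps)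
      finally show "w j x * s x ^ Suc n = (1/2) * (w (j + 1) x * s x ^ n) + (1/2) * (w (j - 1) x * s x ^ n)" .
    qed
    also have "\<dots> = L2_of b (\<lambda>x. (1/2) * (w (j + 1) x * s x ^ n)) + L2_of b (\<lambda>x. (1/2) * (w (j - 1) x * s x ^ n))"
      by (rule L2_of_add) (intro continuous_intros w s)+
    also have "L2_of b (\<lambda>x. (1/2) * (w (j + 1) x * s x ^ n)) = (1/2) *\<^sub>R L2_of b (\<lambda>x. w (j + 1) x * s x ^ n)"
      by (rule L2_of_scale) (intro continuous_intros w s)+
    also have "L2_of b (\<lambda>x. (1/2) * (w (j - 1) x * s x ^ n)) = (1/2) *\<^sub>R L2_of b (\<lambda>x. w (j - 1) x * s x ^ n)"
      by (rule L2_of_scale) (intro continuous_intros w s)+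
    finally show ?case by (simp add: inner_add_right Suc)
  qed
  then show ?thesis
    by (intro orthogonal_weighted_powers_imp_zero[OF f b s w])
qed

lemma cos_scaled_inj:
  assumes "b > 0" shows "inj_on (\<lambda>x. cos (pi / b * x)) {0..b}"
proof (rule inj_onI)
  fix x y assume xy: "x \<in> {0..b}" "y \<in> {0..b}" "cos (pi / b * x) = cos (pi / b * y)"
  have r: "0 \<le> pi / b * z" "pi / b * z \<le> pi" if "z \<in> {0..b}" for z
    using that assms by (auto simp: field_simps)
  have "pi / b * x = pi / b * y"
    by (rule cos_inj_pi) (use r xy in auto)
  then show "x = y" using assms by simp
qed

lemma sin_three_term: "sin (a * t) * cos t = (sin ((a + 1) * t) + sin ((a - 1) * t)) / (2::real)"
  by (simp add: sin_add sin_diff distrib_right left_diff_distrib)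

definition freq :: "real \<Rightarrow> nat \<Rightarrow> real" where
  "freq L k = (real k + 1/2) * (pi / L)"

definition mode :: "real \<Rightarrow> nat \<Rightarrow> L2" where
  "mode L k = sqrt (2 / L) *\<^sub>R L2_of L (\<lambda>x. sin (freq L k * x))"

lemma freq_pos: "L > 0 \<Longrightarrow> freq L k > 0"
  by (simp add: freq_def)

lemma cos_freq [simp]: "L > 0 \<Longrightarrow> cos (freq L k * L) = 0"
proof -
  assume "L > 0"
  then have "freq L k * L = real k * pi + pi / 2" by (simp add: freq_def algebra_simps)
  then show ?thesis by (simp add: cos_add)
qed

text \<open>
  The reflection \<open>j \<mapsto> - j - 1\<close> changes the sign of \<open>sin ((j + 1/2) \<theta>)\<close>, which reduces integers to natural
  numbers.
\<close>
lemma modes_complete: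
  assumes f: "f \<in> L2_on L" and L: "L > 0" and ortho: "\<And>k. inner f (mode L k) = 0"
  shows "f = 0"
proof (rule three_term_orthogonal_imp_zero[OF f L, where w = "\<lambda>j x. sin ((of_int j + 1/2) * (pi / L * x))"])
  have ortho': "inner f (L2_of L (\<lambda>x. sin ((real k + 1/2) * (pi / L * x)))) = 0" for k
    using ortho[of k] L by (simp add: mode_def freq_def mult.assoc)
  show "inj_on (\<lambda>x. cos (pi / L * x)) {0..L}" by (rule cos_scaled_inj[OF L])
  show "sin ((of_int 0 + 1/2) * (pi / L * x)) > 0" if "x \<in> {0<..<L}" for x
    using that L by (auto intro!: sin_gt_zero simp: field_simps)
  show "inner f (L2_of L (\<lambda>x. sin ((of_int j + 1/2) * (pi / L * x)))) = 0" for j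
  proof (cases "j \<ge> 0")
    case True
    then show ?thesis using ortho'[of "nat j"] by simp
  next
    case False
    have "sin ((of_int j + 1/2) * (pi / L * x)) = (- 1) * sin ((real (nat (- j - 1)) + 1/2) * (pi / L * x))" for x
    proof -
      have "real (nat (- j - 1)) + 1/2 = - (of_int j + 1/2)" using False by simp
      then show ?thesis by (simp only: mult_minus_left sin_minus mult_1_left minus_minus)
    qed
    then have "L2_of L (\<lambda>x. sin ((of_int j + 1/2) * (pi / L * x))) =
        (- 1) *\<^sub>R L2_of L (\<lambda>x. sin ((real (nat (- j - 1)) + 1/2) * (pi / L * x)))"
      using L by (subst L2_of_scale[symmetric]) (auto intro!: continuous_intros)
    then show ?thesis using ortho'[of "nat (- j - 1)"] by simp
  qed
  show "sin ((of_int j + 1/2) * (pi / L * x)) * cos (pi / L * x) =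
      (sin ((of_int (j + 1) + 1/2) * (pi / L * x)) + sin ((of_int (j - 1) + 1/2) * (pi / L * x))) / 2" for j x
  proof -
    have e: "(of_int (j + 1) + 1/2 :: real) = of_int j + 1/2 + 1" "(of_int (j - 1) + 1/2 :: real) = of_int j + 1/2 - 1"
      by simp_all
    show ?thesis unfolding e by (rule sin_three_term)
  qed
qed (use assms in \<open>auto intro!: continuous_intros\<close>)

lemma integral_FTC:
  fixes F :: "real \<Rightarrow> real"
  assumes "0 \<le> b" "\<And>x. x \<in> {0..b} \<Longrightarrow> (F has_real_derivative f x) (at x within {0..b})"
  shows "integral {0..b} f = F b - F 0"
  using fundamental_theorem_of_calculus[OF assms(1), of F f] assms(2)
  by (intro integral_unique) (auto simp: has_real_derivative_iff_has_vector_derivative)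

text \<open>
  Two integrations by parts; the boundary terms at \<open>L\<close> disappear because \<open>p' L = 0\<close> and
  \<open>cos (freq L k * L) = 0\<close>.
\<close>
lemma integral_second_derivative_sine:
  assumes L: "L > 0"
    and p: "\<And>x. x \<in> {0..L} \<Longrightarrow> (p has_real_derivative p' x) (at x within {0..L})"
      "\<And>x. x \<in> {0..L} \<Longrightarrow> (p' has_real_derivative p'' x) (at x within {0..L})"
    and p'': "continuous_on {0..L} p''" and p'L: "p' L = 0"
  shows "integral {0..L} (\<lambda>x. p'' x * sin (freq L k * x)) =
    freq L k * p 0 - (freq L k)\<^sup>2 * integral {0..L} (\<lambda>x. p x * sin (freq L k * x))"
proof -
  define w where "w = freq L k"
  have cp: "continuous_on {0..L} p" using p(1) by (rule DERIV_continuous_on)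
  have "integral {0..L} (\<lambda>x. p'' x * sin (w * x) + w\<^sup>2 * (p x * sin (w * x))) =
      (p' L * sin (w * L) - p L * (w * cos (w * L))) - (p' 0 * sin (w * 0) - p 0 * (w * cos (w * 0)))"
  proof (rule integral_FTC)
    fix x assume x: "x \<in> {0..L}"
    have s: "((\<lambda>x. sin (w * x)) has_real_derivative w * cos (w * x)) (at x within {0..L})"
       "((\<lambda>x. w * cos (w * x)) has_real_derivative - (w\<^sup>2 * sin (w * x))) (at x within {0..L})"
      by (auto intro!: derivative_eq_intros simp: power2_eq_square)
    show "((\<lambda>x. p' x * sin (w * x) - p x * (w * cos (w * x))) has_real_derivative
        p'' x * sin (w * x) + w\<^sup>2 * (p x * sin (w * x))) (at x within {0..L})"
      using DERIV_diff[OF DERIV_mult[OF p(2)[OF x] s(1)] DERIV_mult[OF p(1)[OF x] s(2)]]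
      by (simp add: algebra_simps)
  qed (use L in simp)
  also have "\<dots> = w * p 0" using L by (simp add: p'L w_def)
  also have "integral {0..L} (\<lambda>x. p'' x * sin (w * x) + w\<^sup>2 * (p x * sin (w * x))) =
      integral {0..L} (\<lambda>x. p'' x * sin (w * x)) + w\<^sup>2 * integral {0..L} (\<lambda>x. p x * sin (w * x))"
    by (subst integral_add) (auto intro!: integrable_continuous_real continuous_intros p'' cp)
  finally show ?thesis unfolding w_def by simp
qed

lemma inner_mode:
  assumes "continuous_on {0..L} f"
  shows "inner (L2_of L f) (mode L k) = sqrt (2 / L) * integral {0..L} (\<lambda>x. f x * sin (freq L k * x))"
  unfolding mode_def inner_scaleR_right
  by (subst inner_L2_of_L2_of[OF assms]) (auto intro!: continuous_intros)

lemma inner_mode_mode: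
  assumes "L > 0"
  shows "inner (mode L i) (mode L j) = 2 / L * integral {0..L} (\<lambda>x. sin (freq L i * x) * sin (freq L j * x))"
proof -
  have "inner (mode L i) (mode L j) = (sqrt (2 / L) * sqrt (2 / L)) * integral {0..L} (\<lambda>x. sin (freq L i * x) * sin (freq L j * x))"
    unfolding mode_def[of L i] inner_scaleR_left
    by (subst inner_mode, intro continuous_intros, simp only: mult.assoc)
  moreover have "sqrt (2 / L) * sqrt (2 / L) = 2 / L" using assms by simp
  ultimately show ?thesis by (simp only:)
qed

text \<open>
  Orthogonality is the symmetry of the second derivative: applied to another eigenfunction, the
  integration by parts gives the same integral with two different factors.
\<close>
lemma mode_orthonormal:
  assumes L: "L > 0"
  shows "orthonormal_sequence (mode L)"
proof
  fix i j
  let ?a = "freq L i" and ?c = "freq L j"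
  let ?I = "integral {0..L} (\<lambda>x. sin (?a * x) * sin (?c * x))"
  have a: "?a > 0" "?c > 0" using L by (auto simp: freq_pos)
  show "inner (mode L i) (mode L j) = (if i = j then 1 else 0)"
  proof (cases "i = j")
    case True
    have "sin (2 * (?a * L)) = 0" using L sin_double[of "?a * L"] by simp
    have "integral {0..L} (\<lambda>x. sin (?a * x) * sin (?a * x)) =
        (L / 2 - sin (2 * (?a * L)) / (4 * ?a)) - (0 / 2 - sin (2 * (?a * 0)) / (4 * ?a))"
    proof (rule integral_FTC[where F = "\<lambda>x. x / 2 - sin (2 * (?a * x)) / (4 * ?a)"])
      fix x
      have "sin (?a * x) * sin (?a * x) = 1 / 2 - cos (2 * (?a * x)) / 2"
        using cos_double_sin[of "?a * x"] unfolding power2_eq_square by linarith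
      moreover have "((\<lambda>x. x / 2 - sin (2 * (?a * x)) / (4 * ?a)) has_real_derivative
          1 / 2 - cos (2 * (?a * x)) / 2) (at x within {0..L})"
        using a by (auto intro!: derivative_eq_intros simp: field_simps)
      ultimately show "((\<lambda>x. x / 2 - sin (2 * (?a * x)) / (4 * ?a)) has_real_derivative
          sin (?a * x) * sin (?a * x)) (at x within {0..L})"
        by (simp only:)
    qed (use L in simp)
    then have "?I = L / 2" using True \<open>sin (2 * (?a * L)) = 0\<close> by simp
    then show ?thesis using inner_mode_mode[OF L, of i j] L True by simp
  next
    case False
    have "integral {0..L} (\<lambda>x. - (?a\<^sup>2 * sin (?a * x)) * sin (?c * x)) = ?c * sin (?a * 0) - ?c\<^sup>2 * ?I"
      by (rule integral_second_derivative_sine[OF L, where p' = "\<lambda>x. ?a * cos (?a * x)"])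
        (use L in \<open>auto intro!: derivative_eq_intros continuous_intros simp: power2_eq_square\<close>)
    then have "(?c\<^sup>2 - ?a\<^sup>2) * ?I = 0" by (auto simp: mult.assoc left_diff_distrib)
    moreover have "?c \<noteq> ?a" using False L by (simp add: freq_def)
    then have "?c\<^sup>2 - ?a\<^sup>2 \<noteq> 0" using a power2_eq_imp_eq[of ?c ?a] by auto
    ultimately show ?thesis using inner_mode_mode[OF L, of i j] False by simp
  qed
qed

section \<open>Weak derivatives and primitives\<close>

lemma L2_on_zero: "0 \<in> L2_on b"
proof -
  have "AE x in lborel. rep_L2 (abs_L2 (\<lambda>x. 0)) x = 0" by (rule rep_abs_L2[OF square_integrable_zero])
  then show ?thesis by (auto simp: L2_on_def abs_L2_zero elim!: eventually_mono)
qed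

text \<open>
  As an orthogonality condition the definition is visibly stable under linear combinations and limits.
\<close>
lemma L2_on_iff: "f \<in> L2_on b \<longleftrightarrow> (\<forall>g. square_integrable g \<longrightarrow> (\<forall>x\<in>{0<..<b}. g x = 0) \<longrightarrow> inner f (abs_L2 g) = 0)"
proof (intro iffI allI impI)
  fix g assume f: "f \<in> L2_on b" and g: "square_integrable g" "\<forall>x\<in>{0<..<b}. g x = 0"
  have "(\<lambda>x. indicator {0<..<b} x * g x) = (\<lambda>x. 0)" using g(2) by (auto simp: indicator_def)
  then show "inner f (abs_L2 g) = 0"
    using inner_L2_on_restrict[OF f g(1)] by (simp add: abs_L2_zero)
next
  assume *: "\<forall>g. square_integrable g \<longrightarrow> (\<forall>x\<in>{0<..<b}. g x = 0) \<longrightarrow> inner f (abs_L2 g) = 0"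
  define g where "g x = (1 - indicator {0<..<b} x) * rep_L2 f x" for x
  have g: "square_integrable g"
    by (rule square_integrable_bounded[OF _ square_integrable_rep[of f]]) (auto simp: g_def[abs_def] indicator_def)
  have "inner f (abs_L2 g) = 0" using * g by (simp add: g_def)
  moreover have "inner f (abs_L2 g) = inner (abs_L2 g) (abs_L2 g)"
    unfolding inner_rep_abs_L2[OF g, of f] inner_abs_L2[OF g g]
    by (rule Bochner_Integration.integral_cong) (auto simp: g_def indicator_def)
  ultimately have "abs_L2 g = 0" by simp
  then have "L2_rel g (\<lambda>x. 0)"
    unfolding abs_L2_zero[symmetric]
    using Quotient3_rel[OF Quotient3_L2] g square_integrable_zero L2_rel_refl by blast
  then have "AE x in lborel. g x = 0" by (simp add: L2_rel_def)
  then show "f \<in> L2_on b"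
    unfolding L2_on_def mem_Collect_eq by eventually_elim (auto simp: g_def indicator_def)
qed

lemma L2_on_add: "f \<in> L2_on b \<Longrightarrow> g \<in> L2_on b \<Longrightarrow> f + g \<in> L2_on b"
  unfolding L2_on_iff by (auto simp: inner_add_left)

lemma L2_on_scale: "f \<in> L2_on b \<Longrightarrow> c *\<^sub>R f \<in> L2_on b"
  unfolding L2_on_iff by auto

lemma L2_on_diff: "f \<in> L2_on b \<Longrightarrow> g \<in> L2_on b \<Longrightarrow> f - g \<in> L2_on b"
  unfolding L2_on_iff by (auto simp: inner_diff_left)

lemma closed_L2_on: "closed (L2_on b)"
proof -
  have "L2_on b = (\<Inter>g\<in>{g. square_integrable g \<and> (\<forall>x\<in>{0<..<b}. g x = 0)}. {f. inner f (abs_L2 g) = 0})"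
    by (auto simp: L2_on_iff)
  moreover have "closed {f. inner f (abs_L2 g) = 0}" for g
    by (intro closed_Collect_eq continuous_intros)
  ultimately show ?thesis by (auto intro!: closed_INT)
qed

lemma L2_of_continuous_in_L2_on: "continuous_on {0..b} f \<Longrightarrow> L2_of b f \<in> L2_on b"
  by (intro L2_of_in_L2_on square_integrable_continuous)

lemma L2_of_eq_imp_eq:
  assumes "b > 0" "continuous_on {0..b} f" "continuous_on {0..b} g" "L2_of b f = L2_of b g" "x \<in> {0..b}"
  shows "f x = g x"
proof -
  have c: "continuous_on {0..b} (\<lambda>x. f x - g x)" by (intro continuous_intros assms)
  have "L2_of b (\<lambda>x. f x - g x) = 0" using assms by (simp add: L2_of_diff)
  then have "integral {0..b} (\<lambda>x. (f x - g x) * (f x - g x)) = 0"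
    using inner_L2_of_L2_of[OF c c] by simp
  then have "\<forall>x\<in>{0..b}. (f x - g x) * (f x - g x) = 0"
    by (subst (asm) integral_eq_0_iff[OF continuous_on_mult[OF c c] assms(1)]) simp_all
  then show ?thesis using assms(5) by auto
qed

lemma point_value_L2_of:
  assumes "b > 0" "continuous_on {0..b} g" "x \<in> {0..b}"
  shows "point_value b (L2_of b g) x = g x"
  unfolding point_value_def
  by (rule the_equality) (use assms L2_of_eq_imp_eq in blast)+

text \<open>
  The primitive of \<open>g\<close> vanishing at \<open>0\<close>. As an inner product it is linear and continuous in \<open>g\<close> by
  construction and independent of the choice of a representative.
\<close>
definition prim :: "L2 \<Rightarrow> real \<Rightarrow> real" where
  "prim g x = inner g (abs_L2 (indicator {0<..<x}))"

lemma prim_0 [simp]: "prim g 0 = 0"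
proof -
  have "(indicator {0<..<0} :: real \<Rightarrow> real) = (\<lambda>x. 0)" by (auto simp: indicator_def)
  then show ?thesis by (simp only: prim_def abs_L2_zero inner_zero_right)
qed

lemma continuous_on_prim: "continuous_on {0..b} (prim g)"
proof -
  let ?F = "\<lambda>x::real. abs_L2 (indicator {0<..<x})"
  have d: "dist (?F y) (?F x) = sqrt \<bar>y - x\<bar>" if "0 \<le> x" "x \<le> y" for x y
  proof -
    have "(norm (?F y - ?F x))\<^sup>2 = (LINT s|lborel. (indicator {0<..<y} s - indicator {0<..<x} s)\<^sup>2)"
      by (subst abs_L2_diff[OF square_integrable_interval square_integrable_interval],
          rule norm_abs_L2[OF square_integrable_diff[OF square_integrable_interval square_integrable_interval]])
    also have "\<dots> = (LINT s|lborel. indicator {x<..<y} s)"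
    proof (rule integral_cong_AE)
      have "AE s in lborel. s \<noteq> x" by (rule AE_lborel_singleton)
      then show "AE s in lborel. (indicator {0<..<y} s - indicator {0<..<x} s)\<^sup>2 = (indicator {x<..<y} s :: real)"
        by eventually_elim (use that in \<open>auto simp: indicator_def\<close>)
    qed auto
    also have "\<dots> = y - x" using that by simp
    finally have "sqrt ((norm (?F y - ?F x))\<^sup>2) = sqrt (y - x)" by simp
    then show ?thesis using that by (simp add: dist_norm)
  qed
  have d': "dist (?F y) (?F x) = sqrt \<bar>y - x\<bar>" if "0 \<le> x" "0 \<le> y" for x y
    using d[of x y] d[of y x] that by (cases "x \<le> y") (auto simp: dist_commute abs_minus_commute)
  have "continuous_on {0..b} ?F"
    unfolding continuous_on_def
  proof
    fix x assume x: "x \<in> {0..b}"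
    have "((\<lambda>y. sqrt \<bar>y - x\<bar>) \<longlongrightarrow> sqrt \<bar>x - x\<bar>) (at x within {0..b})"
      by (intro tendsto_intros)
    then have "((\<lambda>y. sqrt \<bar>y - x\<bar>) \<longlongrightarrow> 0) (at x within {0..b})" by simp
    then have "((\<lambda>y. dist (?F y) (?F x)) \<longlongrightarrow> 0) (at x within {0..b})"
    proof (rule Lim_transform_eventually)
      show "\<forall>\<^sub>F y in at x within {0..b}. sqrt \<bar>y - x\<bar> = dist (?F y) (?F x)"
        unfolding eventually_at_filter by (intro always_eventually allI impI) (subst d', use x in auto)
    qed
    then show "(?F \<longlongrightarrow> ?F x) (at x within {0..b})"
      by (rule tendsto_dist_iff[THEN iffD2])
  qed
  then show ?thesis
    unfolding prim_def by (intro continuous_intros)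
qed

text \<open>
  Fubini's theorem on the triangle \<open>0 < s < x < b\<close>; no differentiability of the primitive is available,
  as \<open>g\<close> is merely square integrable.
\<close>
lemma prim_by_parts:
  assumes g: "g \<in> L2_on b" and b: "b > 0"
    and psi: "\<And>x. x \<in> {0..b} \<Longrightarrow> (psi has_real_derivative psi' x) (at x within {0..b})"
    and psi': "continuous_on {0..b} psi'"
  shows "inner (L2_of b (prim g)) (L2_of b psi') = prim g b * psi b - inner g (L2_of b psi)"
proof -
  have cpsi: "continuous_on {0..b} psi" using psi by (rule DERIV_continuous_on)
  define u where "u x = indicator {0<..<b} x * psi' x" for x
  define v where "v s = indicator {0<..<b} s * rep_L2 g s" for s
  define f where "f x s = (if s < x then u x * v s else 0)" for x s
  have [measurable]: "u \<in> borel_measurable borel" "v \<in> borel_measurable borel"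
    using continuous_on_indicator_measurable[OF psi'] by (auto simp: u_def[abs_def] v_def[abs_def])
  have ui: "integrable lborel u"
    using set_integrable_continuous_Ioo(2)[OF psi'] by (simp add: u_def[abs_def] set_integrable_def)
  have vi: "integrable lborel v"
    using square_integrable_mult[OF square_integrable_interval square_integrable_rep] by (simp add: v_def[abs_def])
  have fi: "integrable (lborel \<Otimes>\<^sub>M lborel) (case_prod f)"
  proof (rule Bochner_Integration.integrable_bound)
    show "integrable (lborel \<Otimes>\<^sub>M lborel) (\<lambda>(x, s). u x * v s)"
      by (rule lborel_pair.Fubini_integrable) (use ui vi in \<open>auto simp: abs_mult\<close>)
    show "case_prod f \<in> borel_measurable (lborel \<Otimes>\<^sub>M lborel)"
      unfolding f_def by measurable
  qed (auto simp: f_def)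
  have "inner (L2_of b (prim g)) (L2_of b psi') = (LINT x|lborel. (indicator {0<..<b} x * prim g x) * u x)"
    unfolding L2_of_def u_def
    by (intro inner_abs_L2 square_integrable_continuous continuous_on_prim psi')
  also have "\<dots> = (LINT x|lborel. LINT s|lborel. f x s)"
  proof (rule Bochner_Integration.integral_cong[OF refl])
    fix x
    show "(indicator {0<..<b} x * prim g x) * u x = (LINT s|lborel. f x s)"
    proof (cases "x \<in> {0<..<b}")
      case True
      have "(LINT s|lborel. f x s) = (LINT s|lborel. u x * (rep_L2 g s * indicator {0<..<x} s))"
        by (rule Bochner_Integration.integral_cong) (use True in \<open>auto simp: f_def v_def indicator_def\<close>)
      also have "\<dots> = u x * prim g x"
        by (simp add: prim_def inner_rep_abs_L2[OF square_integrable_interval])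
      finally show ?thesis using True by simp
    next
      case False
      then have "u x = 0" by (simp add: u_def)
      then have "f x s = 0" for s by (simp add: f_def)
      then show ?thesis using False by simp
    qed
  qed
  also have "\<dots> = (LINT s|lborel. LINT x|lborel. f x s)"
    using lborel_pair.Fubini_integral[OF fi] by simp
  also have "\<dots> = (LINT s|lborel. psi b * (rep_L2 g s * indicator {0<..<b} s) - rep_L2 g s * (indicator {0<..<b} s * psi s))"
  proof (rule Bochner_Integration.integral_cong[OF refl])
    fix s
    show "(LINT x|lborel. f x s) = psi b * (rep_L2 g s * indicator {0<..<b} s) - rep_L2 g s * (indicator {0<..<b} s * psi s)"
    proof (cases "s \<in> {0<..<b}")
      case True
      have "(LINT x|lborel. f x s) = (LINT x|lborel. v s * (indicator {s<..<b} x * psi' x))"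
        by (rule Bochner_Integration.integral_cong) (use True in \<open>auto simp: f_def u_def indicator_def\<close>)
      also have "\<dots> = v s * (LINT x:{s<..<b}|lborel. psi' x)"
        by (simp add: set_lebesgue_integral_def)
      also have "(LINT x:{s<..<b}|lborel. psi' x) = (LBINT x=ereal s..ereal b. psi' x)"
        using True by (simp add: interval_lebesgue_integral_def einterval_eq)
      also have "\<dots> = psi b - psi s"
      proof (rule interval_integral_FTC_finite)
        show "continuous_on {min s b..max s b} psi'"
          using True by (intro continuous_on_subset[OF psi']) auto
        show "(psi has_vector_derivative psi' x) (at x within {min s b..max s b})"
          if "min s b \<le> x" "x \<le> max s b" for x
        proof -
          have "(psi has_real_derivative psi' x) (at x within {min s b..max s b})"
            using True that by (intro DERIV_subset[OF psi[of x]]) auto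
          then show ?thesis by (simp add: has_real_derivative_iff_has_vector_derivative)
        qed
      qed
      finally show ?thesis using True by (simp add: v_def algebra_simps)
    next
      case False
      then have "v s = 0" by (simp add: v_def)
      then have "f x s = 0" for x by (simp add: f_def)
      then show ?thesis using False by simp
    qed
  qed
  also have "\<dots> = psi b * prim g b - (LINT s|lborel. rep_L2 g s * (indicator {0<..<b} s * psi s))"
  proof (subst Bochner_Integration.integral_diff)
    show "integrable lborel (\<lambda>s. psi b * (rep_L2 g s * indicator {0<..<b} s))"
      by (intro integrable_mult_right square_integrable_mult square_integrable_rep square_integrable_interval)
    show "integrable lborel (\<lambda>s. rep_L2 g s * (indicator {0<..<b} s * psi s))"
      by (intro square_integrable_mult square_integrable_rep square_integrable_continuous cpsi)
  qed (simp add: prim_def inner_rep_abs_L2[OF square_integrable_interval])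
  also have "(LINT s|lborel. rep_L2 g s * (indicator {0<..<b} s * psi s)) = inner g (L2_of b psi)"
    unfolding L2_of_def by (rule inner_rep_abs_L2[symmetric]) (rule square_integrable_continuous[OF cpsi])
  finally show ?thesis by simp
qed

lemma test_function_facts:
  assumes "test_function b psi"
  shows "(psi has_real_derivative deriv psi x) (at x)" "continuous_on S (deriv psi)" "continuous_on S psi"
    "psi 0 = 0" "psi b = 0"
proof -
  show d: "(psi has_real_derivative deriv psi x) (at x)" for x
    using assms DERIV_deriv_iff_real_differentiable by (auto simp: test_function_def)
  show "continuous_on S (deriv psi)"
    using assms by (auto simp: test_function_def intro: continuous_on_subset)
  show "continuous_on S psi"
    using d by (intro continuous_at_imp_continuous_on ballI DERIV_isCont)
  obtain K where "K \<subseteq> {0<..<b}" "\<forall>x. x \<notin> K \<longrightarrow> psi x = 0"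
    using assms by (auto simp: test_function_def)
  then show "psi 0 = 0" "psi b = 0" by auto
qed

lemma has_weak_deriv_iff:
  "has_weak_deriv b f g \<longleftrightarrow> f \<in> L2_on b \<and> g \<in> L2_on b \<and>
     (\<forall>psi. test_function b psi \<longrightarrow> inner f (L2_of b (deriv psi)) = - inner g (L2_of b psi))"
  unfolding has_weak_deriv_def by (simp add: inner_L2_of test_function_facts)

lemma has_weak_deriv_prim:
  assumes g: "g \<in> L2_on b" and b: "b > 0"
  shows "has_weak_deriv b (L2_of b (\<lambda>x. c + prim g x)) g"
  unfolding has_weak_deriv_iff
proof (intro conjI allI impI)
  have cont: "continuous_on {0..b} (\<lambda>x. c + prim g x)"
    by (intro continuous_intros continuous_on_prim)
  show "L2_of b (\<lambda>x. c + prim g x) \<in> L2_on b"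
    by (rule L2_of_continuous_in_L2_on[OF cont])
  fix psi assume psi: "test_function b psi"
  note t = test_function_facts[OF psi]
  have "L2_of b (\<lambda>x. c + prim g x) = L2_of b (\<lambda>x. c) + L2_of b (prim g)"
    by (rule L2_of_add) (intro continuous_intros continuous_on_prim)+
  moreover have "inner (L2_of b (prim g)) (L2_of b (deriv psi)) = - inner g (L2_of b psi)"
    using prim_by_parts[OF g b has_field_derivative_at_within[OF t(1)] t(2)] t(5) by simp
  moreover have "inner (L2_of b (\<lambda>x. c)) (L2_of b (deriv psi)) = integral {0..b} (\<lambda>x. c * deriv psi x)"
    by (rule inner_L2_of_L2_of) (intro continuous_intros t)+
  moreover have "integral {0..b} (\<lambda>x. c * deriv psi x) = c * psi b - c * psi 0"
    by (rule integral_FTC) (use b in \<open>auto intro!: DERIV_cmult has_field_derivative_at_within[OF t(1)]\<close>)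
  ultimately show "inner (L2_of b (\<lambda>x. c + prim g x)) (L2_of b (deriv psi)) = - inner g (L2_of b psi)"
    using t by (simp add: inner_add_left)
qed (rule g)

text \<open>
  The lemma of du Bois-Reymond: a continuous function with compact support and mean zero is the
  derivative of a test function, so \<open>d\<close> only sees the mean value of such functions; a fixed bump \<open>e\<close>
  serves to correct the mean.
\<close>
lemma weak_deriv_zero_imp_constant:
  assumes d: "d \<in> L2_on b" and b: "b > 0"
    and zero: "\<And>psi. test_function b psi \<Longrightarrow> inner d (L2_of b (deriv psi)) = 0"
  obtains c where "d = L2_of b (\<lambda>x. c)"
proof -
  define e where "e x = max 0 (min (x - b / 4) (3 * b / 4 - x))" for x
  have e: "continuous_on A e" for A unfolding e_def by (intro continuous_intros)
  define E where "E = integral {0..b} e"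
  have "E \<noteq> 0"
  proof
    assume "E = 0"
    then have "\<forall>x\<in>{0..b}. e x = 0"
      unfolding E_def by (subst (asm) integral_eq_0_iff[OF e b]) (simp_all add: e_def)
    then have "e (b / 2) = 0" using b by simp
    then show False using b by (simp add: e_def max_def min_def split: if_splits)
  qed
  define C where "C = inner d (L2_of b e) / E"
  have "d - C *\<^sub>R L2_of b (\<lambda>x. 1) = 0"
  proof (rule orthogonal_compact_support_imp_zero)
    show "d - C *\<^sub>R L2_of b (\<lambda>x. 1) \<in> L2_on b"
      by (intro L2_on_diff L2_on_scale d L2_of_continuous_in_L2_on continuous_on_const)
    fix g :: "real \<Rightarrow> real" and K assume g: "continuous_on UNIV g" and K: "compact K" "K \<subseteq> {0<..<b}" "\<And>x. x \<notin> K \<Longrightarrow> g x = 0"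
    have gc: "continuous_on A g" for A using g by (rule continuous_on_subset) simp
    define ga where "ga = integral {0..b} g"
    define h where "h x = g x - ga / E * e x" for x
    have h: "continuous_on A h" for A unfolding h_def by (intro continuous_intros gc e)
    obtain H where H: "\<And>t. (H has_real_derivative h t) (at t)"
      using antiderivative_exists[OF h] by blast
    define K' where "K' = K \<union> {b / 4..3 * b / 4}"
    have K': "compact K'" "K' \<subseteq> {0<..<b}" "K' \<noteq> {}" using K b by (auto simp: K'_def)
    obtain p r where p: "p \<in> K'" "\<And>x. x \<in> K' \<Longrightarrow> p \<le> x" and r: "r \<in> K'" "\<And>x. x \<in> K' \<Longrightarrow> x \<le> r"
      using compact_attains_inf[OF K'(1,3)] compact_attains_sup[OF K'(1,3)] by blast
    have hK: "h x = 0" if "x \<notin> K'" for x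
      using that K(3)[of x] by (auto simp: h_def e_def K'_def)
    have "integral {0..b} h = H b - H 0"
      by (rule integral_FTC) (use b H in \<open>auto intro: has_field_derivative_at_within\<close>)
    moreover have "integral {0..b} h = ga - ga / E * E"
    proof -
      have "integral {0..b} h = integral {0..b} g - integral {0..b} (\<lambda>x. ga / E * e x)"
        unfolding h_def by (rule integral_diff) (intro integrable_continuous_real continuous_intros gc e)+
      then show ?thesis by (simp only: integral_mult_right ga_def[symmetric] E_def[symmetric])
    qed
    ultimately have Hb: "H b = H 0" using \<open>E \<noteq> 0\<close> by simp
    have low: "H x = H 0" if "x < p" for x
    proof (cases "x \<le> 0")
      case True
      then show ?thesis by (rule zero_deriv_imp_eq[OF H]) (use hK K'(2) in force)
    next
      case False
      then have "H 0 = H x" by (intro zero_deriv_imp_eq[OF H] hK) (use that p in force)+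
      then show ?thesis ..
    qed
    have high: "H x = H 0" if "x > r" for x
    proof (cases "x \<ge> b")
      case True
      then show ?thesis unfolding Hb[symmetric]
        by (intro zero_deriv_imp_eq[OF H, symmetric] hK) (use K'(2) in force)+
    next
      case False
      then have "H x = H b" by (intro zero_deriv_imp_eq[OF H] hK) (use that r in force)+
      then show ?thesis by (simp add: Hb)
    qed
    define psi where "psi x = H x - H 0" for x
    have psi: "(psi has_real_derivative h x) (at x)" for x
      unfolding psi_def using H[of x] by (auto intro!: derivative_eq_intros)
    then have dpsi: "deriv psi = h" by (intro ext DERIV_imp_deriv)
    have "test_function b psi"
      unfolding test_function_def dpsi
    proof (intro conjI allI exI[of _ "{p..r}"] impI h)
      show "psi differentiable (at x)" for x using psi real_differentiable_def by blast
      show "{p..r} \<subseteq> {0<..<b}" using p r K'(2) by force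
      show "psi x = 0" if "x \<notin> {p..r}" for x
        using that low[of x] high[of x] by (auto simp: psi_def)
    qed simp
    then have "inner d (L2_of b h) = 0" using zero by (simp add: dpsi[symmetric])
    moreover have "L2_of b h = L2_of b g - (ga / E) *\<^sub>R L2_of b e"
      unfolding h_def by (subst L2_of_diff, intro gc, intro continuous_intros e, subst L2_of_scale, intro e) simp
    ultimately have "inner d (L2_of b g) = C * ga" by (simp add: C_def inner_diff_right)
    moreover have "inner (L2_of b (\<lambda>x. 1)) (L2_of b g) = ga"
      by (subst inner_L2_of_L2_of) (auto intro: gc simp: ga_def)
    ultimately show "inner (d - C *\<^sub>R L2_of b (\<lambda>x. 1)) (L2_of b g) = 0"
      by (simp add: inner_diff_left)
  qed
  moreover have "L2_of b (\<lambda>x. C * 1) = C *\<^sub>R L2_of b (\<lambda>x. 1)" by (rule L2_of_scale) simp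
  ultimately show thesis using that[of C] by simp
qed

lemma has_weak_deriv_imp_prim:
  assumes fg: "has_weak_deriv b f g" and b: "b > 0"
  obtains c where "f = L2_of b (\<lambda>x. c + prim g x)"
proof -
  have g: "g \<in> L2_on b" and f: "f \<in> L2_on b" using fg by (auto simp: has_weak_deriv_iff)
  have G: "has_weak_deriv b (L2_of b (prim g)) g"
    using has_weak_deriv_prim[OF g b, of 0] by simp
  obtain c where "f - L2_of b (prim g) = L2_of b (\<lambda>x. c)"
  proof (rule weak_deriv_zero_imp_constant[OF _ b])
    show "f - L2_of b (prim g) \<in> L2_on b" using fg G by (auto simp: has_weak_deriv_iff intro: L2_on_diff)
    show "inner (f - L2_of b (prim g)) (L2_of b (deriv psi)) = 0" if "test_function b psi" for psi
      using fg G that by (simp add: has_weak_deriv_iff inner_diff_left)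
  qed
  then have "f = L2_of b (\<lambda>x. c) + L2_of b (prim g)" by (simp add: algebra_simps)
  also have "\<dots> = L2_of b (\<lambda>x. c + prim g x)"
    by (subst L2_of_add[symmetric]) (auto intro!: continuous_intros continuous_on_prim)
  finally show thesis using that by blast
qed

text \<open>
  The primitives of \<open>g\<close> and \<open>h\<close> coincide, and \<open>prim (g - h)\<close> at a point is the inner product with the
  indicator of an interval.
\<close>
lemma has_weak_deriv_unique:
  assumes "has_weak_deriv b f g" "has_weak_deriv b f h" "b > 0"
  shows "g = h"
proof -
  have gh: "g - h \<in> L2_on b" using assms by (auto simp: has_weak_deriv_iff intro: L2_on_diff)
  obtain c where c: "f = L2_of b (\<lambda>x. c + prim g x)" using has_weak_deriv_imp_prim[OF assms(1,3)] by blast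
  obtain d where d: "f = L2_of b (\<lambda>x. d + prim h x)" using has_weak_deriv_imp_prim[OF assms(2,3)] by blast
  have cont: "continuous_on {0..b} (\<lambda>x. c + prim g x)" for c g
    by (intro continuous_intros continuous_on_prim)
  have eq: "c + prim g x = d + prim h x" if "x \<in> {0..b}" for x
    by (rule L2_of_eq_imp_eq[OF assms(3) cont cont _ that]) (use c d in simp)
  have "c = d" using eq[of 0] assms(3) by simp
  then have p: "prim (g - h) x = 0" if "x \<in> {0..b}" for x
    using eq[OF that] by (simp add: prim_def inner_diff_left)
  have "g - h = 0"
  proof (rule orthogonal_intervals_imp_zero)
    fix a c :: real
    define a' where "a' = max a 0"
    define c' where "c' = max a' (min c b)"
    show "inner (g - h) (abs_L2 (indicator {a<..<c})) = 0"
    proof (cases "a' \<le> b")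
      case True
      have "AE x in lborel. x \<noteq> a'" by (rule AE_lborel_singleton)
      then have "AE x in lborel. indicator {0<..<b} x * indicator {a<..<c} x = (indicator {0<..<c'} x - indicator {0<..<a'} x :: real)"
        by eventually_elim (auto simp: indicator_def a'_def c'_def)
      then have "abs_L2 (\<lambda>x. indicator {0<..<b} x * indicator {a<..<c} x) = abs_L2 (\<lambda>x. indicator {0<..<c'} x - indicator {0<..<a'} x)"
        by (intro abs_L2_cong square_integrable_diff square_integrable_interval
            square_integrable_bounded_interval[of b _ 1]) (auto simp: indicator_def)
      then have "inner (g - h) (abs_L2 (indicator {a<..<c})) = prim (g - h) c' - prim (g - h) a'"
        unfolding inner_L2_on_restrict[OF gh square_integrable_interval[of a c]] prim_def
        by (simp add: abs_L2_diff[symmetric] square_integrable_interval inner_diff_right)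
      then show ?thesis using p[of a'] p[of c'] True assms(3) by (simp add: a'_def c'_def)
    next
      case False
      then have "(\<lambda>x. indicator {0<..<b} x * indicator {a<..<c} x) = (\<lambda>x. 0::real)"
        using assms(3) by (auto simp: indicator_def a'_def)
      then show ?thesis
        unfolding inner_L2_on_restrict[OF gh square_integrable_interval[of a c]] by (simp only: abs_L2_zero inner_zero_right)
    qed
  qed
  then show ?thesis by simp
qed

lemma weak_deriv_eq:
  assumes "has_weak_deriv b f g" "b > 0"
  shows "weak_deriv b f = g"
  unfolding weak_deriv_def by (rule the_equality) (use assms has_weak_deriv_unique in blast)+

section \<open>The inverse of the second derivative\<close>

text \<open>
  \<open>inv_dxx L g\<close> is the solution of \<open>f'' = g\<close> with \<open>f(0) = 0\<close> and \<open>f'(L) = 0\<close>, and \<open>inv_dx L g\<close> is its derivative.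
\<close>
definition inv_dx :: "real \<Rightarrow> L2 \<Rightarrow> L2" where
  "inv_dx L g = L2_of L (\<lambda>x. - prim g L + prim g x)"

definition inv_dxx :: "real \<Rightarrow> L2 \<Rightarrow> L2" where
  "inv_dxx L g = L2_of L (\<lambda>x. 0 + prim (inv_dx L g) x)"

lemma inv_dxx_weak_deriv:
  assumes "g \<in> L2_on L" "L > 0"
  shows "has_weak_deriv L (inv_dx L g) g" "has_weak_deriv L (inv_dxx L g) (inv_dx L g)"
    "inv_dx L g \<in> L2_on L" "inv_dxx L g \<in> L2_on L"
proof -
  show 1: "has_weak_deriv L (inv_dx L g) g" unfolding inv_dx_def by (rule has_weak_deriv_prim[OF assms])
  then show 2: "inv_dx L g \<in> L2_on L" by (simp add: has_weak_deriv_iff)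
  show 3: "has_weak_deriv L (inv_dxx L g) (inv_dx L g)" unfolding inv_dxx_def by (rule has_weak_deriv_prim[OF 2 assms(2)])
  then show "inv_dxx L g \<in> L2_on L" by (simp add: has_weak_deriv_iff)
qed

lemma inv_dxx_boundary:
  assumes "L > 0"
  shows "point_value L (inv_dxx L g) 0 = 0" "point_value L (inv_dx L g) L = 0"
proof -
  show "point_value L (inv_dxx L g) 0 = 0"
    unfolding inv_dxx_def by (subst point_value_L2_of) (use assms in \<open>auto intro!: continuous_intros continuous_on_prim\<close>)
  show "point_value L (inv_dx L g) L = 0"
    unfolding inv_dx_def by (subst point_value_L2_of) (use assms in \<open>auto intro!: continuous_intros continuous_on_prim\<close>)
qed

lemma inv_dxx_unique:
  assumes "has_weak_deriv L f f1" "has_weak_deriv L f1 f2" "L > 0"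
    and "point_value L f 0 = 0" "point_value L f1 L = 0"
  shows "f1 = inv_dx L f2" "f = inv_dxx L f2"
proof -
  have cont: "continuous_on {0..L} (\<lambda>x. c + prim h x)" for c h
    by (intro continuous_intros continuous_on_prim)
  obtain c where c: "f1 = L2_of L (\<lambda>x. c + prim f2 x)"
    using has_weak_deriv_imp_prim[OF assms(2,3)] by blast
  have "c + prim f2 L = 0"
    using assms(5) point_value_L2_of[OF assms(3) cont, of L c f2] assms(3) by (simp add: c)
  then have "c = - prim f2 L" by simp
  then show 1: "f1 = inv_dx L f2" by (simp add: c inv_dx_def)
  obtain d where d: "f = L2_of L (\<lambda>x. d + prim f1 x)"
    using has_weak_deriv_imp_prim[OF assms(1,3)] by blast
  have "d = 0"
    using assms(4) point_value_L2_of[OF assms(3) cont, of 0 d f1] assms(3) by (simp add: d)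
  then show "f = inv_dxx L f2" by (simp add: d inv_dxx_def 1)
qed

lemma inv_dxx_coefficient:
  assumes g: "g \<in> L2_on L" and L: "L > 0"
  shows "inner (inv_dxx L g) (mode L k) = - inner g (mode L k) / (freq L k)\<^sup>2"
proof -
  define w where "w = freq L k"
  have w: "w > 0" "cos (w * L) = 0" using L by (auto simp: w_def freq_pos)
  have K0: "inv_dxx L g = L2_of L (prim (inv_dx L g))" by (simp add: inv_dxx_def)
  have "inner (inv_dxx L g) (L2_of L (\<lambda>x. sin (w * x))) =
      prim (inv_dx L g) L * (- cos (w * L) / w) - inner (inv_dx L g) (L2_of L (\<lambda>x. - cos (w * x) / w))"
    unfolding K0
    by (rule prim_by_parts[OF inv_dxx_weak_deriv(3)[OF g L] L, where psi = "\<lambda>x. - cos (w * x) / w"])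
      (use w in \<open>auto intro!: derivative_eq_intros continuous_intros\<close>)
  also have "L2_of L (\<lambda>x. - cos (w * x) / w) = (- 1 / w) *\<^sub>R L2_of L (\<lambda>x. cos (w * x))"
    by (subst L2_of_scale[symmetric]) (auto intro!: continuous_intros)
  finally have 1: "inner (inv_dxx L g) (L2_of L (\<lambda>x. sin (w * x))) = inner (inv_dx L g) (L2_of L (\<lambda>x. cos (w * x))) / w"
    using w by simp
  have "inv_dx L g = L2_of L (\<lambda>x. - prim g L) + L2_of L (prim g)"
    unfolding inv_dx_def by (rule L2_of_add) (intro continuous_intros continuous_on_prim)+
  moreover have "inner (L2_of L (prim g)) (L2_of L (\<lambda>x. cos (w * x))) =
      prim g L * (sin (w * L) / w) - inner g (L2_of L (\<lambda>x. sin (w * x) / w))"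
    by (rule prim_by_parts[OF g L, where psi = "\<lambda>x. sin (w * x) / w"])
      (use w in \<open>auto intro!: derivative_eq_intros continuous_intros\<close>)
  moreover have "L2_of L (\<lambda>x. sin (w * x) / w) = (1 / w) *\<^sub>R L2_of L (\<lambda>x. sin (w * x))"
    by (subst L2_of_scale[symmetric]) (auto intro!: continuous_intros)
  moreover have "inner (L2_of L (\<lambda>x. - prim g L)) (L2_of L (\<lambda>x. cos (w * x))) = - prim g L * sin (w * L) / w"
  proof -
    have "inner (L2_of L (\<lambda>x. - prim g L)) (L2_of L (\<lambda>x. cos (w * x))) = integral {0..L} (\<lambda>x. - prim g L * cos (w * x))"
      by (rule inner_L2_of_L2_of) (intro continuous_intros)+
    also have "\<dots> = - prim g L * sin (w * L) / w - - prim g L * sin (w * 0) / w"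
      by (rule integral_FTC) (use w L in \<open>auto intro!: derivative_eq_intros\<close>)
    finally show ?thesis by simp
  qed
  ultimately have "inner (inv_dx L g) (L2_of L (\<lambda>x. cos (w * x))) = - inner g (L2_of L (\<lambda>x. sin (w * x))) / w"
    by (simp add: inner_add_left)
  then have "inner (inv_dxx L g) (L2_of L (\<lambda>x. sin (w * x))) = - inner g (L2_of L (\<lambda>x. sin (w * x))) / w\<^sup>2"
    using 1 by (simp add: power2_eq_square)
  then show ?thesis by (simp add: mode_def w_def)
qed

text \<open>
  The four boundary conditions are those of \<open>inv_dxx\<close> for \<open>phi\<close> and once more for its second derivative.
  Hence the domain of the operator is the range of the square of \<open>inv_dxx\<close>, which reduces every question
  about Sobolev spaces to the coefficient formula for \<open>inv_dxx\<close>.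
\<close>
lemma KS_domain_imp_inv_dxx:
  assumes "phi \<in> KS_domain L" "L > 0"
  obtains w where "w \<in> L2_on L" "phi = inv_dxx L (inv_dxx L w)" "KS_op L lam phi = lam *\<^sub>R inv_dxx L w + w"
proof -
  have "phi \<in> sobolev (Suc (Suc (Suc (Suc 0)))) L"
    using assms(1) by (simp add: KS_domain_def eval_nat_numeral)
  then obtain g1 g2 g3 g4 where g: "has_weak_deriv L phi g1" "has_weak_deriv L g1 g2"
      "has_weak_deriv L g2 g3" "has_weak_deriv L g3 g4"
    by auto
  note e = g[THEN weak_deriv_eq, OF assms(2)]
  have d: "(weak_deriv L ^^ 2) phi = g2" "(weak_deriv L ^^ 3) phi = g3" "(weak_deriv L ^^ 4) phi = g4"
    by (simp_all add: eval_nat_numeral e)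
  have b: "point_value L phi 0 = 0" "point_value L g2 0 = 0" "point_value L g1 L = 0" "point_value L g3 L = 0"
    using assms(1) by (simp_all add: KS_domain_def d e)
  have g2: "g2 = inv_dxx L g4" "phi = inv_dxx L g2"
    using inv_dxx_unique(2)[OF g(3,4) assms(2) b(2,4)] inv_dxx_unique(2)[OF g(1,2) assms(2) b(1,3)] by simp_all
  have "KS_op L lam phi = lam *\<^sub>R g2 + g4" by (simp add: KS_op_def d)
  moreover have "g4 \<in> L2_on L" using g(4) by (simp add: has_weak_deriv_iff)
  moreover have "phi = inv_dxx L (inv_dxx L g4)" using g2 by simp
  ultimately show thesis unfolding g2(1) by (intro that[of g4])
qed

lemma inv_dxx_in_KS_domain:
  assumes w: "w \<in> L2_on L" and L: "L > 0"
  shows "inv_dxx L (inv_dxx L w) \<in> KS_domain L" "KS_op L lam (inv_dxx L (inv_dxx L w)) = lam *\<^sub>R inv_dxx L w + w"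
proof -
  note k = inv_dxx_weak_deriv[OF w L]
  note kk = inv_dxx_weak_deriv[OF k(4) L]
  note e = k(1,2)[THEN weak_deriv_eq, OF L] kk(1,2)[THEN weak_deriv_eq, OF L]
  have d: "(weak_deriv L ^^ 2) (inv_dxx L (inv_dxx L w)) = inv_dxx L w" "(weak_deriv L ^^ 3) (inv_dxx L (inv_dxx L w)) = inv_dx L w"
      "(weak_deriv L ^^ 4) (inv_dxx L (inv_dxx L w)) = w"
    by (simp_all add: eval_nat_numeral e)
  have "inv_dxx L (inv_dxx L w) \<in> sobolev (Suc (Suc (Suc (Suc 0)))) L"
    using k kk w by auto
  then show "inv_dxx L (inv_dxx L w) \<in> KS_domain L"
    by (simp add: KS_domain_def d e inv_dxx_boundary L eval_nat_numeral)
  show "KS_op L lam (inv_dxx L (inv_dxx L w)) = lam *\<^sub>R inv_dxx L w + w"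
    by (simp add: KS_op_def d)
qed

section \<open>The semigroup and its generator\<close>

lemma exp_minus_one_bound: "\<bar>exp y - 1\<bar> \<le> \<bar>y\<bar> * exp (max 0 y)" for y :: real
proof (cases "y \<ge> 0")
  case True
  have "1 - y \<le> exp (- y)" using exp_ge_add_one_self[of "- y"] by simp
  from mult_right_mono[OF this, of "exp y"] have "exp y - y * exp y \<le> 1"
    by (simp add: left_diff_distrib flip: exp_add)
  then show ?thesis using True by (simp add: max_def)
next
  case False
  then have "exp y \<le> 1" "max 0 y = 0" "\<bar>y\<bar> = - y" by simp_all
  moreover have "1 + y \<le> exp y" by (rule exp_ge_add_one_self)
  ultimately have "\<bar>exp y - 1\<bar> \<le> - y" by linarith
  then show ?thesis by (simp only: \<open>max 0 y = 0\<close> \<open>\<bar>y\<bar> = - y\<close> exp_zero mult_1_right)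
qed

text \<open>
  The operator acts on \<open>sin (freq L k * x)\<close> as multiplication by \<open>nu k\<close>. Finitely many \<open>nu k\<close> may be
  negative, and they need not be distinct.
\<close>
locale KS_spectrum =
  fixes L lam :: real
  assumes L: "L > 0" and lam: "lam \<ge> 0"
begin

sublocale orthonormal_sequence "mode L"
  by (rule mode_orthonormal[OF L])

abbreviation m :: "nat \<Rightarrow> real" where "m k \<equiv> (freq L k)\<^sup>2"

definition nu :: "nat \<Rightarrow> real" where "nu k = m k * (m k - lam)"

abbreviation coef :: "L2 \<Rightarrow> nat \<Rightarrow> real" where "coef f k \<equiv> inner f (mode L k)"

lemma m_pos: "m k > 0"
  using freq_pos[OF L, of k] by simp

lemma nu_ge: "nu k \<ge> - (lam\<^sup>2 / 4)"
proof -
  have "0 \<le> (m k - lam / 2)\<^sup>2" by simp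
  then show ?thesis by (simp add: nu_def power2_eq_square algebra_simps)
qed

lemma mode_in_L2_on: "mode L k \<in> L2_on L"
  unfolding mode_def by (intro L2_on_scale L2_of_continuous_in_L2_on continuous_intros)

lemma combo_in_L2_on:
  assumes "summable (\<lambda>k. (a k)\<^sup>2)"
  shows "combo a \<in> L2_on L"
proof (rule closed_sequentially[OF closed_L2_on])
  show "(\<lambda>n. \<Sum>k<n. a k *\<^sub>R mode L k) \<longlonglongrightarrow> combo a"
    unfolding combo_def by (rule summable_LIMSEQ[OF summable_combo[OF assms]])
  show "(\<Sum>k<n. a k *\<^sub>R mode L k) \<in> L2_on L" for n
    by (induction n) (auto intro: L2_on_zero L2_on_add L2_on_scale mode_in_L2_on)
qed

lemma coef_eqI:
  assumes "f \<in> L2_on L" "g \<in> L2_on L" "\<And>k. coef f k = coef g k"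
  shows "f = g"
proof -
  have "f - g = 0"
    by (rule modes_complete[OF L2_on_diff[OF assms(1,2)] L]) (simp add: inner_diff_left assms(3))
  then show ?thesis by simp
qed

lemma expansion: "f \<in> L2_on L \<Longrightarrow> combo (coef f) = f"
  by (rule coef_eqI) (auto intro: combo_in_L2_on bessel simp: inner_combo bessel)

definition S :: "real \<Rightarrow> L2 \<Rightarrow> L2" where
  "S t f = combo (\<lambda>k. exp (- nu k * t) * coef f k)"

lemma exp_nu_le: "0 \<le> s \<Longrightarrow> s \<le> t \<Longrightarrow> exp (- nu k * s) \<le> exp (lam\<^sup>2 / 4 * t)"
proof -
  assume s: "0 \<le> s" "s \<le> t"
  have "- nu k * s \<le> lam\<^sup>2 / 4 * s" using nu_ge[of k] s by (intro mult_right_mono) auto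
  also have "\<dots> \<le> lam\<^sup>2 / 4 * t" using s by (intro mult_left_mono) auto
  finally show ?thesis by simp
qed

lemma S_bound_coef: "0 \<le> s \<Longrightarrow> s \<le> t \<Longrightarrow> \<bar>exp (- nu k * s) * coef f k\<bar> \<le> exp (lam\<^sup>2 / 4 * t) * \<bar>coef f k\<bar>"
  unfolding abs_mult using exp_nu_le[of s t k] by (intro mult_right_mono) auto

lemma summable_scaled: "summable (\<lambda>k. (c * \<bar>coef f k\<bar>)\<^sup>2)"
  using summable_mult[OF bessel(1)[of f], of "c\<^sup>2"] by (simp add: power_mult_distrib)

lemma S_summable:
  assumes "t \<ge> 0"
  shows "summable (\<lambda>k. (exp (- nu k * t) * coef f k)\<^sup>2)"
proof (rule summable_comparison_test'[OF summable_scaled[of "exp (lam\<^sup>2 / 4 * t)" f], of 0])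
  fix k
  show "norm ((exp (- nu k * t) * coef f k)\<^sup>2) \<le> (exp (lam\<^sup>2 / 4 * t) * \<bar>coef f k\<bar>)\<^sup>2"
    using power_mono[OF S_bound_coef[OF assms order_refl, of k f], of 2] by simp
qed

lemma S_coef: "t \<ge> 0 \<Longrightarrow> coef (S t f) k = exp (- nu k * t) * coef f k"
  unfolding S_def by (rule inner_combo[OF S_summable])

lemma S_in: "t \<ge> 0 \<Longrightarrow> S t f \<in> L2_on L"
  unfolding S_def by (rule combo_in_L2_on[OF S_summable])

lemma S_add: "t \<ge> 0 \<Longrightarrow> S t (f + g) = S t f + S t g"
  by (rule coef_eqI) (auto intro: S_in L2_on_add simp: S_coef inner_add_left distrib_left)

lemma S_scale: "t \<ge> 0 \<Longrightarrow> S t (c *\<^sub>R f) = c *\<^sub>R S t f"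
  by (rule coef_eqI) (auto intro: S_in L2_on_scale simp: S_coef)

lemma S_S: "s \<ge> 0 \<Longrightarrow> t \<ge> 0 \<Longrightarrow> S s (S t f) = S (s + t) f"
  by (rule coef_eqI) (auto intro: S_in simp: S_coef distrib_left exp_add right_diff_distrib exp_diff exp_minus field_simps)

lemma S_0: "f \<in> L2_on L \<Longrightarrow> S 0 f = f"
  by (simp add: S_def expansion)

lemma S_norm: "t \<ge> 0 \<Longrightarrow> norm (S t f) \<le> exp (lam\<^sup>2 / 4 * t) * norm f"
proof (rule power2_le_imp_le)
  assume t: "t \<ge> 0"
  have "(norm (S t f))\<^sup>2 = (\<Sum>k. (exp (- nu k * t) * coef f k)\<^sup>2)"
    unfolding S_def by (rule norm_combo[OF S_summable[OF t]])
  also have "\<dots> \<le> (\<Sum>k. (exp (lam\<^sup>2 / 4 * t) * \<bar>coef f k\<bar>)\<^sup>2)"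
  proof (rule suminf_le[OF _ S_summable[OF t] summable_scaled])
    fix k show "(exp (- nu k * t) * coef f k)\<^sup>2 \<le> (exp (lam\<^sup>2 / 4 * t) * \<bar>coef f k\<bar>)\<^sup>2"
      using power_mono[OF S_bound_coef[OF t order_refl, of k f], of 2] by simp
  qed
  also have "\<dots> = (exp (lam\<^sup>2 / 4 * t))\<^sup>2 * (\<Sum>k. (coef f k)\<^sup>2)"
    by (simp add: power_mult_distrib suminf_mult bessel)
  also have "\<dots> \<le> (exp (lam\<^sup>2 / 4 * t))\<^sup>2 * (norm f)\<^sup>2"
    by (intro mult_left_mono bessel) simp
  finally show "(norm (S t f))\<^sup>2 \<le> (exp (lam\<^sup>2 / 4 * t) * norm f)\<^sup>2"
    by (simp add: power_mult_distrib)
qed simp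

lemma S_bounded_linear: "t \<ge> 0 \<Longrightarrow> bounded_linear (S t)"
proof (rule bounded_linear_intro[of _ "exp (lam\<^sup>2 / 4 * t)"])
  fix x assume "t \<ge> 0"
  then show "norm (S t x) \<le> norm x * exp (lam\<^sup>2 / 4 * t)"
    using S_norm[of t x] by (simp only: mult.commute)
qed (simp_all add: S_add S_scale)

lemma S_continuous: "continuous_on {0..} (\<lambda>t. S t f)"
  unfolding continuous_on_def
proof
  fix t :: real assume t: "t \<in> {0..}"
  show "((\<lambda>s. S s f) \<longlongrightarrow> S t f) (at t within {0..})"
  proof (cases "at t within {0::real..} = bot")
    case False
    show ?thesis
      unfolding S_def
    proof (rule combo_tendsto(2)[OF _ _ summable_scaled False])
      show "((\<lambda>s. exp (- nu k * s) * coef f k) \<longlongrightarrow> exp (- nu k * t) * coef f k) (at t within {0..})" for k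
        by (intro tendsto_intros)
      have "\<forall>\<^sub>F s in at t within {0..}. s < t + 1"
        by (rule order_tendstoD[OF tendsto_ident_at]) simp
      moreover have "\<forall>\<^sub>F s in at t within {0..}. s \<in> {0..}"
        by (simp add: eventually_at_filter)
      ultimately show "\<forall>\<^sub>F s in at t within {0..}. \<forall>k. \<bar>exp (- nu k * s) * coef f k\<bar> \<le> exp (lam\<^sup>2 / 4 * (t + 1)) * \<bar>coef f k\<bar>"
        by eventually_elim (intro allI S_bound_coef, auto)
    qed
  qed simp
qed

lemma S_C0_semigroup: "C0_semigroup (L2_on L) S"
  unfolding C0_semigroup_def
proof (intro conjI allI impI ballI)
  fix t :: real assume t: "0 \<le> t"
  show "\<exists>K. \<forall>x\<in>L2_on L. norm (S t x) \<le> K * norm x"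
    using S_norm[OF t] by blast
next
  fix f assume f: "f \<in> L2_on L"
  have "((\<lambda>t. S t f) \<longlongrightarrow> S 0 f) (at 0 within {0..})"
    using S_continuous[of f] unfolding continuous_on_def by simp
  then have "((\<lambda>t. S t f) \<longlongrightarrow> S 0 f) (at 0 within {0<..})"
    by (rule tendsto_within_subset) auto
  then show "((\<lambda>t. S t f) \<longlongrightarrow> f) (at_right 0)" by (simp add: S_0 f)
qed (auto simp: S_in S_add S_scale S_0 S_S)

lemma quotient_coef_tendsto: "((\<lambda>h. (exp (- nu k * h) - 1) / h) \<longlongrightarrow> - nu k) (at_right 0)"
proof -
  have "((\<lambda>h. exp (- nu k * h)) has_real_derivative - nu k) (at 0)"
    by (auto intro!: derivative_eq_intros)
  then have "((\<lambda>h. (exp (- nu k * h) - 1) / h) \<longlongrightarrow> - nu k) (at 0)"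
    by (simp add: DERIV_def)
  then show ?thesis by (rule tendsto_within_subset[OF _ subset_UNIV])
qed

lemma quotient_coef:
  "h > 0 \<Longrightarrow> coef ((S h f - f) /\<^sub>R h) k = (exp (- nu k * h) - 1) / h * coef f k"
  by (simp add: inner_diff_left S_coef divide_inverse algebra_simps)

lemma inv_dxx_in: "f \<in> L2_on L \<Longrightarrow> inv_dxx L f \<in> L2_on L"
  by (rule inv_dxx_weak_deriv(4)[OF _ L])

text \<open>
  The coefficients of the difference quotient converge one by one and are dominated by a multiple of
  those of the image under the operator, which are square summable.
\<close>
lemma domain_imp_generator:
  assumes x: "x \<in> KS_domain L"
  shows "((\<lambda>h. (S h x - x) /\<^sub>R h) \<longlongrightarrow> - KS_op L lam x) (at_right 0)"
proof -
  obtain w where w: "w \<in> L2_on L" "x = inv_dxx L (inv_dxx L w)" "KS_op L lam x = lam *\<^sub>R inv_dxx L w + w"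
    using KS_domain_imp_inv_dxx[OF x L] by blast
  have xL: "x \<in> L2_on L" using w by (simp add: inv_dxx_in)
  have A: "- KS_op L lam x \<in> L2_on L"
    using L2_on_scale[OF L2_on_add[OF L2_on_scale[OF inv_dxx_in[OF w(1)], of lam] w(1)], of "-1"] by (simp add: w(3))
  have cA: "coef (- KS_op L lam x) k = - nu k * coef x k" for k
  proof -
    have "coef x k = coef w k / (m k * m k)"
      by (simp add: w(2) inv_dxx_coefficient[OF inv_dxx_in[OF w(1)] L] inv_dxx_coefficient[OF w(1) L])
    moreover have "c / M = M * a \<and> c = M * M * a" if "a = c / (M * M)" "M > 0" for a c M :: real
      using that by simp
    ultimately have e1: "coef w k / m k = m k * coef x k" and e2: "coef w k = m k * m k * coef x k"
      using m_pos[of k] by blast+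
    have "coef (KS_op L lam x) k = - (lam * (coef w k / m k)) + coef w k"
      by (simp add: w(3) inner_add_left inv_dxx_coefficient[OF w(1) L])
    also have "\<dots> = nu k * coef x k"
      unfolding e1 unfolding e2 nu_def by (simp only: algebra_simps)
    finally show ?thesis by simp
  qed
  have ev: "\<forall>\<^sub>F h in at_right 0. h \<in> {0<..<1::real}"
    by (rule eventually_at_right_real) simp
  have "((\<lambda>h. combo (\<lambda>k. (exp (- nu k * h) - 1) / h * coef x k)) \<longlongrightarrow> combo (coef (- KS_op L lam x))) (at_right 0)"
  proof (rule combo_tendsto(2))
    show "((\<lambda>h. (exp (- nu k * h) - 1) / h * coef x k) \<longlongrightarrow> coef (- KS_op L lam x) k) (at_right 0)" for k
      unfolding cA by (intro tendsto_mult tendsto_const quotient_coef_tendsto)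
    show "summable (\<lambda>k. (exp (lam\<^sup>2 / 4 * 1) * \<bar>coef (- KS_op L lam x) k\<bar>)\<^sup>2)" by (rule summable_scaled)
    show "\<forall>\<^sub>F h in at_right 0. \<forall>k. \<bar>(exp (- nu k * h) - 1) / h * coef x k\<bar> \<le> exp (lam\<^sup>2 / 4 * 1) * \<bar>coef (- KS_op L lam x) k\<bar>"
      using ev
    proof (eventually_elim, intro allI)
      fix h :: real and k assume h: "h \<in> {0<..<1}"
      have "\<bar>exp (- nu k * h) - 1\<bar> \<le> \<bar>- nu k * h\<bar> * exp (max 0 (- nu k * h))"
        by (rule exp_minus_one_bound)
      also have "exp (max 0 (- nu k * h)) \<le> exp (lam\<^sup>2 / 4 * 1)"
        using exp_nu_le[of h 1 k] h by (simp add: max_def)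
      finally have "\<bar>exp (- nu k * h) - 1\<bar> \<le> \<bar>nu k\<bar> * h * exp (lam\<^sup>2 / 4)"
        using h by (simp add: abs_mult mult_left_mono)
      then have "\<bar>(exp (- nu k * h) - 1) / h\<bar> \<le> \<bar>nu k\<bar> * exp (lam\<^sup>2 / 4)"
        using h by (simp add: field_simps)
      from mult_right_mono[OF this, of "\<bar>coef x k\<bar>"]
      show "\<bar>(exp (- nu k * h) - 1) / h * coef x k\<bar> \<le> exp (lam\<^sup>2 / 4 * 1) * \<bar>coef (- KS_op L lam x) k\<bar>"
        unfolding cA by (simp add: abs_mult mult_ac)
    qed
  qed simp
  then have "((\<lambda>h. combo (\<lambda>k. (exp (- nu k * h) - 1) / h * coef x k)) \<longlongrightarrow> - KS_op L lam x) (at_right 0)"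
    by (simp only: expansion[OF A])
  then show ?thesis
  proof (rule Lim_transform_eventually)
    show "\<forall>\<^sub>F h in at_right 0. combo (\<lambda>k. (exp (- nu k * h) - 1) / h * coef x k) = (S h x - x) /\<^sub>R h"
      using ev
    proof eventually_elim
      case (elim h)
      have "(S h x - x) /\<^sub>R h \<in> L2_on L"
        using elim by (intro L2_on_scale L2_on_diff S_in xL) auto
      from expansion[OF this] show ?case
        using quotient_coef[of h x] elim by simp
    qed
  qed
qed

text \<open>
  If \<open>w\<close> is the limit then \<open>coef w k = - nu k * coef x k\<close>. Dividing by \<open>(m k)\<^sup>2\<close>, this says
  \<open>x = - lam (inv_dxx x) - inv_dxx (inv_dxx w)\<close>, which exhibits \<open>x\<close> in the range of \<open>inv_dxx\<close> squared. The
  vectors \<open>g\<close> and \<open>v\<close> below are the second derivative of \<open>x\<close> and its fourth.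
\<close>
lemma generator_imp_domain:
  assumes x: "x \<in> L2_on L" and lim: "((\<lambda>h. (S h x - x) /\<^sub>R h) \<longlongrightarrow> w) (at_right 0)"
  shows "x \<in> KS_domain L" "w = - KS_op L lam x"
proof -
  have ev: "\<forall>\<^sub>F h in at_right 0. h \<in> {0<..<1::real}"
    by (rule eventually_at_right_real) simp
  have w: "w \<in> L2_on L"
  proof (rule Lim_in_closed_set[OF closed_L2_on _ _ lim])
    show "\<forall>\<^sub>F h in at_right 0. (S h x - x) /\<^sub>R h \<in> L2_on L"
      using ev by eventually_elim (intro L2_on_scale L2_on_diff S_in x, auto)
  qed simp
  have cw: "coef w k = - nu k * coef x k" for k
  proof (rule tendsto_unique[of "at_right 0"])
    show "((\<lambda>h. coef ((S h x - x) /\<^sub>R h) k) \<longlongrightarrow> coef w k) (at_right 0)"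
      by (intro tendsto_intros lim)
    have "((\<lambda>h. (exp (- nu k * h) - 1) / h * coef x k) \<longlongrightarrow> - nu k * coef x k) (at_right 0)"
      by (intro tendsto_mult tendsto_const quotient_coef_tendsto)
    then show "((\<lambda>h. coef ((S h x - x) /\<^sub>R h) k) \<longlongrightarrow> - nu k * coef x k) (at_right 0)"
      by (rule Lim_transform_eventually) (use ev in \<open>eventually_elim, subst quotient_coef, auto\<close>)
  qed simp
  define g where "g = (- lam) *\<^sub>R x - inv_dxx L w"
  define v where "v = (- lam) *\<^sub>R g - w"
  have g: "g \<in> L2_on L" unfolding g_def by (intro L2_on_diff L2_on_scale x inv_dxx_in w)
  have v: "v \<in> L2_on L" unfolding v_def by (intro L2_on_diff L2_on_scale g w)
  have cg: "coef g k = - m k * coef x k" for k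
    using m_pos[of k] by (simp add: g_def inner_diff_left inv_dxx_coefficient[OF w L] cw nu_def field_simps)
  have "x = inv_dxx L g"
  proof (rule coef_eqI[OF x inv_dxx_in[OF g]])
    show "coef x k = coef (inv_dxx L g) k" for k
      using m_pos[of k] by (simp add: inv_dxx_coefficient[OF g L] cg)
  qed
  moreover have "g = inv_dxx L v"
  proof (rule coef_eqI[OF g inv_dxx_in[OF v]])
    fix k
    have "coef v k = - lam * coef g k - coef w k" by (simp add: v_def inner_diff_left)
    also have "\<dots> = m k * (m k * coef x k)"
      unfolding cg cw nu_def by algebra
    finally have "coef v k = m k * (m k * coef x k)" .
    moreover have "c / M = M * a" if "c = M * (M * a)" "M > 0" for a c M :: real
      using that by simp
    ultimately have "coef v k / m k = m k * coef x k"
      using m_pos[of k] by blast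
    then show "coef g k = coef (inv_dxx L v) k"
      by (simp add: inv_dxx_coefficient[OF v L] cg)
  qed
  ultimately have xv: "x = inv_dxx L (inv_dxx L v)" by simp
  show "x \<in> KS_domain L" unfolding xv by (rule inv_dxx_in_KS_domain(1)[OF v L])
  have "KS_op L lam x = lam *\<^sub>R g + v"
    using inv_dxx_in_KS_domain(2)[OF v L, of lam] xv \<open>g = inv_dxx L v\<close> by simp
  then show "w = - KS_op L lam x" by (simp add: v_def)
qed

lemma KS_domain_subset: "KS_domain L \<subseteq> L2_on L"
  by (auto simp: KS_domain_def eval_nat_numeral)

lemma S_generator: "has_generator (L2_on L) S (KS_domain L) (\<lambda>x. - KS_op L lam x)"
  unfolding has_generator_def
  using KS_domain_subset domain_imp_generator generator_imp_domain by blast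

end

section \<open>Traces of the uncontrolled solution\<close>

lemma suminf_swap_real:
  fixes f :: "nat \<Rightarrow> nat \<Rightarrow> real"
  assumes "\<And>j. summable (\<lambda>n. \<bar>f n j\<bar>)" "summable (\<lambda>j. \<Sum>n. \<bar>f n j\<bar>)"
  shows "(\<Sum>n. \<Sum>j. f n j) = (\<Sum>j. \<Sum>n. f n j)"
proof -
  have conv: "infsum g UNIV = suminf g" if "g summable_on UNIV" for g :: "nat \<Rightarrow> real"
    using has_sum_imp_sums[OF has_sum_infsum[OF that]] by (rule sums_unique)
  have sumn: "(\<lambda>n. \<bar>f n j\<bar>) summable_on UNIV" for j
    using assms(1)[of j] by (simp add: summable_on_UNIV_nonneg_real_iff)
  have "(\<lambda>x. norm ((\<lambda>(j, n). f n j) x)) summable_on UNIV \<times> UNIV"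
  proof (rule Infinite_Sum.abs_summable_on_Sigma_iff[THEN iffD2], intro conjI ballI)
    show "(\<lambda>n. norm (case (j, n) of (j, n) \<Rightarrow> f n j)) summable_on UNIV" for j
      using sumn[of j] by simp
    have "(\<lambda>j. \<Sum>n. \<bar>f n j\<bar>) summable_on UNIV"
      using assms by (subst summable_on_UNIV_nonneg_real_iff) (auto intro: suminf_nonneg)
    then show "(\<lambda>j. norm (\<Sum>\<^sub>\<infinity>n. norm (case (j, n) of (j, n) \<Rightarrow> f n j))) summable_on UNIV"
      using assms(1) by (simp add: conv[OF sumn] suminf_nonneg)
  qed
  then have s: "(\<lambda>(j, n). f n j) summable_on UNIV \<times> UNIV"
    by (rule abs_summable_summable)
  then have s': "(\<lambda>(n, j). f n j) summable_on UNIV \<times> UNIV"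
    using has_sum_swap[where f = "\<lambda>(j, n). f n j" and A = UNIV and B = UNIV]
    by (auto simp: summable_on_def case_prod_unfold)
  have o1: "(\<lambda>j. \<Sum>\<^sub>\<infinity>n. f n j) summable_on UNIV" "\<And>j. (\<lambda>n. f n j) summable_on UNIV"
    using summable_on_Sigma_banach[OF s] summable_on_SigmaD1[OF s] by auto
  have o2: "(\<lambda>n. \<Sum>\<^sub>\<infinity>j. f n j) summable_on UNIV" "\<And>n. (\<lambda>j. f n j) summable_on UNIV"
    using summable_on_Sigma_banach[OF s'] summable_on_SigmaD1[OF s'] by auto
  have "(\<Sum>\<^sub>\<infinity>j. \<Sum>\<^sub>\<infinity>n. f n j) = (\<Sum>\<^sub>\<infinity>n. \<Sum>\<^sub>\<infinity>j. f n j)"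
    by (rule infsum_swap_banach[OF s])
  then show ?thesis
    using o1 o2 by (simp add: conv)
qed

lemma suminf_minus_diff_mult:
  fixes a b :: "nat \<Rightarrow> real"
  assumes "summable a" "summable b"
  shows "(\<Sum>k. - a k - c * b k) = - suminf a - c * suminf b"
  using assms by (simp add: suminf_diff[symmetric] suminf_minus[symmetric] suminf_mult[symmetric] summable_minus summable_mult)

lemma jet_cong:
  assumes "\<And>i. D i t = D' i t" "\<And>i. E i t = E' i t"
  shows "jet lam D E n i t = jet lam D' E' n i t"
  by (induction n arbitrary: i rule: induct_nat_012) (auto simp: assms)

lemma gevrey_subset: "gevrey I D \<Longrightarrow> J \<subseteq> I \<Longrightarrow> gevrey J D"
  unfolding gevrey_def by (meson subsetD)

text \<open>
  Used twice for the truncated traces: before the cutoff sets in their towers are those of the free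
  traces, and after it has vanished they are zero.
\<close>
lemma derivative_towers_agree:
  fixes D E :: "nat \<Rightarrow> real \<Rightarrow> real"
  assumes D: "\<And>n t. t \<in> I \<Longrightarrow> (D n has_real_derivative D (Suc n) t) (at t)"
    and E: "\<And>n t. t \<in> I \<Longrightarrow> (E n has_real_derivative E (Suc n) t) (at t)"
    and I: "open I" and eq: "\<And>t. t \<in> I \<Longrightarrow> D 0 t = E 0 t" and t: "t \<in> I"
  shows "D n t = E n t"
  using t
proof (induction n arbitrary: t)
  case (Suc n)
  have "(E n has_real_derivative D (Suc n) t) (at t)"
    by (rule has_field_derivative_transform_within_open[OF D[OF Suc.prems] I Suc.prems Suc.IH])
  then show ?case using E[OF Suc.prems] by (rule DERIV_unique)
qed (rule eq)

context KS_spectrum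
begin

text \<open>
  Any exponential of a multiple of \<open>m k\<close> is beaten by \<open>exp (- nu k * t)\<close> for \<open>t > 0\<close>, since \<open>nu k\<close> is
  quadratic in \<open>m k\<close>.
\<close>
definition tame :: "(nat \<Rightarrow> real) \<Rightarrow> bool" where
  "tame z \<longleftrightarrow> (\<exists>c\<ge>0. \<forall>k. \<bar>z k\<bar> \<le> c * exp (m k))"

text \<open>
  The \<open>i\<close>-th time derivative of the value at \<open>x = L\<close> of a superposition of decaying modes; \<open>z k\<close> is the
  amplitude of the \<open>k\<close>-th mode there.
\<close>
definition trace :: "(nat \<Rightarrow> real) \<Rightarrow> nat \<Rightarrow> real \<Rightarrow> real" where
  "trace z i t = (\<Sum>k. z k * (- nu k) ^ i * exp (- nu k * t))"

lemma summable_exp_freq: "summable (\<lambda>k. exp (- freq L k))"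
proof -
  define p where "p = pi / L"
  have p: "p > 0" using L by (simp add: p_def)
  have "exp (- freq L k) = exp (- p / 2) * exp (- p) ^ k" for k
    by (simp add: freq_def p_def[symmetric] exp_of_nat_mult[symmetric] exp_add[symmetric] algebra_simps)
  moreover have "summable (\<lambda>k. exp (- p / 2) * exp (- p) ^ k)"
    using p by (intro summable_mult summable_geometric) simp
  ultimately show ?thesis by simp
qed

lemma heat_decay:
  assumes "tau > 0" "B \<ge> 0"
  obtains C where "C \<ge> 0" "\<And>t k. tau \<le> t \<Longrightarrow> t \<le> T' \<Longrightarrow> exp (- nu k * t + B * m k) \<le> C * exp (- freq L k)"
proof -
  \<comment> \<open>The tangent of slope \<open>A\<close> to the parabola \<open>nu\<close> as a function of \<open>m\<close>; the slope is chosen so that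
    \<open>A * tau\<close> exceeds \<open>B\<close> by the 1 that is left to control \<open>freq\<close>.\<close>
  define A where "A = (B + 1) / tau"
  define kap where "kap = (lam + A)\<^sup>2 / 4"
  have "exp (- nu k * t + B * m k) \<le> exp (kap * T' + 1) * exp (- freq L k)" if t: "tau \<le> t" "t \<le> T'" for t k
  proof -
    have "0 \<le> (m k - (lam + A) / 2)\<^sup>2" by simp
    then have "A * m k - kap \<le> nu k"
      by (simp add: nu_def kap_def power2_eq_square algebra_simps add_divide_distrib diff_divide_distrib)
    then have 1: "- nu k * t \<le> - (A * m k - kap) * t"
      using t assms by (intro mult_right_mono) auto
    have "A * m k * tau \<le> A * m k * t"
      using t assms m_pos[of k] by (intro mult_left_mono) (auto simp: A_def)
    moreover have "A * m k * tau = (B + 1) * m k" using assms by (simp add: A_def)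
    moreover have "kap * t \<le> kap * T'" using t by (intro mult_left_mono) (auto simp: kap_def)
    moreover have "freq L k \<le> 1 + m k"
    proof -
      have "0 \<le> (freq L k - 1 / 2)\<^sup>2" by simp
      then show ?thesis by (simp add: power2_eq_square algebra_simps)
    qed
    ultimately have "- nu k * t + B * m k \<le> kap * T' + 1 + - freq L k"
      using 1 by (simp add: algebra_simps)
    then show ?thesis by (simp only: exp_add[symmetric] exp_le_cancel_iff)
  qed
  then show thesis using that[of "exp (kap * T' + 1)"] by simp
qed

text \<open>
  Half of the available decay pays for the powers of \<open>nu k\<close>, by \<open>x ^ i \<le> fact i * exp x\<close>; the other half
  pays for the amplitude and for summability.
\<close>
lemma trace_term_bound:
  assumes z: "tame z" and tau: "tau > 0"
  obtains c where "c \<ge> 0"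
    "\<And>t k i. tau \<le> t \<Longrightarrow> t \<le> T' \<Longrightarrow> \<bar>z k * (- nu k) ^ i * exp (- nu k * t)\<bar> \<le> c * (2 / tau) ^ i * fact i * exp (- freq L k)"
proof -
  obtain c0 where c0: "c0 \<ge> 0" "\<And>k. \<bar>z k\<bar> \<le> c0 * exp (m k)" using z by (auto simp: tame_def)
  obtain C where C: "C \<ge> 0"
    "\<And>t k. tau / 2 \<le> t \<Longrightarrow> t \<le> T' \<Longrightarrow> exp (- nu k * t + 1 * m k) \<le> C * exp (- freq L k)"
    by (rule heat_decay[of "tau / 2" 1 T']) (use tau in auto)
  define kap where "kap = lam\<^sup>2 / 4"
  define c where "c = c0 * exp (kap * tau) * C"
  have "\<bar>z k * (- nu k) ^ i * exp (- nu k * t)\<bar> \<le> c * (2 / tau) ^ i * fact i * exp (- freq L k)"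
    if t: "tau \<le> t" "t \<le> T'" for t k i
  proof -
    have "(\<bar>nu k\<bar> * tau / 2) ^ i \<le> fact i * exp (\<bar>nu k\<bar> * tau / 2)"
      using tau by (intro power_exp_le_fact) auto
    then have "(2 / tau) ^ i * (\<bar>nu k\<bar> * tau / 2) ^ i \<le> (2 / tau) ^ i * (fact i * exp (\<bar>nu k\<bar> * tau / 2))"
      using tau by (intro mult_left_mono) auto
    moreover have "(2 / tau) ^ i * (\<bar>nu k\<bar> * tau / 2) ^ i = \<bar>nu k\<bar> ^ i"
      unfolding power_mult_distrib[symmetric] using tau by simp
    ultimately have p: "\<bar>nu k\<bar> ^ i \<le> (2 / tau) ^ i * (fact i * exp (\<bar>nu k\<bar> * tau / 2))" by simp
    have "\<bar>nu k\<bar> \<le> nu k + 2 * kap" using nu_ge[of k] by (simp add: kap_def abs_if)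
    then have "\<bar>nu k\<bar> * (tau / 2) \<le> (nu k + 2 * kap) * (tau / 2)" using tau by (intro mult_right_mono) auto
    then have e: "\<bar>nu k\<bar> * tau / 2 + - nu k * t + m k \<le> kap * tau + (- nu k * (t - tau / 2) + 1 * m k)"
      by (simp add: algebra_simps)
    have "\<bar>z k * (- nu k) ^ i * exp (- nu k * t)\<bar> = \<bar>z k\<bar> * \<bar>nu k\<bar> ^ i * exp (- nu k * t)"
      by (simp add: abs_mult power_abs)
    also have "\<dots> \<le> (c0 * exp (m k)) * ((2 / tau) ^ i * (fact i * exp (\<bar>nu k\<bar> * tau / 2))) * exp (- nu k * t)"
      using c0 by (intro mult_right_mono mult_mono p) auto
    also have "\<dots> = c0 * (2 / tau) ^ i * fact i * exp (\<bar>nu k\<bar> * tau / 2 + - nu k * t + m k)"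
      by (simp only: exp_add mult_ac)
    also have "\<dots> \<le> c0 * (2 / tau) ^ i * fact i * exp (kap * tau + (- nu k * (t - tau / 2) + 1 * m k))"
      using e c0 tau by (intro mult_left_mono) auto
    also have "\<dots> = c0 * (2 / tau) ^ i * fact i * exp (kap * tau) * exp (- nu k * (t - tau / 2) + 1 * m k)"
      by (simp only: exp_add mult.assoc)
    also have "\<dots> \<le> c0 * (2 / tau) ^ i * fact i * exp (kap * tau) * (C * exp (- freq L k))"
      using c0 tau t by (intro mult_left_mono C(2)) auto
    also have "\<dots> = c * (2 / tau) ^ i * fact i * exp (- freq L k)"
      by (simp only: c_def mult_ac)
    finally show ?thesis .
  qed
  moreover have "c \<ge> 0" using c0 C by (simp add: c_def)
  ultimately show thesis using that by blast
qed

lemma trace_summable: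
  assumes z: "tame z" and t: "t > 0"
  shows "summable (\<lambda>k. z k * (- nu k) ^ i * exp (- nu k * t))"
proof -
  obtain c where "c \<ge> 0" and c: "\<And>s k i. t \<le> s \<Longrightarrow> s \<le> t \<Longrightarrow> \<bar>z k * (- nu k) ^ i * exp (- nu k * s)\<bar> \<le> c * (2 / t) ^ i * fact i * exp (- freq L k)"
    by (rule trace_term_bound[OF z t, where T' = t]) (rule that)
  show ?thesis
    by (rule summable_comparison_test'[OF summable_mult[OF summable_exp_freq, of "c * (2 / t) ^ i * fact i"], of 0])
      (use c[OF order_refl order_refl] in simp)
qed

lemma trace_gevrey:
  assumes z: "tame z" and tau: "tau > 0"
  shows "gevrey {tau<..<T'} (trace z)"
proof -
  obtain c where c: "c \<ge> 0" "\<And>t k i. tau \<le> t \<Longrightarrow> t \<le> T' \<Longrightarrow>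
      \<bar>z k * (- nu k) ^ i * exp (- nu k * t)\<bar> \<le> c * (2 / tau) ^ i * fact i * exp (- freq L k)"
    by (rule trace_term_bound[OF z tau, where T' = T']) (rule that)
  define Q where "Q = (\<Sum>k. exp (- freq L k))"
  have Q: "Q \<ge> 0" unfolding Q_def by (rule suminf_nonneg[OF summable_exp_freq]) simp
  note maj = summable_mult[OF summable_exp_freq, of "c * (2 / tau) ^ i * fact i" for i]
  show ?thesis
  proof (rule gevreyI)
    fix i t assume t: "t \<in> {tau<..<T'}"
    have "((\<lambda>t. \<Sum>k. z k * (- nu k) ^ i * exp (- nu k * t)) has_real_derivative (\<Sum>k. z k * (- nu k) ^ Suc i * exp (- nu k * t))) (at t)"
    proof (rule has_field_derivative_series'(2)[where ?x0.0 = t and S = "{tau<..<T'}"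
        and f = "\<lambda>k t. z k * (- nu k) ^ i * exp (- nu k * t)" and f' = "\<lambda>k t. z k * (- nu k) ^ Suc i * exp (- nu k * t)"])
      show "((\<lambda>t. z k * (- nu k) ^ i * exp (- nu k * t)) has_real_derivative z k * (- nu k) ^ Suc i * exp (- nu k * x)) (at x within {tau<..<T'})" for k x
        by (auto intro!: derivative_eq_intros)
      show "uniformly_convergent_on {tau<..<T'} (\<lambda>n x. \<Sum>k<n. z k * (- nu k) ^ Suc i * exp (- nu k * x))"
      proof (rule Weierstrass_m_test'[OF _ maj[of "Suc i"]])
        fix k x assume "x \<in> {tau<..<T'}"
        then show "norm (z k * (- nu k) ^ Suc i * exp (- nu k * x)) \<le> c * (2 / tau) ^ Suc i * fact (Suc i) * exp (- freq L k)"
          unfolding real_norm_def by (intro c(2)) auto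
      qed
      show "summable (\<lambda>k. z k * (- nu k) ^ i * exp (- nu k * t))"
        by (rule trace_summable[OF z]) (use t tau in auto)
    qed (use t in auto)
    then show "(trace z i has_real_derivative trace z (Suc i) t) (at t)"
      by (simp only: trace_def[abs_def])
  next
    show "c * Q \<ge> 0" using c Q by simp
    show "2 / tau \<ge> 0" using tau by simp
    fix i t assume t: "t \<in> {tau<..<T'}"
    have b: "\<bar>z k * (- nu k) ^ i * exp (- nu k * t)\<bar> \<le> c * (2 / tau) ^ i * fact i * exp (- freq L k)" for k
      using t by (intro c(2)) auto
    have "\<bar>trace z i t\<bar> \<le> (\<Sum>k. c * (2 / tau) ^ i * fact i * exp (- freq L k))"
      unfolding trace_def real_norm_def[symmetric]
      by (rule norm_suminf_le[OF _ maj]) (use b in simp)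
    also have "\<dots> = c * (2 / tau) ^ i * fact i * Q"
      unfolding Q_def by (rule suminf_mult[OF summable_exp_freq])
    also have "\<dots> \<le> c * (2 / tau) ^ i * (fact i)\<^sup>2 * Q"
    proof (intro mult_right_mono mult_left_mono)
      have "fact i * 1 \<le> (fact i * fact i :: real)" by (intro mult_left_mono fact_ge_1) auto
      then show "fact i \<le> (fact i :: real)\<^sup>2" by (simp add: power2_eq_square)
    qed (use c Q tau in auto)
    finally show "\<bar>trace z i t\<bar> \<le> c * Q * (2 / tau) ^ i * (fact i)\<^sup>2"
      by (simp only: mult_ac)
  qed
qed

lemma tame_power:
  assumes "\<And>k. \<bar>d k\<bar> \<le> c"
  shows "tame (\<lambda>k. d k * (- m k) ^ n)"
  unfolding tame_def
proof (intro exI[of _ "\<bar>c\<bar> * fact n"] conjI allI)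
  fix k
  have "\<bar>d k * (- m k) ^ n\<bar> = \<bar>d k\<bar> * m k ^ n"
    using m_pos[of k] by (simp add: abs_mult power_abs)
  also have "\<dots> \<le> \<bar>c\<bar> * (fact n * exp (m k))"
    using assms[of k] m_pos[of k] by (intro mult_mono power_exp_le_fact) auto
  finally show "\<bar>d k * (- m k) ^ n\<bar> \<le> \<bar>c\<bar> * fact n * exp (m k)" by (simp add: mult.assoc)
qed simp

text \<open>
  For a single mode the \<open>n\<close>-th coefficient is \<open>(- m k) ^ n\<close> times the zeroth one. This is consistent with
  the recursion because \<open>(m k)\<^sup>2 = nu k + lam * m k\<close>.
\<close>
lemma jet_of_traces:
  assumes d: "\<And>k. \<bar>d k\<bar> \<le> c" and t: "t > 0"
  shows "jet lam (trace (\<lambda>k. d k * (- m k) ^ 0)) (trace (\<lambda>k. d k * (- m k) ^ Suc 0)) n i t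
    = trace (\<lambda>k. d k * (- m k) ^ n) i t"
proof (induction n arbitrary: i rule: induct_nat_012)
  case (ge2 n)
  note s = trace_summable[OF tame_power[where d = d, OF d] t]
  have "trace (\<lambda>k. d k * (- m k) ^ Suc (Suc n)) i t =
      (\<Sum>k. - (d k * (- m k) ^ n * (- nu k) ^ Suc i * exp (- nu k * t)) - lam * (d k * (- m k) ^ Suc n * (- nu k) ^ i * exp (- nu k * t)))"
    unfolding trace_def
  proof (rule suminf_cong)
    fix k
    have "(- m k) * (- m k) = nu k + lam * m k" by (simp add: nu_def algebra_simps)
    then have "d k * (- m k) ^ Suc (Suc n) * (- nu k) ^ i * exp (- nu k * t) =
        d k * ((nu k + lam * m k) * (- m k) ^ n) * (- nu k) ^ i * exp (- nu k * t)"
      by (simp only: power_Suc mult.assoc[symmetric])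
    then show "d k * (- m k) ^ Suc (Suc n) * (- nu k) ^ i * exp (- nu k * t) =
        - (d k * (- m k) ^ n * (- nu k) ^ Suc i * exp (- nu k * t)) - lam * (d k * (- m k) ^ Suc n * (- nu k) ^ i * exp (- nu k * t))"
      by (simp add: algebra_simps)
  qed
  also have "\<dots> = - trace (\<lambda>k. d k * (- m k) ^ n) (Suc i) t - lam * trace (\<lambda>k. d k * (- m k) ^ Suc n) i t"
    unfolding trace_def using s[of n "Suc i"] s[of "Suc n" i] by (rule suminf_minus_diff_mult)
  finally show ?case using ge2 by simp
qed simp_all

text \<open>
  Interchange of the expansion in modes with the Taylor expansion in \<open>x\<close>. The double series converges
  absolutely, since the Taylor series of the \<open>k\<close>-th mode is at most \<open>exp (L\<^sup>2 * m k)\<close>.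
\<close>
lemma free_series:
  assumes d: "\<And>k. \<bar>d k\<bar> \<le> c" and t: "t > 0" and w: "\<And>n. \<bar>w n\<bar> \<le> c' * (L ^ (2 * n) / fact (2 * n))"
  shows "(\<Sum>n. trace (\<lambda>k. d k * (- m k) ^ n) 0 t * w n) = (\<Sum>k. d k * exp (- nu k * t) * (\<Sum>n. (- m k) ^ n * w n))"
proof -
  define f where "f n k = d k * (- m k) ^ n * exp (- nu k * t) * w n" for n k
  have c: "c \<ge> 0" using d[of 0] by linarith
  have c': "c' \<ge> 0" using w[of 0] by simp
  have wb: "\<bar>(- m k) ^ n * w n\<bar> \<le> c' * ((L\<^sup>2 * m k) ^ n / fact n)" for n k
  proof -
    have "\<bar>(- m k) ^ n * w n\<bar> = m k ^ n * \<bar>w n\<bar>" using m_pos[of k] by (simp add: abs_mult power_abs)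
    also have "\<dots> \<le> m k ^ n * (c' * (L ^ (2 * n) / fact (2 * n)))"
      using m_pos[of k] by (intro mult_left_mono w) auto
    also have "\<dots> \<le> m k ^ n * (c' * (L ^ (2 * n) / fact n))"
      using m_pos[of k] c' L by (intro mult_left_mono divide_left_mono fact_mono) auto
    also have "\<dots> = c' * ((L\<^sup>2 * m k) ^ n / fact n)" by (simp add: power_mult_distrib power_mult)
    finally show ?thesis .
  qed
  have ssum: "(\<lambda>n. (L\<^sup>2 * m k) ^ n / fact n) sums exp (L\<^sup>2 * m k)" for k
    using exp_converges[of "L\<^sup>2 * m k"] by (simp add: scaleR_conv_of_real divide_inverse mult.commute)
  have wsum: "summable (\<lambda>n. \<bar>(- m k) ^ n * w n\<bar>)" for k
    by (rule summable_comparison_test'[OF summable_mult[OF sums_summable[OF ssum[of k]], of c'], of 0]) (use wb in simp)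
  have wle: "(\<Sum>n. \<bar>(- m k) ^ n * w n\<bar>) \<le> c' * exp (L\<^sup>2 * m k)" for k
    using suminf_le[OF wb wsum[of k] summable_mult[OF sums_summable[OF ssum[of k]]]]
      suminf_mult[OF sums_summable[OF ssum[of k]], of c'] sums_unique[OF ssum[of k]] by simp
  have fabs: "\<bar>f n k\<bar> = \<bar>d k\<bar> * exp (- nu k * t) * \<bar>(- m k) ^ n * w n\<bar>" for n k
    by (simp add: f_def abs_mult)
  have f1: "summable (\<lambda>n. \<bar>f n k\<bar>)" for k
    unfolding fabs by (intro summable_mult wsum)
  obtain C where C: "C \<ge> 0" "\<And>s k. t \<le> s \<Longrightarrow> s \<le> t \<Longrightarrow> exp (- nu k * s + L\<^sup>2 * m k) \<le> C * exp (- freq L k)"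
    by (rule heat_decay[of t "L\<^sup>2" t]) (use t in auto)
  have f2: "summable (\<lambda>k. \<Sum>n. \<bar>f n k\<bar>)"
  proof (rule summable_comparison_test'[OF summable_mult[OF summable_exp_freq, of "c * c' * C"], of 0])
    fix k
    have "(\<Sum>n. \<bar>f n k\<bar>) = \<bar>d k\<bar> * exp (- nu k * t) * (\<Sum>n. \<bar>(- m k) ^ n * w n\<bar>)"
      unfolding fabs by (rule suminf_mult[OF wsum])
    also have "\<dots> \<le> c * exp (- nu k * t) * (c' * exp (L\<^sup>2 * m k))"
      using d[of k] c wle[of k] by (intro mult_mono mult_right_mono) (auto intro!: suminf_nonneg wsum)
    also have "\<dots> = c * c' * exp (- nu k * t + L\<^sup>2 * m k)" by (simp only: exp_add mult_ac)
    also have "\<dots> \<le> c * c' * (C * exp (- freq L k))"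
      using c c' by (intro mult_left_mono C) auto
    finally have "(\<Sum>n. \<bar>f n k\<bar>) \<le> c * c' * C * exp (- freq L k)" by (simp add: mult.assoc)
    moreover have "0 \<le> (\<Sum>n. \<bar>f n k\<bar>)" by (rule suminf_nonneg[OF f1]) simp
    ultimately show "norm (\<Sum>n. \<bar>f n k\<bar>) \<le> c * c' * C * exp (- freq L k)" by simp
  qed
  have "(\<Sum>n. trace (\<lambda>k. d k * (- m k) ^ n) 0 t * w n) = (\<Sum>n. \<Sum>k. f n k)"
  proof (rule suminf_cong)
    fix n
    have "trace (\<lambda>k. d k * (- m k) ^ n) 0 t * w n = (\<Sum>k. d k * (- m k) ^ n * (- nu k) ^ 0 * exp (- nu k * t) * w n)"
      unfolding trace_def by (rule suminf_mult2[OF trace_summable[OF tame_power[where d = d, OF d] t]])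
    then show "trace (\<lambda>k. d k * (- m k) ^ n) 0 t * w n = (\<Sum>k. f n k)" by (simp add: f_def)
  qed
  also have "\<dots> = (\<Sum>k. \<Sum>n. f n k)" by (rule suminf_swap_real[OF f1 f2])
  also have "\<dots> = (\<Sum>k. d k * exp (- nu k * t) * (\<Sum>n. (- m k) ^ n * w n))"
  proof (rule suminf_cong)
    fix k
    have "(\<Sum>n. f n k) = (\<Sum>n. (d k * exp (- nu k * t)) * ((- m k) ^ n * w n))"
      by (simp only: f_def mult_ac)
    also have "\<dots> = d k * exp (- nu k * t) * (\<Sum>n. (- m k) ^ n * w n)"
      by (rule suminf_mult[OF summable_rabs_cancel[OF wsum]])
    finally show "(\<Sum>n. f n k) = d k * exp (- nu k * t) * (\<Sum>n. (- m k) ^ n * w n)" .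
  qed
  finally show ?thesis .
qed

text \<open>
  The integrals of the monomials of the expansion at \<open>x = L\<close> against the \<open>k\<close>-th eigenfunction.
\<close>
definition W :: "nat \<Rightarrow> nat \<Rightarrow> real" where
  "W k n = integral {0..L} (\<lambda>x. (x - L) ^ (2 * n) / fact (2 * n) * sin (freq L k * x))"

lemma W_bound: "\<bar>W k n\<bar> \<le> L * (L ^ (2 * n) / fact (2 * n))"
proof -
  have "\<bar>W k n\<bar> \<le> integral {0..L} (\<lambda>x. L ^ (2 * n) / fact (2 * n))"
    unfolding W_def real_norm_def[symmetric]
  proof (rule integral_norm_bound_integral)
    show "(\<lambda>x. (x - L) ^ (2 * n) / fact (2 * n) * sin (freq L k * x)) integrable_on {0..L}"
      by (intro integrable_continuous_real continuous_intros) auto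
    show "(\<lambda>x. L ^ (2 * n) / fact (2 * n)) integrable_on {0..L}" by (rule integrable_const_ivl)
    fix x assume x: "x \<in> {0..L}"
    have "\<bar>x - L\<bar> ^ (2 * n) * \<bar>sin (freq L k * x)\<bar> \<le> L ^ (2 * n) * 1"
      using x L by (intro mult_mono power_mono) auto
    then show "norm ((x - L) ^ (2 * n) / fact (2 * n) * sin (freq L k * x)) \<le> L ^ (2 * n) / fact (2 * n)"
      by (simp add: abs_mult power_abs divide_right_mono)
  qed
  also have "\<dots> = L * (L ^ (2 * n) / fact (2 * n))" using L by simp
  finally show ?thesis .
qed

lemma W_0: "W k 0 = 1 / freq L k"
proof -
  have "integral {0..L} (\<lambda>x. sin (freq L k * x)) = - cos (freq L k * L) / freq L k - - cos (freq L k * 0) / freq L k"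
    by (rule integral_FTC) (use L freq_pos[OF L, of k] in \<open>auto intro!: derivative_eq_intros\<close>)
  then show ?thesis using L by (simp add: W_def)
qed

lemma W_Suc: "W k n = freq L k * (L ^ (2 * Suc n) / fact (2 * Suc n)) - m k * W k (Suc n)"
proof -
  define p where "p j x = (x - L) ^ j / fact j" for j x
  have p: "((\<lambda>x. p (Suc j) x) has_real_derivative p j x) (at x within A)" for j x A
    unfolding p_def by (auto intro!: derivative_eq_intros simp del: power_Suc fact_Suc) (simp add: fact_Suc)
  have "integral {0..L} (\<lambda>x. p (2 * n) x * sin (freq L k * x)) =
      freq L k * p (Suc (Suc (2 * n))) 0 - m k * integral {0..L} (\<lambda>x. p (Suc (Suc (2 * n))) x * sin (freq L k * x))"
    by (rule integral_second_derivative_sine[OF L p p]) (auto simp: p_def intro!: continuous_intros)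
  then show ?thesis by (simp add: W_def p_def)
qed

lemma cos_series_at_freq: "(\<Sum>n. (- m k) ^ n * (L ^ (2 * n) / fact (2 * n))) = 0"
proof -
  have "(\<lambda>n. (- 1) ^ n / fact (2 * n) * (freq L k * L) ^ (2 * n)) sums cos (freq L k * L)"
    by (rule cos_paired)
  moreover have "(- 1) ^ n / fact (2 * n) * (freq L k * L) ^ (2 * n) = (- m k) ^ n * (L ^ (2 * n) / fact (2 * n))" for n
    by (subst power_minus[of "m k"]) (simp add: power_mult_distrib power_mult)
  ultimately show ?thesis using L sums_unique by fastforce
qed

text \<open>
  The Taylor series of \<open>cos (mu (x - L))\<close>, which up to the sign \<open>sin (mu L)\<close> is \<open>sin (mu x)\<close>, integrated
  term by term; what remains is the orthogonality of the eigenfunctions.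
\<close>
lemma W_series: "(\<Sum>n. (- m j) ^ n * W k n) = (if j = k then sin (freq L k * L) * (L / 2) else 0)"
proof -
  define g where "g n x = (- m j) ^ n * ((x - L) ^ (2 * n) / fact (2 * n) * sin (freq L k * x))" for n x
  have gs: "(\<lambda>n. g n x) sums (cos (freq L j * (x - L)) * sin (freq L k * x))" for x
  proof -
    have "(\<lambda>n. (- 1) ^ n / fact (2 * n) * (freq L j * (x - L)) ^ (2 * n)) sums cos (freq L j * (x - L))"
      by (rule cos_paired)
    from sums_mult2[OF this, of "sin (freq L k * x)"]
    have "(\<lambda>n. (- 1) ^ n / fact (2 * n) * (freq L j * (x - L)) ^ (2 * n) * sin (freq L k * x)) sums
        (cos (freq L j * (x - L)) * sin (freq L k * x))" .
    moreover have "(- 1) ^ n / fact (2 * n) * (freq L j * (x - L)) ^ (2 * n) * sin (freq L k * x) = g n x" for n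
      unfolding g_def by (subst power_minus[of "m j"]) (simp add: power_mult_distrib power_mult)
    ultimately show ?thesis by simp
  qed
  have gb: "norm (g n x) \<le> (m j * L\<^sup>2) ^ n / fact n" if x: "x \<in> {0..L}" for n x
  proof -
    have "norm (g n x) = m j ^ n * (\<bar>x - L\<bar> ^ (2 * n) / fact (2 * n) * \<bar>sin (freq L k * x)\<bar>)"
      using m_pos[of j] by (simp add: g_def abs_mult power_abs)
    also have "\<dots> \<le> m j ^ n * (L ^ (2 * n) / fact n * 1)"
      using m_pos[of j] x L by (intro mult_left_mono mult_mono frac_le power_mono fact_mono) auto
    also have "\<dots> = (m j * L\<^sup>2) ^ n / fact n" by (simp add: power_mult_distrib power_mult)
    finally show ?thesis .
  qed
  have gsum: "summable (\<lambda>n. (m j * L\<^sup>2) ^ n / fact n)"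
    using summable_exp_generic[of "m j * L\<^sup>2"] by (simp add: scaleR_conv_of_real divide_inverse mult.commute)
  have gc: "continuous_on {0..L} (g n)" for n unfolding g_def by (intro continuous_intros) auto
  have ul: "uniform_limit {0..L} (\<lambda>N x. \<Sum>n<N. g n x) (\<lambda>x. suminf (\<lambda>n. g n x)) sequentially"
    by (rule Weierstrass_m_test[OF gb gsum])
  obtain I J where IJ: "\<And>N. ((\<lambda>x. \<Sum>n<N. g n x) has_integral I N) {0..L}"
      "((\<lambda>x. suminf (\<lambda>n. g n x)) has_integral J) {0..L}" "I \<longlonglongrightarrow> J"
    by (rule uniform_limit_integral[OF ul]) (auto intro!: continuous_intros gc)
  have "integral {0..L} (g n) = (- m j) ^ n * W k n" for n
    by (simp add: g_def[abs_def] W_def)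
  moreover have "(g n has_integral integral {0..L} (g n)) {0..L}" for n
    by (intro integrable_integral integrable_continuous_real gc)
  ultimately have gi: "(g n has_integral ((- m j) ^ n * W k n)) {0..L}" for n by simp
  have "I = (\<lambda>N. \<Sum>n<N. (- m j) ^ n * W k n)"
  proof (rule ext, rule has_integral_unique[OF IJ(1)])
    fix N
    show "((\<lambda>x. \<Sum>n<N. g n x) has_integral (\<Sum>n<N. (- m j) ^ n * W k n)) {0..L}"
      by (rule has_integral_sum[OF finite_lessThan]) (rule gi)
  qed
  then have "(\<lambda>n. (- m j) ^ n * W k n) sums J"
    using IJ(3) by (simp only: sums_def)
  then have "(\<Sum>n. (- m j) ^ n * W k n) = J" by (rule sums_unique[symmetric])
  also have "J = integral {0..L} (\<lambda>x. suminf (\<lambda>n. g n x))"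
    using IJ(2) by (rule integral_unique[symmetric])
  also have "(\<lambda>x. suminf (\<lambda>n. g n x)) = (\<lambda>x. sin (freq L j * L) * (sin (freq L j * x) * sin (freq L k * x)))"
  proof
    fix x
    have "suminf (\<lambda>n. g n x) = cos (freq L j * (x - L)) * sin (freq L k * x)"
      using gs by (rule sums_unique[symmetric])
    also have "cos (freq L j * (x - L)) = sin (freq L j * L) * sin (freq L j * x)"
      using L by (simp add: right_diff_distrib cos_diff)
    finally show "suminf (\<lambda>n. g n x) = sin (freq L j * L) * (sin (freq L j * x) * sin (freq L k * x))" by simp
  qed
  also have "integral {0..L} (\<lambda>x. sin (freq L j * L) * (sin (freq L j * x) * sin (freq L k * x))) =
      sin (freq L j * L) * integral {0..L} (\<lambda>x. sin (freq L j * x) * sin (freq L k * x))"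
    by simp
  also have "integral {0..L} (\<lambda>x. sin (freq L j * x) * sin (freq L k * x)) = (if j = k then L / 2 else 0)"
    using inner_mode_mode[OF L, of j k] L by (simp add: ortho field_simps split: if_splits)
  finally show ?thesis by simp
qed

lemma sin_freq_sq: "sin (freq L k * L) * sin (freq L k * L) = 1"
  using sin_cos_squared_add[of "freq L k * L"] L by (simp add: power2_eq_square)

end

section \<open>Controls from flat outputs\<close>

text \<open>
  Controls are switched on only after time \<open>0\<close>. Then the initial datum needs no correction, and
  convolutions with a control or its derivative depend continuously on time.
\<close>
definition control :: "(real \<Rightarrow> real) \<Rightarrow> (real \<Rightarrow> real) \<Rightarrow> bool" where
  "control u u' \<longleftrightarrow> (\<forall>t. (u has_real_derivative u' t) (at t)) \<and> continuous_on UNIV u' \<and>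
     (\<forall>t\<le>0. u t = 0 \<and> u' t = 0)"

lemma controlD:
  assumes "control u u'"
  shows "(u has_real_derivative u' t) (at t)" "continuous_on A u" "continuous_on A u'"
    "t \<le> 0 \<Longrightarrow> u t = 0" "t \<le> 0 \<Longrightarrow> u' t = 0"
proof -
  show d: "(u has_real_derivative u' t) (at t)" for t using assms by (simp add: control_def)
  show "continuous_on A u" using d by (intro continuous_at_imp_continuous_on ballI DERIV_isCont)
  show "continuous_on A u'" using assms unfolding control_def by (blast intro: continuous_on_subset)
qed (use assms in \<open>auto simp: control_def\<close>)

lemma glue_zero:
  fixes f f' :: "real \<Rightarrow> real"
  assumes I: "open I" and A: "open A" and cover: "I \<union> A = UNIV"
    and d: "\<And>t. t \<in> I \<Longrightarrow> (f has_real_derivative f' t) (at t)" and c: "continuous_on I f'"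
    and z: "\<And>t. t \<in> I \<Longrightarrow> t \<in> A \<Longrightarrow> f t = 0"
  defines "g \<equiv> \<lambda>t. if t \<in> I then f t else 0" and "g' \<equiv> \<lambda>t. if t \<in> I then f' t else 0"
  shows "(g has_real_derivative g' t) (at t)" "continuous_on UNIV g'" "t \<in> A \<Longrightarrow> g t = 0" "t \<in> A \<Longrightarrow> g' t = 0"
proof -
  have gA: "g t = 0" if "t \<in> A" for t using that z by (auto simp: g_def)
  have zero: "(g has_real_derivative 0) (at t)" if "t \<in> A" for t
    by (rule has_field_derivative_transform_within_open[OF DERIV_const A that]) (simp add: gA)
  have onI: "(g has_real_derivative g' t) (at t)" if "t \<in> I" for t
  proof -
    have "(g has_real_derivative f' t) (at t)"
      by (rule has_field_derivative_transform_within_open[OF d[OF that] I that]) (simp add: g_def)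
    then show ?thesis using that by (simp add: g'_def)
  qed
  have g'A: "g' t = 0" if "t \<in> A" for t
  proof (cases "t \<in> I")
    case True
    show ?thesis using onI[OF True] zero[OF that] by (rule DERIV_unique)
  qed (simp add: g'_def)
  show "(g has_real_derivative g' t) (at t)"
  proof (cases "t \<in> I")
    case True
    then show ?thesis by (rule onI)
  next
    case False
    then have "t \<in> A" using cover by blast
    then show ?thesis using zero g'A by metis
  qed
  show "t \<in> A \<Longrightarrow> g t = 0" "t \<in> A \<Longrightarrow> g' t = 0" by (simp_all add: gA g'A)
  have "continuous_on (I \<union> A) g'"
  proof (rule continuous_on_open_Un[OF I A])
    show "continuous_on I g'"
      by (rule continuous_on_cong[THEN iffD1, OF refl _ c]) (simp add: g'_def)
    show "continuous_on A g'"
      by (rule continuous_on_cong[THEN iffD1, OF refl _ continuous_on_const[of _ 0]]) (simp add: g'A)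
  qed
  then show "continuous_on UNIV g'" by (simp only: cover)
qed

context KS_spectrum
begin

text \<open>
  The controls are the boundary values at \<open>x = 0\<close> of the formal solution whose two traces at \<open>x = L\<close> are
  those of the uncontrolled solution multiplied by the cutoff. As long as the cutoff equals 1 this is
  the uncontrolled solution, and the controls vanish. Once the cutoff is 0 the solution vanishes. In
  between, the balance law governs every Fourier coefficient, and integrating it over this period
  gives the stated equation.
\<close>
lemma flat_controls:
  fixes a :: "nat \<Rightarrow> real"
  assumes a: "\<And>k. \<bar>a k\<bar> \<le> c" and T: "T > 0"
  obtains u1 u1' u2 u2' where "control u1 u1'" "control u2 u2'"
    "\<And>k. a k + sqrt (2 / L) * freq L k * integral {0..T} (\<lambda>s. exp (nu k * s) * ((m k - lam) * u1 s - u2 s)) = 0"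
proof -
  \<comment> \<open>The sine, which is \<open>\<plusminus>1\<close>, is the value of the eigenfunction at \<open>x = L\<close>.\<close>
  define d where "d k = sin (freq L k * L) * sqrt (2 / L) * a k" for k
  have d: "\<bar>d k\<bar> \<le> sqrt (2 / L) * c" for k
  proof -
    have "\<bar>d k\<bar> = \<bar>sin (freq L k * L)\<bar> * (sqrt (2 / L) * \<bar>a k\<bar>)" using L by (simp add: d_def abs_mult)
    also have "\<dots> \<le> 1 * (sqrt (2 / L) * c)" using L a[of k] by (intro mult_mono) auto
    finally show ?thesis by simp
  qed
  define z where "z n k = d k * (- m k) ^ n" for n k
  have tz: "tame (z n)" for n unfolding z_def by (rule tame_power[OF d])
  obtain Th where Th: "gevrey UNIV Th" "\<And>t. t \<le> T / 2 \<Longrightarrow> Th 0 t = 1" "\<And>t. t \<ge> 3 * T / 4 \<Longrightarrow> Th 0 t = 0"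
    using gevrey_cutoff[of "T / 2" "3 * T / 4"] T by auto
  \<comment> \<open>The traces are smooth only for positive times; \<open>T\<close> has to be an interior point.\<close>
  define I where "I = {T / 8<..<2 * T}"
  have gz: "gevrey I (trace (z n))" for n
    unfolding I_def by (rule trace_gevrey[OF tz]) (use T in simp)
  have gTh: "gevrey I Th" using Th(1) by (rule gevrey_subset) simp
  define D where "D = leibniz Th (trace (z 0))"
  define E where "E = leibniz Th (trace (z (Suc 0)))"
  have gD: "gevrey I D" and gE: "gevrey I E" unfolding D_def E_def by (intro gevrey_mult gTh gz)+
  interpret flat_system lam L D E I
    by unfold_locales (use gD gE lam L in \<open>auto simp: I_def\<close>)
  have Dd: "(F n has_real_derivative F (Suc n) t) (at t)" if "gevrey I F" "t \<in> I" for F n t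
    using that by (auto simp: gevrey_def)
  define I1 where "I1 = {T / 8<..<T / 2}"
  define I2 where "I2 = {3 * T / 4<..<2 * T}"
  have I12: "I1 \<subseteq> I" "I2 \<subseteq> I" "open I1" "open I2" using T by (auto simp: I1_def I2_def I_def)
  have early: "leibniz Th (trace (z p)) i t = trace (z p) i t" if "t \<in> I1" for p i t
  proof (rule derivative_towers_agree[where I = I1 and D = "leibniz Th (trace (z p))" and E = "trace (z p)"])
    show "leibniz Th (trace (z p)) 0 t = trace (z p) 0 t" if "t \<in> I1" for t
      using that Th(2)[of t] by (simp add: leibniz_def I1_def)
  qed (use that I12 Dd[OF gevrey_mult[OF gTh gz]] Dd[OF gz] in blast)+
  have late: "leibniz Th (trace (z p)) i t = 0" if "t \<in> I2" for p i t
  proof -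
    have "leibniz Th (trace (z p)) i t = 0"
    proof (rule derivative_towers_agree[where E = "\<lambda>n t. 0" and I = I2 and D = "leibniz Th (trace (z p))"])
      show "leibniz Th (trace (z p)) 0 t = 0" if "t \<in> I2" for t
        using that Th(3)[of t] by (simp add: leibniz_def I2_def)
    qed (use that I12 Dd[OF gevrey_mult[OF gTh gz]] in \<open>auto intro!: derivative_eq_intros\<close>)
    then show ?thesis by simp
  qed
  have jet_early: "jet lam D E n 0 t = trace (z n) 0 t" if "t \<in> I1" for n t
  proof -
    have "jet lam D E n 0 t = jet lam (trace (z 0)) (trace (z (Suc 0))) n 0 t"
      by (rule jet_cong) (simp_all add: D_def E_def early that)
    also have "\<dots> = trace (z n) 0 t"
      unfolding z_def[abs_def] by (rule jet_of_traces[OF d]) (use that T in \<open>auto simp: I1_def\<close>)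
    finally show ?thesis .
  qed
  have jet_late: "jet lam D E n i t = 0" if "t \<in> I2" for n i t
    by (induction n arbitrary: i rule: induct_nat_012) (simp_all add: D_def E_def late that)
  have series_late: "series p 0 w t = 0" if "t \<in> I2" for p w t
    by (simp add: series_def jet_late that)
  have series_early: "series 0 0 w t = (\<Sum>k. d k * exp (- nu k * t) * (\<Sum>n. (- m k) ^ n * w n))"
    if t: "t \<in> I1" and w: "\<And>n. \<bar>w n\<bar> \<le> c' * (L ^ (2 * n) / fact (2 * n))" for w t c'
  proof -
    have "series 0 0 w t = (\<Sum>n. trace (\<lambda>k. d k * (- m k) ^ n) 0 t * w n)"
      using jet_early[OF t] by (simp add: series_def z_def[abs_def])
    also have "\<dots> = (\<Sum>k. d k * exp (- nu k * t) * (\<Sum>n. (- m k) ^ n * w n))"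
      by (rule free_series[OF d _ w]) (use t T in \<open>auto simp: I1_def\<close>)
    finally show ?thesis .
  qed
  have wW: "weight (W k)" for k
    unfolding weight_def q_def using W_bound[of k] L by (intro exI[of _ L]) simp
  define e where "e k = sqrt (2 / L) * (L / 2) * a k" for k
  have Y_early: "series 0 0 (W k) t = e k * exp (- nu k * t)" if t: "t \<in> I1" for k t
  proof -
    have "series 0 0 (W k) t = (\<Sum>j. d j * exp (- nu j * t) * (if j = k then sin (freq L k * L) * (L / 2) else 0))"
      unfolding series_early[OF t W_bound] W_series ..
    also have "\<dots> = (\<Sum>j\<in>{k}. d j * exp (- nu j * t) * (if j = k then sin (freq L k * L) * (L / 2) else 0))"
      by (rule suminf_finite) auto
    also have "\<dots> = (sin (freq L k * L) * sin (freq L k * L)) * e k * exp (- nu k * t)"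
      by (simp add: d_def e_def mult_ac)
    finally show ?thesis by (simp only: sin_freq_sq mult_1_left)
  qed
  have q_early: "series 0 0 q t = 0" if t: "t \<in> I1" for t
  proof -
    have "\<bar>q n\<bar> \<le> 1 * (L ^ (2 * n) / fact (2 * n))" for n using L by (simp add: q_def)
    from series_early[OF t this] show ?thesis
      unfolding q_def cos_series_at_freq by simp
  qed
  have balance: "series 0 1 (W k) t = - nu k * series 0 0 (W k) t + freq L k * ((m k - lam) * series 0 0 q t - series 1 0 q t)"
    if "t \<in> I" for k t
    unfolding nu_def
  proof (rule series_balance[OF wW that _ refl])
    show "freq L k \<noteq> 0" using freq_pos[OF L, of k] by simp
    show "W k 0 = 1 / freq L k" by (rule W_0)
    show "W k n = freq L k * q (Suc n) - m k * W k (Suc n)" for n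
      unfolding q_def by (rule W_Suc)
  qed
  \<comment> \<open>All other terms of the balance law for a free mode cancel, so the second control vanishes too.\<close>
  have q1_early: "series 1 0 q t = 0" if t: "t \<in> I1" for t
  proof -
    have tI: "t \<in> I" using t I12 by blast
    have "((\<lambda>t. e 0 * exp (- nu 0 * t)) has_real_derivative - nu 0 * (e 0 * exp (- nu 0 * t))) (at t)"
      by (auto intro!: derivative_eq_intros)
    then have "(series 0 0 (W 0) has_real_derivative - nu 0 * (e 0 * exp (- nu 0 * t))) (at t)"
      by (rule has_field_derivative_transform_within_open[OF _ I12(3) t]) (simp add: Y_early)
    from DERIV_unique[OF series_deriv[OF wW tI, of 0] this]
    have "series 0 1 (W 0) t = - nu 0 * series 0 0 (W 0) t" by (simp add: Y_early[OF t])
    then have "freq L 0 * series 1 0 q t = 0"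
      using balance[OF tI, of 0] q_early[OF t] by simp
    then show ?thesis using freq_pos[OF L, of 0] by simp
  qed
  define A where "A = {..<T / 2} \<union> {3 * T / 4<..}"
  have A: "open A" "I \<union> A = UNIV" "\<And>t. t \<in> I \<Longrightarrow> t \<in> A \<Longrightarrow> t \<in> I1 \<or> t \<in> I2"
    using T by (auto simp: A_def I_def I1_def I2_def)
  have z0: "series p 0 q t = 0" if "t \<in> I" "t \<in> A" "p \<le> 1" for p t
    using A(3)[OF that(1,2)] that(3) q_early q1_early series_late by (cases p) auto
  define u where "u p t = (if t \<in> I then series p 0 q t else 0)" for p t
  define u' where "u' p t = (if t \<in> I then series p 1 q t else 0)" for p t
  have u: "(u p has_real_derivative u' p t) (at t)" "continuous_on UNIV (u' p)"
      "t \<in> A \<Longrightarrow> u p t = 0" "t \<in> A \<Longrightarrow> u' p t = 0" if "p \<le> 1" for p t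
  proof -
    note g = glue_zero[OF I(1) A(1,2) series_deriv[OF weight_q _ that] series_deriv_continuous[OF weight_q that] z0[OF _ _ that]]
    have e: "u p = (\<lambda>t. if t \<in> I then series p 0 q t else 0)" "u' p = (\<lambda>t. if t \<in> I then series p 1 q t else 0)"
      by (rule ext, rule u_def) (rule ext, rule u'_def)
    show "(u p has_real_derivative u' p t) (at t)" unfolding e by (rule g(1))
    show "continuous_on UNIV (u' p)" unfolding e by (rule g(2))
    show "t \<in> A \<Longrightarrow> u p t = 0" unfolding e by (rule g(3))
    show "t \<in> A \<Longrightarrow> u' p t = 0" unfolding e by (rule g(4))
  qed
  have negA: "t \<in> A" if "t \<le> T / 4" for t using that T by (auto simp: A_def)
  have moment: "a k + sqrt (2 / L) * freq L k * integral {0..T} (\<lambda>s. exp (nu k * s) * ((m k - lam) * u 0 s - u 1 s)) = 0" for k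
  proof -
    let ?g = "\<lambda>s. exp (nu k * s) * ((m k - lam) * u 0 s - u 1 s)"
    let ?F = "\<lambda>s. exp (nu k * s) * series 0 0 (W k) s"
    have "((\<lambda>s. freq L k * ?g s) has_integral (?F T - ?F (T / 4))) {T / 4..T}"
    proof (rule fundamental_theorem_of_calculus)
      show "T / 4 \<le> T" using T by simp
      fix s assume s: "s \<in> {T / 4..T}"
      then have sI: "s \<in> I" using T by (auto simp: I_def)
      have "((\<lambda>s. exp (nu k * s)) has_real_derivative nu k * exp (nu k * s)) (at s)"
        by (auto intro!: derivative_eq_intros)
      from DERIV_mult[OF this series_deriv[OF wW sI, of 0 k]]
      have "(?F has_real_derivative nu k * exp (nu k * s) * series 0 0 (W k) s + series 0 1 (W k) s * exp (nu k * s)) (at s)"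
        by simp
      also have "nu k * exp (nu k * s) * series 0 0 (W k) s + series 0 1 (W k) s * exp (nu k * s) = freq L k * ?g s"
        unfolding balance[OF sI] using sI by (simp add: u_def algebra_simps)
      finally show "(?F has_vector_derivative freq L k * ?g s) (at s within {T / 4..T})"
        unfolding has_real_derivative_iff_has_vector_derivative by (rule has_vector_derivative_at_within)
    qed
    moreover have "?F T = 0" using series_late[of T 0 "W k"] T by (simp add: I2_def)
    moreover have "?F (T / 4) = e k"
      using Y_early[of "T / 4" k] T by (simp add: I1_def exp_minus field_simps)
    ultimately have 1: "((\<lambda>s. freq L k * ?g s) has_integral - e k) {T / 4..T}" by simp
    have "((\<lambda>s. freq L k * ?g s) has_integral 0) {0..T / 4}"
    proof (rule has_integral_is_0)
      fix s assume "s \<in> {0..T / 4}"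
      then have "u 0 s = 0" "u 1 s = 0" using u(3)[OF _ negA, of 0 s] u(3)[OF _ negA, of 1 s] by auto
      then show "freq L k * ?g s = 0" by simp
    qed
    from has_integral_combine[OF _ _ this 1] have "((\<lambda>s. freq L k * ?g s) has_integral - e k) {0..T}"
      using T by simp
    then have "integral {0..T} (\<lambda>s. freq L k * ?g s) = - e k" by (rule integral_unique)
    then have "freq L k * integral {0..T} ?g = - e k" by simp
    moreover have "sqrt (2 / L) * e k = a k"
    proof -
      have "sqrt (2 / L) * sqrt (2 / L) = 2 / L" using L by simp
      then have "sqrt (2 / L) * e k = 2 / L * (L / 2) * a k" by (simp only: e_def mult.assoc[symmetric])
      then show ?thesis using L by simp
    qed
    ultimately show ?thesis by (simp add: mult.assoc)
  qed
  have neg: "t \<in> A" if "t \<le> 0" for t using negA[of t] that T by simp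
  have "control (u p) (u' p)" if "p \<le> 1" for p
    unfolding control_def using u[OF that] neg by blast
  then show thesis
    by (intro that[of "u 0" "u' 0" "u 1" "u' 1"] moment) simp_all
qed

end

section \<open>The controlled solution\<close>

text \<open>
  Classical integration by parts suffices here, as the control is continuously differentiable.
\<close>
lemma control_sobolev:
  assumes u: "control u u'" and T: "T > 0"
  shows "L2_of T u \<in> sobolev 1 T" "weak_deriv T (L2_of T u) = L2_of T u'"
    "t \<in> {0..T} \<Longrightarrow> point_value T (L2_of T u) t = u t"
proof -
  note cu = controlD(2,3)[OF u]
  have wd: "has_weak_deriv T (L2_of T u) (L2_of T u')"
    unfolding has_weak_deriv_iff
  proof (intro conjI allI impI L2_of_continuous_in_L2_on cu)
    fix psi assume psi: "test_function T psi"
    note t = test_function_facts[OF psi]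
    have "integral {0..T} (\<lambda>x. u x * deriv psi x + u' x * psi x) = u T * psi T - u 0 * psi 0"
    proof (rule integral_FTC)
      fix x
      show "((\<lambda>x. u x * psi x) has_real_derivative u x * deriv psi x + u' x * psi x) (at x within {0..T})"
        using has_field_derivative_at_within[OF DERIV_mult[OF controlD(1)[OF u] t(1), of x]]
        by (simp add: mult.commute add.commute)
    qed (use T in simp)
    moreover have "integral {0..T} (\<lambda>x. u x * deriv psi x + u' x * psi x) =
        integral {0..T} (\<lambda>x. u x * deriv psi x) + integral {0..T} (\<lambda>x. u' x * psi x)"
      by (rule integral_add) (intro integrable_continuous_real continuous_intros cu t)+
    ultimately show "inner (L2_of T u) (L2_of T (deriv psi)) = - inner (L2_of T u') (L2_of T psi)"
      using t by (simp add: inner_L2_of_L2_of cu)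
  qed
  show "weak_deriv T (L2_of T u) = L2_of T u'" by (rule weak_deriv_eq[OF wd T])
  show "L2_of T u \<in> sobolev 1 T"
    unfolding One_nat_def sobolev.simps using wd by (auto simp: has_weak_deriv_iff)
  show "t \<in> {0..T} \<Longrightarrow> point_value T (L2_of T u) t = u t"
    by (rule point_value_L2_of[OF T cu(1)])
qed

lemma exp_convolution_by_parts:
  assumes u: "control u u'" and t: "t \<ge> 0"
  shows "integral {0..t} (\<lambda>s. u' s * exp (- n * (t - s))) = u t - n * integral {0..t} (\<lambda>s. u s * exp (- n * (t - s)))"
proof -
  have "integral {0..t} (\<lambda>s. u' s * exp (- n * (t - s)) + n * (u s * exp (- n * (t - s)))) =
      u t * exp (- n * (t - t)) - u 0 * exp (- n * (t - 0))"
  proof (rule integral_FTC[OF t])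
    fix s
    have "((\<lambda>s. exp (- n * (t - s))) has_real_derivative n * exp (- n * (t - s))) (at s)"
      by (auto intro!: derivative_eq_intros)
    from has_field_derivative_at_within[OF DERIV_mult[OF controlD(1)[OF u] this]]
    show "((\<lambda>s. u s * exp (- n * (t - s))) has_real_derivative u' s * exp (- n * (t - s)) + n * (u s * exp (- n * (t - s)))) (at s within {0..t})"
      by (simp add: mult_ac)
  qed
  moreover have "integral {0..t} (\<lambda>s. u' s * exp (- n * (t - s)) + n * (u s * exp (- n * (t - s)))) =
      integral {0..t} (\<lambda>s. u' s * exp (- n * (t - s))) + n * integral {0..t} (\<lambda>s. u s * exp (- n * (t - s)))"
    by (subst integral_add) (auto intro!: integrable_continuous_real continuous_intros controlD(2,3)[OF u])
  ultimately show ?thesis using controlD(4)[OF u] by simp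
qed

lemma smooth_on_deriv:
  assumes "smooth_on L p" "x \<in> {0..L}"
  shows "((deriv_on L ^^ k) p has_real_derivative (deriv_on L ^^ Suc k) p x) (at x within {0..L})"
  using assms vector_derivative_works[of "(deriv_on L ^^ k) p" "at x within {0..L}"]
  by (simp add: smooth_on_def deriv_on_def has_real_derivative_iff_has_vector_derivative)

lemma smooth_on_continuous:
  assumes "smooth_on L p"
  shows "continuous_on {0..L} ((deriv_on L ^^ k) p)"
  using smooth_on_deriv[OF assms] by (rule DERIV_continuous_on)

context KS_spectrum
begin

text \<open>
  The image under the differential operator of a lifting function. As \<open>p\<close> violates the boundary
  conditions at \<open>0\<close>, its coefficients differ from \<open>nu k\<close> times those of \<open>p\<close>; the difference is what turns
  the controls into an input.
\<close>
definition lifted :: "(real \<Rightarrow> real) \<Rightarrow> L2" where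
  "lifted p = L2_of L (\<lambda>x. lam * (deriv_on L ^^ 2) p x + (deriv_on L ^^ 4) p x)"

lemma lifted_coef:
  assumes p: "smooth_on L p" and b: "deriv_on L p L = 0" "(deriv_on L ^^ 3) p L = 0"
  shows "coef (lifted p) k =
    nu k * coef (L2_of L p) k + sqrt (2 / L) * freq L k * ((lam - m k) * p 0 + (deriv_on L ^^ 2) p 0)"
proof -
  note c = smooth_on_continuous[OF p]
  note d = smooth_on_deriv[OF p]
  define I where "I j = integral {0..L} (\<lambda>x. (deriv_on L ^^ j) p x * sin (freq L k * x))" for j
  have 1: "I 2 = freq L k * p 0 - m k * I 0" unfolding I_def funpow_0
    by (rule integral_second_derivative_sine[OF L, where p' = "deriv_on L p"])
      (use d[of _ 0] d[of _ 1] c[of 2] b in \<open>simp_all add: eval_nat_numeral\<close>)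
  have 2: "I 4 = freq L k * (deriv_on L ^^ 2) p 0 - m k * I 2" unfolding I_def
    by (rule integral_second_derivative_sine[OF L, where p' = "(deriv_on L ^^ 3) p"])
      (use d[of _ 2] d[of _ 3] c[of 4] b in \<open>simp_all add: eval_nat_numeral\<close>)
  have "lifted p = lam *\<^sub>R L2_of L ((deriv_on L ^^ 2) p) + L2_of L ((deriv_on L ^^ 4) p)"
    unfolding lifted_def by (subst L2_of_add, intro continuous_intros c, rule c, subst L2_of_scale, rule c) simp
  then have "coef (lifted p) k = sqrt (2 / L) * (lam * I 2 + I 4)"
    by (simp add: inner_add_left inner_mode c I_def distrib_left)
  moreover have "coef (L2_of L p) k = sqrt (2 / L) * I 0"
    using inner_mode[OF c[of 0]] by (simp add: I_def)
  ultimately show ?thesis unfolding 2 1 nu_def by algebra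
qed

definition conv :: "(real \<Rightarrow> real) \<Rightarrow> L2 \<Rightarrow> real \<Rightarrow> L2" where
  "conv om v t = (LINT s:{0..t}|lborel. om s *\<^sub>R S (t - s) v)"

lemma S_shift_continuous: "continuous_on {0..t} (\<lambda>s. S (t - s) v)"
  by (rule continuous_on_compose2[OF S_continuous]) (auto intro!: continuous_intros)

lemma conv_integrable:
  assumes "continuous_on {0..t} om"
  shows "set_integrable lborel {0..t} (\<lambda>s. om s *\<^sub>R S (t - s) v)"
  unfolding set_integrable_def
  by (rule borel_integrable_compact) (auto intro!: continuous_intros assms S_shift_continuous)

lemma conv_coef:
  assumes om: "continuous_on {0..t} om"
  shows "coef (conv om v t) k = coef v k * integral {0..t} (\<lambda>s. om s * exp (- nu k * (t - s)))"
proof -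
  have c: "continuous_on {0..t} (\<lambda>s. om s * exp (- nu k * (t - s)))" by (intro continuous_intros om)
  have "coef (conv om v t) k = (LINT s|lborel. inner (indicator {0..t} s *\<^sub>R om s *\<^sub>R S (t - s) v) (mode L k))"
    unfolding conv_def set_lebesgue_integral_def
    by (rule integral_inner_left[symmetric]) (use conv_integrable[OF om] in \<open>simp add: set_integrable_def\<close>)
  also have "\<dots> = (LINT s|lborel. coef v k * (indicator {0..t} s *\<^sub>R (om s * exp (- nu k * (t - s)))))"
    by (rule Bochner_Integration.integral_cong[OF refl]) (auto simp: indicator_def S_coef)
  also have "\<dots> = coef v k * (LINT s:{0..t}|lborel. om s * exp (- nu k * (t - s)))"
    by (simp add: set_lebesgue_integral_def)
  also have "(LINT s:{0..t}|lborel. om s * exp (- nu k * (t - s))) = integral {0..t} (\<lambda>s. om s * exp (- nu k * (t - s)))"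
    by (rule set_borel_integral_eq_integral(2)[OF set_integrable_continuous_Ioo(1)[OF c]])
  finally show ?thesis .
qed

text \<open>
  \<open>S 0\<close> is the orthogonal projection onto \<open>L\<^sup>2(0,L)\<close>, and it can be moved under the integral.
\<close>
lemma conv_in:
  assumes om: "continuous_on {0..t} om"
  shows "conv om v t \<in> L2_on L"
proof -
  have "S 0 (conv om v t) = (LINT s|lborel. S 0 (indicator {0..t} s *\<^sub>R om s *\<^sub>R S (t - s) v))"
    unfolding conv_def set_lebesgue_integral_def
    by (rule integral_bounded_linear[OF S_bounded_linear, symmetric])
      (use conv_integrable[OF om] in \<open>simp_all add: set_integrable_def\<close>)
  also have "\<dots> = conv om v t"
    unfolding conv_def set_lebesgue_integral_def
    by (rule Bochner_Integration.integral_cong[OF refl]) (auto simp: indicator_def S_scale S_S S_0[OF L2_on_zero])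
  finally show ?thesis using S_in[of 0 "conv om v t"] by simp
qed

text \<open>
  After time reversal, \<open>om\<close> carries the dependence on \<open>t\<close>; since it vanishes for negative arguments the
  domain of integration can be fixed, and dominated convergence applies.
\<close>
lemma conv_continuous:
  assumes om: "continuous_on UNIV om" and neg: "\<And>s. s \<le> 0 \<Longrightarrow> om s = 0"
  shows "continuous_on {0..T} (conv om v)"
proof -
  define h where "h t r = indicator {0..T} r *\<^sub>R (om (t - r) *\<^sub>R S r v)" for t r
  have eq: "conv om v t = (LINT r|lborel. h t r)" if t: "t \<in> {0..T}" for t
  proof -
    have "conv om v t = \<bar>-1\<bar> *\<^sub>R (LINT r|lborel. indicator {0..t} (t + -1 * r) *\<^sub>R om (t + -1 * r) *\<^sub>R S (t - (t + -1 * r)) v)"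
      unfolding conv_def set_lebesgue_integral_def by (rule lborel_integral_real_affine) simp
    also have "\<dots> = (LINT r|lborel. indicator {0..t} (t + -1 * r) *\<^sub>R om (t + -1 * r) *\<^sub>R S (t - (t + -1 * r)) v)"
      by simp
    also have "\<dots> = (LINT r|lborel. h t r)"
    proof (rule Bochner_Integration.integral_cong[OF refl])
      fix r
      show "indicator {0..t} (t + -1 * r) *\<^sub>R om (t + -1 * r) *\<^sub>R S (t - (t + -1 * r)) v = h t r"
        using neg[of "t - r"] t by (cases "r \<le> t") (auto simp: h_def indicator_def)
    qed
    finally show ?thesis .
  qed
  obtain M where M: "M \<ge> 0" "\<And>s. s \<in> {-T..T} \<Longrightarrow> \<bar>om s\<bar> \<le> M"
    using continuous_on_bounded_abs[OF continuous_on_subset[OF om subset_UNIV]] by blast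
  have hc: "continuous_on {0..T} (\<lambda>r. om (t - r) *\<^sub>R S r v)" for t
    by (intro continuous_intros continuous_on_compose2[OF om] continuous_on_subset[OF S_continuous]) auto
  have hm: "h t \<in> borel_measurable lborel" for t
    unfolding h_def using borel_measurable_continuous_on_indicator[OF _ hc[of t]] by simp
  define B where "B = M * (exp (lam\<^sup>2 / 4 * T) * norm v)"
  have hb: "norm (h t r) \<le> B * indicator {0..T} r" if t: "t \<in> {0..T}" for t r
  proof (cases "r \<in> {0..T}")
    case True
    have "norm (S r v) \<le> exp (lam\<^sup>2 / 4 * r) * norm v" using True by (intro S_norm) simp
    also have "\<dots> \<le> exp (lam\<^sup>2 / 4 * T) * norm v" using True by (intro mult_right_mono) (auto intro!: mult_left_mono)
    finally have "\<bar>om (t - r)\<bar> * norm (S r v) \<le> M * (exp (lam\<^sup>2 / 4 * T) * norm v)"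
      using M(2)[of "t - r"] M(1) True t by (intro mult_mono) auto
    then show ?thesis using True by (simp add: h_def B_def)
  qed (simp add: h_def)
  show ?thesis
    unfolding continuous_on_sequentially
  proof (intro allI ballI impI)
    fix x t assume x: "t \<in> {0..T}" "(\<forall>n. x n \<in> {0..T}) \<and> x \<longlonglongrightarrow> t"
    then have xn: "x n \<in> {0..T}" for n by blast
    have "(\<lambda>n. LINT r|lborel. h (x n) r) \<longlonglongrightarrow> (LINT r|lborel. h t r)"
    proof (rule integral_dominated_convergence[where w = "\<lambda>r. B * indicator {0..T} r"])
      show "integrable lborel (\<lambda>r. B * indicator {0..T} r)"
        by (intro integrable_mult_right integrable_real_indicator) (simp_all add: emeasure_lborel_Icc_eq)
      show "AE r in lborel. (\<lambda>n. h (x n) r) \<longlonglongrightarrow> h t r"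
      proof (intro AE_I2)
        fix r
        have "isCont om (t - r)" using om by (simp add: continuous_on_eq_continuous_at)
        moreover have "(\<lambda>n. x n - r) \<longlonglongrightarrow> t - r" using x by (intro tendsto_intros) auto
        ultimately have "(\<lambda>n. om (x n - r)) \<longlonglongrightarrow> om (t - r)" by (rule isCont_tendsto_compose)
        then show "(\<lambda>n. h (x n) r) \<longlonglongrightarrow> h t r" unfolding h_def by (intro tendsto_intros)
      qed
      show "AE r in lborel. norm (h (x n) r) \<le> B * indicator {0..T} r" for n
        by (intro AE_I2 hb xn)
    qed (rule hm)+
    then show "(conv om v \<circ> x) \<longlonglongrightarrow> conv om v t" by (simp only: comp_def eq[OF x(1)] eq[OF xn])
  qed
qed

end

locale KS_controlled = KS_spectrum +
  fixes T :: real and y0 :: L2 and u1 u1' u2 u2' :: "real \<Rightarrow> real"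
  assumes T: "T > 0" and y0: "y0 \<in> L2_on L" and u1: "control u1 u1'" and u2: "control u2 u2'"
begin

lemmas cu = controlD(2,3)[OF u1] controlD(2,3)[OF u2]

definition source :: "(real \<Rightarrow> real) \<Rightarrow> (real \<Rightarrow> real) \<Rightarrow> real \<Rightarrow> L2" where
  "source p1 p2 s = KS_source L lam T p1 (L2_of T u1) s + KS_source L lam T p2 (L2_of T u2) s"

definition forced :: "(real \<Rightarrow> real) \<Rightarrow> (real \<Rightarrow> real) \<Rightarrow> real \<Rightarrow> L2" where
  "forced p1 p2 t = - (conv u1' (L2_of L p1) t + conv u1 (lifted p1) t) - (conv u2' (L2_of L p2) t + conv u2 (lifted p2) t)"

definition state :: "(real \<Rightarrow> real) \<Rightarrow> (real \<Rightarrow> real) \<Rightarrow> real \<Rightarrow> L2" where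
  "state p1 p2 t = S t y0 + forced p1 p2 t + u1 t *\<^sub>R L2_of L p1 + u2 t *\<^sub>R L2_of L p2"

text \<open>
  The source involves an arbitrary representative of the derivative of the control, so the integrand is
  first made measurable by writing it as a combination of products, and then compared almost
  everywhere with a continuous one.
\<close>
lemma mild_integral:
  assumes t: "t \<in> {0..T}"
  shows "set_integrable lborel {0..t} (\<lambda>s. S (t - s) (source p1 p2 s))"
    "(LINT s:{0..t}|lborel. S (t - s) (source p1 p2 s)) = forced p1 p2 t"
proof -
  define i where "i v s = indicator {0..t} s *\<^sub>R S (t - s) v" for v s
  have im [measurable]: "i v \<in> borel_measurable borel" for v
    unfolding i_def using borel_measurable_continuous_on_indicator[OF _ S_shift_continuous[of t v]] by simp
  have ium: "(\<lambda>s. om s *\<^sub>R i v s) \<in> borel_measurable borel" if "continuous_on {0..t} om" for om v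
    using borel_measurable_continuous_on_indicator[OF _ continuous_on_scaleR[OF that S_shift_continuous[of t v]]]
    by (simp add: i_def mult.commute)
  have ii: "integrable lborel (\<lambda>s. om s *\<^sub>R i v s)" if "continuous_on {0..t} om" for om v
    using conv_integrable[OF that, of v] by (simp add: set_integrable_def i_def mult.commute)
  have iJ: "(LINT s|lborel. om s *\<^sub>R i v s) = conv om v t" for om v
    by (simp add: conv_def set_lebesgue_integral_def i_def mult.commute)
  define r1 where "r1 = rep_L2 (L2_of T u1')"
  define r2 where "r2 = rep_L2 (L2_of T u2')"
  have rm [measurable]: "r1 \<in> borel_measurable borel" "r2 \<in> borel_measurable borel" by (simp_all add: r1_def r2_def)
  let ?f = "\<lambda>s. indicator {0..t} s *\<^sub>R S (t - s) (source p1 p2 s)"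
  let ?g = "\<lambda>s. - (u1' s *\<^sub>R i (L2_of L p1) s + u1 s *\<^sub>R i (lifted p1) s) - (u2' s *\<^sub>R i (L2_of L p2) s + u2 s *\<^sub>R i (lifted p2) s)"
  have fpt: "?f s = - (r1 s *\<^sub>R i (L2_of L p1) s + u1 s *\<^sub>R i (lifted p1) s) - (r2 s *\<^sub>R i (L2_of L p2) s + u2 s *\<^sub>R i (lifted p2) s)" for s
  proof -
    show ?thesis
    proof (cases "s \<in> {0..t}")
      case True
      then have sT: "s \<in> {0..T}" and ts: "t - s \<ge> 0" using t by auto
      have F: "source p1 p2 s = (-1) *\<^sub>R (r1 s *\<^sub>R L2_of L p1 + u1 s *\<^sub>R lifted p1) + (-1) *\<^sub>R (r2 s *\<^sub>R L2_of L p2 + u2 s *\<^sub>R lifted p2)"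
        unfolding source_def KS_source_def lifted_def r1_def r2_def
        using control_sobolev(2,3)[OF u1 T] control_sobolev(2,3)[OF u2 T] sT by simp
      show ?thesis
        unfolding F i_def S_add[OF ts] S_scale[OF ts] using True by simp
    qed (simp add: i_def)
  qed
  have fm: "?f \<in> borel_measurable lborel"
    unfolding fpt using ium[OF cu(1)] ium[OF cu(3)] by measurable
  have gi: "integrable lborel ?g" by (intro Bochner_Integration.integrable_diff Bochner_Integration.integrable_minus Bochner_Integration.integrable_add ii cu)
  have AE: "AE s in lborel. ?f s = ?g s"
  proof -
    have a: "AE s in lborel. r1 s = indicator {0<..<T} s * u1' s" "AE s in lborel. r2 s = indicator {0<..<T} s * u2' s"
      unfolding r1_def r2_def L2_of_def by (intro rep_abs_L2 square_integrable_continuous cu)+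
    have b: "AE s in lborel. s \<noteq> 0" "AE s in lborel. s \<noteq> T" by (rule AE_lborel_singleton)+
    show ?thesis
      using a b
    proof eventually_elim
      case (elim s)
      show ?case
      proof (cases "s \<in> {0..t}")
        case True
        then have "s \<in> {0<..<T}" using elim t by auto
        then show ?thesis unfolding fpt using elim by simp
      next
        case False
        then show ?thesis by (simp add: i_def)
      qed
    qed
  qed
  show "set_integrable lborel {0..t} (\<lambda>s. S (t - s) (source p1 p2 s))"
    unfolding set_integrable_def
    by (rule integrable_cong_AE[THEN iffD2, OF fm borel_measurable_integrable[OF gi] AE gi])
  have "(LINT s:{0..t}|lborel. S (t - s) (source p1 p2 s)) = (LINT s|lborel. ?g s)"
    unfolding set_lebesgue_integral_def
    by (rule integral_cong_AE[OF fm borel_measurable_integrable[OF gi] AE])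
  also have "\<dots> = - ((LINT s|lborel. u1' s *\<^sub>R i (L2_of L p1) s) + (LINT s|lborel. u1 s *\<^sub>R i (lifted p1) s))
      - ((LINT s|lborel. u2' s *\<^sub>R i (L2_of L p2) s) + (LINT s|lborel. u2 s *\<^sub>R i (lifted p2) s))"
    by (simp add: ii cu)
  finally show "(LINT s:{0..t}|lborel. S (t - s) (source p1 p2 s)) = forced p1 p2 t"
    unfolding iJ forced_def .
qed

text \<open>
  An integration by parts in time removes the derivatives of the controls. The coefficients of the
  liftings cancel, and only their prescribed boundary values at \<open>0\<close> survive. Hence the state does not
  depend on the lifting, and it vanishes at time \<open>T\<close> if and only if the controls solve one moment
  equation for each mode.
\<close>
lemma state_coef:
  assumes t: "t \<ge> 0" and p: "lifting L p1 p2"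
  shows "coef (state p1 p2 t) k =
    exp (- nu k * t) * coef y0 k + sqrt (2 / L) * freq L k * integral {0..t} (\<lambda>s. exp (- nu k * (t - s)) * ((m k - lam) * u1 s - u2 s))"
proof -
  define I1 where "I1 = integral {0..t} (\<lambda>s. u1 s * exp (- nu k * (t - s)))"
  define I2 where "I2 = integral {0..t} (\<lambda>s. u2 s * exp (- nu k * (t - s)))"
  define P1 where "P1 = coef (L2_of L p1) k"
  define P2 where "P2 = coef (L2_of L p2) k"
  define r where "r = sqrt (2 / L) * freq L k"
  have Q1: "coef (lifted p1) k = nu k * P1 + r * (lam - m k)"
    using lifted_coef[of p1 k] p by (simp add: lifting_def P1_def r_def)
  have Q2: "coef (lifted p2) k = nu k * P2 + r"
    using lifted_coef[of p2 k] p by (simp add: lifting_def P2_def r_def)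
  have J1: "coef (conv u1' v t) k = coef v k * (u1 t - nu k * I1)" "coef (conv u1 v t) k = coef v k * I1" for v
    by (simp_all only: conv_coef[OF cu(1)] conv_coef[OF cu(2)] I1_def exp_convolution_by_parts[OF u1 t])
  have J2: "coef (conv u2' v t) k = coef v k * (u2 t - nu k * I2)" "coef (conv u2 v t) k = coef v k * I2" for v
    by (simp_all only: conv_coef[OF cu(3)] conv_coef[OF cu(4)] I2_def exp_convolution_by_parts[OF u2 t])
  have "coef (state p1 p2 t) k = exp (- nu k * t) * coef y0 k
      + (- (P1 * (u1 t - nu k * I1) + (nu k * P1 + r * (lam - m k)) * I1) - (P2 * (u2 t - nu k * I2) + (nu k * P2 + r) * I2))
      + u1 t * P1 + u2 t * P2"
    unfolding state_def forced_def
    by (simp only: inner_add_left inner_diff_left inner_minus_left inner_scaleR_left S_coef[OF t] J1 J2 Q1 Q2 P1_def P2_def)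
  also have "\<dots> = exp (- nu k * t) * coef y0 k + r * ((m k - lam) * I1 - I2)"
    by algebra
  also have "(m k - lam) * I1 - I2 = integral {0..t} (\<lambda>s. (m k - lam) * (u1 s * exp (- nu k * (t - s))) - u2 s * exp (- nu k * (t - s)))"
    unfolding I1_def I2_def
    by (subst integral_diff) (auto intro!: integrable_continuous_real continuous_intros cu)
  also have "(\<lambda>s. (m k - lam) * (u1 s * exp (- nu k * (t - s))) - u2 s * exp (- nu k * (t - s))) =
      (\<lambda>s. exp (- nu k * (t - s)) * ((m k - lam) * u1 s - u2 s))"
    by (rule ext) algebra
  finally show ?thesis by (simp only: r_def)
qed

lemma state_in:
  assumes t: "t \<ge> 0" and p: "lifting L p1 p2"
  shows "state p1 p2 t \<in> L2_on L"
proof -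
  have neg: "- f \<in> L2_on L" if "f \<in> L2_on L" for f
    using L2_on_scale[OF that, of "-1"] by simp
  have "L2_of L p1 \<in> L2_on L" "L2_of L p2 \<in> L2_on L"
    using p smooth_on_continuous[of L _ 0] by (auto simp: lifting_def intro!: L2_of_continuous_in_L2_on)
  then show ?thesis
    unfolding state_def forced_def by (intro L2_on_add L2_on_diff neg L2_on_scale S_in[OF t] conv_in cu)
qed

lemma state_continuous: "continuous_on {0..T} (state p1 p2)"
proof -
  have "continuous_on {0..T} (\<lambda>t. S t y0)"
    by (rule continuous_on_subset[OF S_continuous]) auto
  then show ?thesis
    unfolding state_def[abs_def] forced_def
    by (intro continuous_intros conv_continuous cu controlD(4,5)[OF u1] controlD(4,5)[OF u2])
qed

lemma state_independent_of_lifting: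
  assumes "t \<ge> 0" "lifting L p1 p2" "lifting L q1 q2"
  shows "state p1 p2 t = state q1 q2 t"
  using assms by (intro coef_eqI) (simp_all add: state_in state_coef)

lemma state_KS_solution:
  assumes q: "lifting L q1 q2"
  shows "KS_solution L lam T y0 (L2_of T u1) (L2_of T u2) (state q1 q2)"
  unfolding KS_solution_def
proof (intro conjI ballI allI impI)
  show "continuous_on {0..T} (state q1 q2)" by (rule state_continuous)
  show "state q1 q2 t \<in> L2_on L" if "t \<in> {0..T}" for t using state_in[OF _ q] that by simp
  fix p1 p2 assume p: "lifting L p1 p2"
  have pv: "point_value T (L2_of T u1) t = u1 t" "point_value T (L2_of T u2) t = u2 t" if "t \<in> {0..T}" for t
    using control_sobolev(3)[OF u1 T that] control_sobolev(3)[OF u2 T that] by simp_all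
  define z where "z t = S t y0 + (LINT s:{0..t}|lborel. S (t - s) (source p1 p2 s))" for t
  have "mild_solution (L2_on L) (KS_domain L) (KS_op L lam) T (source p1 p2) y0 z"
    unfolding mild_solution_def
    by (intro exI[of _ S] conjI ballI S_C0_semigroup S_generator z_def mild_integral(1))
  moreover have "state q1 q2 t = z t + u1 t *\<^sub>R L2_of L p1 + u2 t *\<^sub>R L2_of L p2" if t: "t \<in> {0..T}" for t
    using state_independent_of_lifting[OF _ q p, of t] t by (simp add: z_def mild_integral(2)[OF t] state_def)
  moreover have "y0 - point_value T (L2_of T u1) 0 *\<^sub>R L2_of L p1 - point_value T (L2_of T u2) 0 *\<^sub>R L2_of L p2 = y0"
    using pv[of 0] controlD(4)[OF u1, of 0] controlD(4)[OF u2, of 0] T by simp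
  ultimately show "\<exists>z. mild_solution (L2_on L) (KS_domain L) (KS_op L lam) T
       (\<lambda>s. KS_source L lam T p1 (L2_of T u1) s + KS_source L lam T p2 (L2_of T u2) s)
       (y0 - point_value T (L2_of T u1) 0 *\<^sub>R L2_of L p1 - point_value T (L2_of T u2) 0 *\<^sub>R L2_of L p2) z \<and>
     (\<forall>t\<in>{0..T}. state q1 q2 t = z t + point_value T (L2_of T u1) t *\<^sub>R L2_of L p1 + point_value T (L2_of T u2) t *\<^sub>R L2_of L p2)"
    unfolding source_def[abs_def] by (intro exI[of _ z] conjI ballI) (simp_all only: pv)
qed

lemma state_T_zero:
  assumes p: "lifting L p1 p2"
    and moment: "\<And>k. coef y0 k + sqrt (2 / L) * freq L k * integral {0..T} (\<lambda>s. exp (nu k * s) * ((m k - lam) * u1 s - u2 s)) = 0"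
  shows "state p1 p2 T = 0"
proof (rule coef_eqI[OF state_in[OF _ p] L2_on_zero])
  fix k
  have e: "exp (- nu k * (T - s)) = exp (- nu k * T) * exp (nu k * s)" for s
    by (simp add: right_diff_distrib flip: exp_add)
  have "integral {0..T} (\<lambda>s. exp (- nu k * (T - s)) * ((m k - lam) * u1 s - u2 s)) =
      exp (- nu k * T) * integral {0..T} (\<lambda>s. exp (nu k * s) * ((m k - lam) * u1 s - u2 s))"
    unfolding e mult.assoc by simp
  then have "coef (state p1 p2 T) k = exp (- nu k * T) * (coef y0 k + sqrt (2 / L) * freq L k * integral {0..T} (\<lambda>s. exp (nu k * s) * ((m k - lam) * u1 s - u2 s)))"
    unfolding state_coef[OF less_imp_le[OF T] p] by (simp only: distrib_left mult_ac)
  then show "coef (state p1 p2 T) k = coef 0 k" by (simp add: moment)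
qed (use T in simp)

end

theorem theorem4p5:
  fixes L lam T :: real and y0 :: L2
  assumes "L > 0" and "lam > 0" and "T > 0" and "y0 \<in> L2_on L"
  shows "\<exists>u1\<in>sobolev 1 T. \<exists>u2\<in>sobolev 1 T. \<exists>y.
           KS_solution L lam T y0 u1 u2 y \<and> y T = 0"
proof -
  interpret KS_spectrum L lam by unfold_locales (use assms in auto)
  have "\<bar>coef y0 k\<bar> \<le> norm y0" for k
  proof -
    have "norm (mode L k) = 1" using ortho[of k k] by (simp add: norm_eq_sqrt_inner)
    then show ?thesis using Cauchy_Schwarz_ineq2[of y0 "mode L k"] by simp
  qed
  then obtain u1 u1' u2 u2' where u: "control u1 u1'" "control u2 u2'"
    and moment: "\<And>k. coef y0 k + sqrt (2 / L) * freq L k * integral {0..T} (\<lambda>s. exp (nu k * s) * ((m k - lam) * u1 s - u2 s)) = 0"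
    by (rule flat_controls[OF _ assms(3)]) (rule that)
  interpret KS_controlled L lam T y0 u1 u1' u2 u2'
    by unfold_locales (use assms u in auto)
  note std = lifting_exists[OF L]
  show ?thesis
    using state_KS_solution[OF std] state_T_zero[OF std moment]
      control_sobolev(1)[OF u(1) T] control_sobolev(1)[OF u(2) T] by blast
qed

end
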